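(* Let $V$ be an integral domain such that at least one of the following holds: (1) $V$ is a valuation ring of a global field $K$ with $V\neq K$; (2) $V$ is a discrete valuation domain with finite residue field such that the quotient field of $V$ is a purely transcendental extension, of transcendence degree at least $1$, of some (arbitrary) field; (3) $V$ is a discrete valuation domain with finite residue field such that the quotient field $K$ of $V$ is a finite extension of a field $L$ that admits a valuation ring $W_L$ (of $L$) independent from $V \cap L$ such that the maximal ideal of $W_L$ is non-zero and principal or the residue field of $W_L$ is finite. Then for all positive integers $k$ and all integers $1 < n_1 \leq \ldots \leq n_k$, there exists $H \in \operatorname{Int}(V)$ which has precisely $k$ essentially different factorizations into irreducible elements of $\operatorname{Int}(V)$, and the lengths of these $k$ factorizations (counted with multiplicity, in a suitable order) are exactly $n_1,\ldots,n_k$.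
   Context: For an integral domain $R$ with quotient field $K$, $\operatorname{Int}(R)=\{f\in K[X]\mid f(R)\subseteq R\}$ is the ring of integer-valued polynomials on $R$ (a subring of $K[X]$). A global field is a finite extension of $\mathbb{Q}$ or of a rational function field $\mathbb F(T)$ in one variable over a finite field $\mathbb F$. A discrete valuation domain is the valuation ring of a valuation on a field with value group isomorphic to $\mathbb{Z}$ (rank one, not a field). A valuation ring of a field $K$ is the valuation ring of a valuation $\mathsf v:K^\times\to G$ into a totally ordered abelian group $G$ (of arbitrary rank), i.e. $\{0\}\cup\{x\in K^\times \mid \mathsf v(x)\ge 0\}$. Two valuation rings of a field $L$ are independent if the smallest subring of $L$ containing both is $L$ itself. An element $r$ of an integral domain $R$ is irreducible if it is a non-zero non-unit that is not the product of two non-units of $R$. A factorization of $r$ is a decomposition $r=a_1\cdots a_n$ into irreducible elements of $R$; $n$ is its length. Two factorizations $r=a_1\cdots a_n=u_1\cdots u_m$ are essentially the same if $n=m$ and, after re-indexing, $u_i=\varepsilon_i a_i$ with a unit $\varepsilon_i\in R$ for all $i$; otherwise they are essentially different. *)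

theory Defs
  imports
    "HOL-Algebra.Group"
    "HOL-Library.Poly_Mapping"
    "HOL-Computational_Algebra.Computational_Algebra"
begin

text \<open>All rings and fields occurring here are subsets of one ambient commutative ring type.\<close>

definition is_subring :: "'a::comm_ring_1 set \<Rightarrow> bool" where
  "is_subring R \<longleftrightarrow> 1 \<in> R \<and> (\<forall>x\<in>R. \<forall>y\<in>R. x - y \<in> R \<and> x * y \<in> R)"

definition is_subfield :: "'a::field set \<Rightarrow> bool" where
  "is_subfield F \<longleftrightarrow> is_subring F \<and> (\<forall>x\<in>F. x \<noteq> 0 \<longrightarrow> inverse x \<in> F)"

definition subring_generated :: "'a::comm_ring_1 set \<Rightarrow> 'a set" where
  "subring_generated S = \<Inter>{R. is_subring R \<and> S \<subseteq> R}"

definition field_adjoin :: "'a::field set \<Rightarrow> 'a set \<Rightarrow> 'a set" where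
  "field_adjoin k B = \<Inter>{F. is_subfield F \<and> k \<union> B \<subseteq> F}"

definition is_quotient_field :: "'a::field set \<Rightarrow> 'a set \<Rightarrow> bool" where
  "is_quotient_field R K \<longleftrightarrow> K = {a / b | a b. a \<in> R \<and> b \<in> R \<and> b \<noteq> 0}"

definition finite_extension :: "'a::field set \<Rightarrow> 'a set \<Rightarrow> bool" where
  "finite_extension L K \<longleftrightarrow> is_subfield L \<and> is_subfield K \<and> L \<subseteq> K \<and>
     (\<exists>B. finite B \<and> B \<subseteq> K \<and>
        (\<forall>x\<in>K. \<exists>c. (\<forall>b\<in>B. c b \<in> L) \<and> x = (\<Sum>b\<in>B. c b * b)))"


subsection \<open>Purely transcendental extensions and global fields\<close>

text \<open>
  A polynomial with coefficients in \<open>k\<close> whose variables are indexed by the elements of \<open>B\<close>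
  is a finitely supported map from monomials (finitely supported exponent functions) to
  coefficients. \<open>mpoly_value\<close> substitutes \<open>b\<close> for the variable indexed by \<open>b\<close>.
\<close>

definition mpoly_over ::
  "'a::field set \<Rightarrow> 'a set \<Rightarrow> (('a \<Rightarrow>\<^sub>0 nat) \<Rightarrow>\<^sub>0 'a) set" where
  "mpoly_over k B =
     {p. \<forall>m \<in> Poly_Mapping.keys p. Poly_Mapping.lookup p m \<in> k \<and> Poly_Mapping.keys m \<subseteq> B}"

definition mpoly_value :: "(('a::field \<Rightarrow>\<^sub>0 nat) \<Rightarrow>\<^sub>0 'a) \<Rightarrow> 'a" where
  "mpoly_value p =
     (\<Sum>m \<in> Poly_Mapping.keys p.
        Poly_Mapping.lookup p m * (\<Prod>b \<in> Poly_Mapping.keys m. b ^ Poly_Mapping.lookup m b))"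

definition alg_independent :: "'a::field set \<Rightarrow> 'a set \<Rightarrow> bool" where
  "alg_independent k B \<longleftrightarrow> (\<forall>p \<in> mpoly_over k B. mpoly_value p = 0 \<longrightarrow> p = 0)"

text \<open>\<open>K\<close> is purely transcendental over \<open>k\<close> with algebraically independent generating set
  \<open>B\<close>; the transcendence degree is the cardinality of \<open>B\<close>.\<close>

definition purely_transcendental :: "'a::field set \<Rightarrow> 'a set \<Rightarrow> 'a set \<Rightarrow> bool" where
  "purely_transcendental k B K \<longleftrightarrow>
     is_subfield k \<and> alg_independent k B \<and> K = field_adjoin k B"

text \<open>In characteristic zero the quotients of (images of) integers form the copy of the
  rational numbers inside the ambient field.\<close>

definition global_field :: "'a::field set \<Rightarrow> bool" where
  "global_field K \<longleftrightarrow>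
     (CHAR('a) = 0 \<and> finite_extension {of_int a / of_int b | a b. b \<noteq> 0} K) \<or>
     (\<exists>F T L. finite F \<and> purely_transcendental F {T} L \<and> finite_extension L K)"


subsection \<open>Valuation rings\<close>

text \<open>
  Value groups are groups \<open>G\<close> of \<open>HOL-Algebra\<close> (hence written multiplicatively), together
  with the relation \<open>r\<close>, where \<open>(g, h) \<in> r\<close> means that \<open>g\<close> is less than or equal to \<open>h\<close>.
\<close>

definition ordered_abelian_group :: "('g, 'm) monoid_scheme \<Rightarrow> ('g \<times> 'g) set \<Rightarrow> bool" where
  "ordered_abelian_group G r \<longleftrightarrow> comm_group G \<and> linear_order_on (carrier G) r \<and>
     (\<forall>a\<in>carrier G. \<forall>b\<in>carrier G. \<forall>c\<in>carrier G.
        (a, b) \<in> r \<longrightarrow> (a \<otimes>\<^bsub>G\<^esub> c, b \<otimes>\<^bsub>G\<^esub> c) \<in> r)"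

text \<open>The last clause says that \<open>v (x + y)\<close> is at least the minimum of \<open>v x\<close> and \<open>v y\<close>.
  The value of \<open>v\<close> at \<open>0\<close> is irrelevant.\<close>

definition is_valuation ::
  "'a::field set \<Rightarrow> ('g, 'm) monoid_scheme \<Rightarrow> ('g \<times> 'g) set \<Rightarrow> ('a \<Rightarrow> 'g) \<Rightarrow> bool" where
  "is_valuation L G r v \<longleftrightarrow> is_subfield L \<and> ordered_abelian_group G r \<and>
     v \<in> L - {0} \<rightarrow> carrier G \<and>
     (\<forall>x\<in>L - {0}. \<forall>y\<in>L - {0}. v (x * y) = v x \<otimes>\<^bsub>G\<^esub> v y) \<and>
     (\<forall>x\<in>L - {0}. \<forall>y\<in>L - {0}. x + y \<noteq> 0 \<longrightarrow> (v x, v (x + y)) \<in> r \<or> (v y, v (x + y)) \<in> r)"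

definition ring_of_valuation ::
  "'a::field set \<Rightarrow> ('g, 'm) monoid_scheme \<Rightarrow> ('g \<times> 'g) set \<Rightarrow> ('a \<Rightarrow> 'g) \<Rightarrow> 'a set" where
  "ring_of_valuation L G r v = {0} \<union> {x \<in> L - {0}. (\<one>\<^bsub>G\<^esub>, v x) \<in> r}"

text \<open>
  The value group ranges over all ordered abelian groups whose carrier consists of subsets
  of the ambient field. This is no restriction: the image of a valuation \<open>v\<close> is isomorphic
  to the group of cosets of the kernel of \<open>v\<close>; see \<open>valuation_ring_ofI\<close> below.
\<close>

definition valuation_ring_of :: "'a::field set \<Rightarrow> 'a set \<Rightarrow> bool" where
  "valuation_ring_of L W \<longleftrightarrow>
     (\<exists>(G :: 'a set monoid) r v. is_valuation L G r v \<and> W = ring_of_valuation L G r v)"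

text \<open>An order isomorphism (a value group isomorphic to the integers is ordered like the
  integers up to sign) turns the value group into the integers themselves.\<close>

abbreviation (input) int_add_group :: "int monoid" where
  "int_add_group \<equiv> \<lparr>carrier = UNIV, monoid.mult = (+), one = 0\<rparr>"

definition discrete_valuation_ring_of :: "'a::field set \<Rightarrow> 'a set \<Rightarrow> bool" where
  "discrete_valuation_ring_of K V \<longleftrightarrow>
     (\<exists>v. is_valuation K int_add_group {(a, b). a \<le> b} v \<and> v ` (K - {0}) = UNIV \<and>
          V = ring_of_valuation K int_add_group {(a, b). a \<le> b} v)"

definition is_ideal :: "'a::comm_ring_1 set \<Rightarrow> 'a set \<Rightarrow> bool" where
  "is_ideal J R \<longleftrightarrow> J \<subseteq> R \<and> 0 \<in> J \<and> (\<forall>x\<in>J. \<forall>y\<in>J. x + y \<in> J) \<and> (\<forall>x\<in>J. \<forall>a\<in>R. a * x \<in> J)"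

definition is_maximal_ideal :: "'a::comm_ring_1 set \<Rightarrow> 'a set \<Rightarrow> bool" where
  "is_maximal_ideal M R \<longleftrightarrow> is_ideal M R \<and> M \<noteq> R \<and>
     (\<forall>J. is_ideal J R \<and> M \<subseteq> J \<longrightarrow> J = M \<or> J = R)"

definition is_principal_ideal :: "'a::comm_ring_1 set \<Rightarrow> 'a set \<Rightarrow> bool" where
  "is_principal_ideal J R \<longleftrightarrow> (\<exists>t\<in>R. J = {a * t | a. a \<in> R})"

definition residue_classes :: "'a::comm_ring_1 set \<Rightarrow> 'a set \<Rightarrow> 'a set set" where
  "residue_classes R J = R // {(x, y). x \<in> R \<and> y \<in> R \<and> x - y \<in> J}"

text \<open>For local rings, where the maximal ideal is unique.\<close>

definition finite_residue_field :: "'a::comm_ring_1 set \<Rightarrow> bool" where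
  "finite_residue_field R \<longleftrightarrow> (\<exists>M. is_maximal_ideal M R \<and> finite (residue_classes R M))"

definition nonzero_principal_maximal_ideal :: "'a::comm_ring_1 set \<Rightarrow> bool" where
  "nonzero_principal_maximal_ideal R \<longleftrightarrow>
     (\<exists>M. is_maximal_ideal M R \<and> M \<noteq> {0} \<and> is_principal_ideal M R)"

definition independent_in :: "'a::field set \<Rightarrow> 'a set \<Rightarrow> 'a set \<Rightarrow> bool" where
  "independent_in L A B \<longleftrightarrow> subring_generated (A \<union> B) = L"

lemma valuation_ring_ofI:
  fixes L :: "'a::field set" and G :: "('g, 'm) monoid_scheme"
  assumes v: "is_valuation L G r v"
  shows "valuation_ring_of L (ring_of_valuation L G r v)"
proof -
  define U where "U = L - {0}"
  have F: "is_subfield L" and O: "ordered_abelian_group G r"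
    and vU: "\<And>x. x \<in> U \<Longrightarrow> v x \<in> carrier G"
    and vm: "\<And>x y. x \<in> U \<Longrightarrow> y \<in> U \<Longrightarrow> v (x * y) = v x \<otimes>\<^bsub>G\<^esub> v y"
    and va: "\<And>x y. x \<in> U \<Longrightarrow> y \<in> U \<Longrightarrow> x + y \<noteq> 0 \<Longrightarrow>
               (v x, v (x + y)) \<in> r \<or> (v y, v (x + y)) \<in> r"
    using v by (auto simp: is_valuation_def U_def)
  interpret G: comm_group G
    using O by (simp add: ordered_abelian_group_def)
  have U1: "1 \<in> U" and Um: "\<And>x y. x \<in> U \<Longrightarrow> y \<in> U \<Longrightarrow> x * y \<in> U"
    and Ui: "\<And>x. x \<in> U \<Longrightarrow> inverse x \<in> U"
    using F by (auto simp: is_subfield_def is_subring_def U_def)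
  have Ua: "x + y \<in> U" if "x \<in> U" "y \<in> U" "x + y \<noteq> 0" for x y
  proof -
    have "0 - y \<in> L"
      using F that(2) unfolding is_subfield_def is_subring_def U_def
      by (metis DiffD1 diff_self)
    then have "x - (0 - y) \<in> L"
      using F that(1) unfolding is_subfield_def is_subring_def U_def by blast
    then show ?thesis using that(3) by (simp add: U_def)
  qed
  have v1: "v 1 = \<one>\<^bsub>G\<^esub>"
    using vm[OF U1 U1] vU[OF U1] by simp
  have lin: "linear_order_on (carrier G) r"
    and tr: "\<And>a b c. a \<in> carrier G \<Longrightarrow> b \<in> carrier G \<Longrightarrow> c \<in> carrier G \<Longrightarrow>
               (a, b) \<in> r \<Longrightarrow> (a \<otimes>\<^bsub>G\<^esub> c, b \<otimes>\<^bsub>G\<^esub> c) \<in> r"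
    using O by (auto simp: ordered_abelian_group_def)
  define j where "j g = {x \<in> U. v x = g}" for g
  define s where "s P = v (SOME x. x \<in> P)" for P
  have sj: "s (j (v x)) = v x" if "x \<in> U" for x
  proof -
    have "(SOME y. y \<in> j (v x)) \<in> j (v x)"
      by (rule someI[of _ x]) (use that in \<open>simp add: j_def\<close>)
    then show ?thesis by (simp add: s_def j_def)
  qed
  have jeq: "j (v x) = j (v y) \<longleftrightarrow> v x = v y" if "x \<in> U" "y \<in> U" for x y
    using sj that by metis
  define H :: "'a set monoid" where
    "H = \<lparr>carrier = (\<lambda>x. j (v x)) ` U, monoid.mult = (\<lambda>P Q. j (s P \<otimes>\<^bsub>G\<^esub> s Q)), one = j \<one>\<^bsub>G\<^esub>\<rparr>"
  define q where "q = {(j (v x), j (v y)) | x y. x \<in> U \<and> y \<in> U \<and> (v x, v y) \<in> r}"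
  have cH: "carrier H = (\<lambda>x. j (v x)) ` U" and oH: "\<one>\<^bsub>H\<^esub> = j (v 1)"
    by (simp_all add: H_def v1)
  have mH: "j (v x) \<otimes>\<^bsub>H\<^esub> j (v y) = j (v (x * y))" if "x \<in> U" "y \<in> U" for x y
    using that by (simp add: H_def sj vm)
  have qiff: "(j (v x), j (v y)) \<in> q \<longleftrightarrow> (v x, v y) \<in> r" if "x \<in> U" "y \<in> U" for x y
    using that by (auto simp: q_def jeq)
  have CH: "comm_group H"
  proof (rule comm_groupI)
    show "\<exists>y\<in>carrier H. y \<otimes>\<^bsub>H\<^esub> P = \<one>\<^bsub>H\<^esub>" if P: "P \<in> carrier H" for P
    proof -
      obtain x where x: "x \<in> U" "P = j (v x)" using P by (auto simp: cH)
      have "j (v (inverse x)) \<otimes>\<^bsub>H\<^esub> P = \<one>\<^bsub>H\<^esub>"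
        using x Ui mH oH by (simp add: U_def)
      then show ?thesis using Ui x by (auto simp: cH)
    qed
  qed (auto simp: cH oH mH U1 Um ac_simps)
  have q: "linear_order_on (carrier H) q"
    unfolding order_on_defs
  proof (intro conjI)
    show "q \<subseteq> carrier H \<times> carrier H" by (auto simp: q_def cH)
    show "refl_on (carrier H) q"
      using lin vU by (auto simp: refl_on_def cH qiff order_on_defs)
    show "trans q"
    proof (rule transI)
      fix P Q R assume PQ: "(P, Q) \<in> q" and QR: "(Q, R) \<in> q"
      obtain x y z where "x \<in> U" "y \<in> U" "z \<in> U" "P = j (v x)" "Q = j (v y)" "R = j (v z)"
        using PQ QR by (auto simp: q_def)
      then show "(P, R) \<in> q"
        using PQ QR lin by (auto simp: qiff order_on_defs dest: transD)
    qed
    show "antisym q"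
    proof (rule antisymI)
      fix P Q assume PQ: "(P, Q) \<in> q" and QP: "(Q, P) \<in> q"
      obtain x y where "x \<in> U" "y \<in> U" "P = j (v x)" "Q = j (v y)"
        using PQ by (auto simp: q_def)
      then show "P = Q"
        using PQ QP lin by (auto simp: qiff order_on_defs dest: antisymD)
    qed
    show "total_on (carrier H) q"
      using lin vU by (auto simp: total_on_def cH qiff jeq order_on_defs)
  qed
  have "(j (v (x * z)), j (v (y * z))) \<in> q"
    if "x \<in> U" "y \<in> U" "z \<in> U" "(v x, v y) \<in> r" for x y z
  proof -
    have "(v (x * z), v (y * z)) \<in> r"
      using that tr[of "v x" "v y" "v z"] by (simp add: vm vU)
    then show ?thesis using that by (simp only: qiff Um)
  qed
  then have "ordered_abelian_group H q"
    unfolding ordered_abelian_group_def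
    using CH q by (auto simp: cH mH qiff)
  then have "is_valuation L H q (\<lambda>x. j (v x))"
    unfolding is_valuation_def U_def[symmetric]
    using F va Ua by (auto simp: cH mH qiff)
  moreover have "ring_of_valuation L G r v = ring_of_valuation L H q (\<lambda>x. j (v x))"
    using U1 by (auto simp: ring_of_valuation_def U_def[symmetric] oH qiff v1[symmetric])
  ultimately show ?thesis
    unfolding valuation_ring_of_def by blast
qed


subsection \<open>Factorizations\<close>

definition units_in :: "'a::comm_ring_1 set \<Rightarrow> 'a set" where
  "units_in R = {u \<in> R. \<exists>w\<in>R. u * w = 1}"

definition irreducible_in :: "'a::comm_ring_1 set \<Rightarrow> 'a \<Rightarrow> bool" where
  "irreducible_in R r \<longleftrightarrow> r \<in> R \<and> r \<noteq> 0 \<and> r \<notin> units_in R \<and>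
     \<not> (\<exists>a\<in>R - units_in R. \<exists>b\<in>R - units_in R. r = a * b)"

text \<open>The empty list is only a factorization of \<open>1\<close>.\<close>

definition factorization_in :: "'a::comm_ring_1 set \<Rightarrow> 'a \<Rightarrow> 'a list \<Rightarrow> bool" where
  "factorization_in R r as \<longleftrightarrow> (\<forall>a\<in>set as. irreducible_in R a) \<and> r = prod_list as"

definition essentially_same_in :: "'a::comm_ring_1 set \<Rightarrow> 'a list \<Rightarrow> 'a list \<Rightarrow> bool" where
  "essentially_same_in R as us \<longleftrightarrow> length as = length us \<and>
     (\<exists>\<pi>. bij_betw \<pi> {..<length us} {..<length as} \<and>
          (\<forall>i<length us. \<exists>\<epsilon>\<in>units_in R. us ! i = \<epsilon> * as ! \<pi> i))"


subsection \<open>Integer-valued polynomials\<close>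

text \<open>For a subring \<open>R\<close> whose quotient field is the whole ambient field.\<close>

definition Int_poly :: "'a::field set \<Rightarrow> 'a poly set" where
  "Int_poly R = {f. \<forall>x\<in>R. poly f x \<in> R}"

end

theory Submission
  imports Defs
begin

text \<open>
  Let \<open>v\<close> be the valuation of \<open>V\<close>, with uniformizer \<open>\<pi>\<close>. A polynomial whose numerator is a product of
  irreducible polynomials \<open>F\<^sub>w\<close> of \<open>K[X]\<close> factors in \<open>Int(V)\<close> by distributing the \<open>F\<^sub>w\<close> and the powers
  of \<open>\<pi>\<close> in the denominator. Take blocks \<open>B\<^sub>1, \<dots>, B\<^sub>k\<close> of \<open>n\<^sub>i - 1\<close> indices and one further index \<open>b\<close>,
  and arrange the sets on which the \<open>F\<^sub>w\<close> have positive valuation so that a product over \<open>I\<close> is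
  divisible by \<open>\<pi>\<close> on \<open>V\<close> precisely if \<open>I\<close> contains \<open>b\<close> and all indices outside some single block.
  The factorizations of \<open>\<pi>\<^sup>-\<^sup>1 \<Prod> F\<^sub>w\<close> then correspond to the blocks: the complement of \<open>B\<^sub>i\<close>, divided by
  \<open>\<pi>\<close>, is one irreducible factor, and the \<open>n\<^sub>i - 1\<close> polynomials of \<open>B\<^sub>i\<close> are the others.
  Integer-valued polynomials with such valuations exist because the residue field is finite, and they
  can be approximated by irreducible polynomials of \<open>K[X]\<close> by imposing Eisenstein's criterion, or
  irreducibility modulo the maximal ideal, at a valuation ring independent of \<open>V\<close>.
\<close>

section \<open>Discrete valuations\<close>

text \<open>The residue field may have only two elements, so residue classes cannot supply a test
  set for every pair of vertices; the shells \<open>v x = i\<close> can, being infinite in number.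
  Finiteness of the residue field yields one exponent \<open>m\<close> with \<open>u ^ m\<close>
  congruent to 1 for all units \<open>u\<close>, which turns units into indicator values. The
  irreducible approximants need degree above 1, so that they have no roots and all valuations are
  finite, and distinct degrees, so that no two are associated. Since some total valuation must be
  exactly one, they are approximated to precision two.

  The auxiliary valuation ring lives in a subfield \<open>L\<close>. Chevalley's theorem extends it
  to the whole field, and a non-zero principal maximal ideal or a finite residue field survives in a
  finite extension. In cases (1) and (2) such a ring is found without inspecting \<open>V\<close>:
  the localizations of a suitable ring \<open>A\<close> at two coprime primes generate its quotient
  field, so not both lie in \<open>V\<close>. In case (1) discreteness and finiteness of the residue
  field of \<open>V\<close> have to be proved as well.\<close>

locale discrete_valuation =
  fixes v :: "'a::field \<Rightarrow> int"
  assumes v_mult: "x \<noteq> 0 \<Longrightarrow> y \<noteq> 0 \<Longrightarrow> v (x * y) = v x + v y"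
    and v_add: "x \<noteq> 0 \<Longrightarrow> y \<noteq> 0 \<Longrightarrow> x + y \<noteq> 0 \<Longrightarrow> min (v x) (v y) \<le> v (x + y)"
    and v_surj: "\<exists>x. x \<noteq> 0 \<and> v x = 1"
begin

text \<open>\<open>v 0\<close> is an arbitrary integer; the disjunct restores the convention that
  zero has infinite valuation.\<close>

definition vge :: "int \<Rightarrow> 'a \<Rightarrow> bool" where
  "vge e x \<longleftrightarrow> x = 0 \<or> e \<le> v x"

definition val_ring :: "'a set" where
  "val_ring = {x. vge 0 x}"

lemma v_one [simp]: "v 1 = 0"
  using v_mult[of 1 1] by simp

lemma v_minus_one [simp]: "v (-1) = 0"
  using v_mult[of "-1" "-1"] by simp

lemma v_minus [simp]: "v (- x) = v x"
proof (cases "x = 0")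
  case False
  then show ?thesis using v_mult[of "-1" x] by simp
qed simp

lemma v_inverse: "x \<noteq> 0 \<Longrightarrow> v (inverse x) = - v x"
  using v_mult[of x "inverse x"] by simp

lemma v_divide: "x \<noteq> 0 \<Longrightarrow> y \<noteq> 0 \<Longrightarrow> v (x / y) = v x - v y"
  by (simp add: divide_inverse v_mult v_inverse)

lemma v_power: "x \<noteq> 0 \<Longrightarrow> v (x ^ n) = int n * v x"
  by (induction n) (auto simp: v_mult algebra_simps)

lemma v_prod: "finite I \<Longrightarrow> (\<And>i. i \<in> I \<Longrightarrow> f i \<noteq> 0) \<Longrightarrow> v (\<Prod>i\<in>I. f i) = (\<Sum>i\<in>I. v (f i))"
  by (induction I rule: finite_induct) (auto simp: v_mult)

lemma vge_0 [simp]: "vge e 0"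
  by (simp add: vge_def)

lemma vge_1 [simp]: "vge e 1 \<longleftrightarrow> e \<le> 0"
  by (simp add: vge_def)

lemma vge_mono: "vge e x \<Longrightarrow> e' \<le> e \<Longrightarrow> vge e' x"
  by (auto simp: vge_def)

lemma vge_1_0: "vge 1 x \<Longrightarrow> vge 0 x"
  by (auto simp: vge_def)

lemma vge_minus [simp]: "vge e (- x) = vge e x"
  by (simp add: vge_def)

lemma vge_add: "vge e x \<Longrightarrow> vge e y \<Longrightarrow> vge e (x + y)"
  using v_add[of x y] by (cases "x = 0"; cases "y = 0"; cases "x + y = 0") (auto simp: vge_def)

lemma vge_diff: "vge e x \<Longrightarrow> vge e y \<Longrightarrow> vge e (x - y)"
  using vge_add[of e x "- y"] by simp

lemma vge_mult: "vge e x \<Longrightarrow> vge e' y \<Longrightarrow> vge (e + e') (x * y)"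
  by (cases "x = 0"; cases "y = 0") (auto simp: vge_def v_mult)

lemma vge_mult0: "vge e x \<Longrightarrow> vge 0 y \<Longrightarrow> vge e (x * y)" "vge 0 x \<Longrightarrow> vge e y \<Longrightarrow> vge e (x * y)"
  using vge_mult[of e x 0 y] vge_mult[of 0 x e y] by simp_all

lemma vge_sum: "(\<And>i. i \<in> I \<Longrightarrow> vge e (f i)) \<Longrightarrow> vge e (\<Sum>i\<in>I. f i)"
  by (induction I rule: infinite_finite_induct) (auto intro: vge_add)

lemma vge_power: "vge e x \<Longrightarrow> vge (int n * e) (x ^ n)"
proof (induction n)
  case (Suc n)
  then have "vge (e + int n * e) (x * x ^ n)" by (intro vge_mult) auto
  then show ?case by (simp add: algebra_simps)
qed simp

lemma vge_power0: "vge 0 x \<Longrightarrow> vge 0 (x ^ n)"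
  using vge_power[of 0 x n] by simp

lemma vge_power_cong:
  assumes "vge e (x - y)" "vge 0 x" "vge 0 y"
  shows "vge e (x ^ n - y ^ n)"
proof (induction n)
  case (Suc n)
  have "x ^ Suc n - y ^ Suc n = (x - y) * x ^ n + y * (x ^ n - y ^ n)"
    by (simp add: algebra_simps)
  then show ?case using assms Suc by (metis vge_add vge_mult0 vge_power0)
qed simp

text \<open>The ultrametric inequality is used twice, for \<open>y = x + (y - x)\<close> and for
  \<open>x = y - (y - x)\<close>: a summand of strictly larger valuation cannot affect the
  minimum.\<close>

lemma v_perturb:
  assumes "x \<noteq> 0" "vge (v x + 1) (y - x)"
  shows "y \<noteq> 0 \<and> v y = v x"
proof (cases "y - x = 0")
  case False
  have lt: "v x < v (y - x)" using assms False by (auto simp: vge_def)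
  have y: "y \<noteq> 0"
  proof
    assume "y = 0"
    then show False using lt by simp
  qed
  have "v x \<le> v y" using v_add[of x "y - x"] assms(1) False y lt by simp
  moreover have "min (v y) (v (y - x)) \<le> v x"
    using v_add[of y "- (y - x)"] assms(1) False y unfolding v_minus by simp
  ultimately show ?thesis using lt y by simp
qed (use assms in auto)

lemma unit_perturb: "vge 1 (y - 1) \<Longrightarrow> y \<noteq> 0 \<and> v y = 0"
  using v_perturb[of 1 y] by simp

lemma vge_poly: "(\<And>i. vge e (coeff p i)) \<Longrightarrow> vge 0 x \<Longrightarrow> vge e (poly p x)"
  unfolding poly_altdef by (intro vge_sum vge_mult0 vge_power0)

text \<open>Each \<open>s i\<close> is, modulo the maximal ideal, the indicator function of the shell
  \<open>v x = i\<close>. If \<open>h\<close> is the indicator of \<open>v x \<ge> i\<close>, then \<open>u = X h^(i+1) / \<pi>^i\<close>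
  is \<open>X / \<pi>^i\<close> there and vanishes elsewhere, so that \<open>u^m\<close> is the indicator of the shell and
  \<open>h - u^m\<close> the indicator of \<open>v x \<ge> i + 1\<close>.\<close>

lemma shell_indicators:
  assumes m: "m > 0" "\<And>u. u \<noteq> 0 \<Longrightarrow> v u = 0 \<Longrightarrow> vge 1 (u ^ m - 1)"
  obtains s :: "nat \<Rightarrow> 'a poly" where
    "\<And>i x. x \<noteq> 0 \<Longrightarrow> v x = int i \<Longrightarrow> vge 1 (poly (s i) x - 1)"
    "\<And>i x. vge 0 x \<Longrightarrow> x = 0 \<or> v x \<noteq> int i \<Longrightarrow> vge 1 (poly (s i) x)"
proof -
  obtain p where p: "p \<noteq> 0" "v p = 1" using v_surj by blast
  define u where "u i h = smult (inverse p ^ i) ([:0, 1:] * h ^ Suc i)" for i and h :: "'a poly"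
  define h where "h = rec_nat 1 (\<lambda>i h. h - u i h ^ m)"
  define s where "s i = u i (h i) ^ m" for i
  have h0: "h 0 = 1" and hS: "h (Suc i) = h i - s i" for i
    by (simp_all add: h_def s_def)
  have pu: "poly (u i h) x = x / p ^ i * poly h x ^ Suc i" for i h x
    by (simp add: u_def field_simps)
  have s1: "vge 1 (poly (s i) x - 1)"
    if "x \<noteq> 0" "v x = int i" "vge 1 (poly (h i) x - 1)" for i x
  proof -
    have h: "vge 0 (poly (h i) x)" using unit_perturb[OF that(3)] by (simp add: vge_def)
    have y: "x / p ^ i \<noteq> 0" "v (x / p ^ i) = 0" using that p by (simp_all add: v_divide v_power)
    have "vge 1 (x / p ^ i * (poly (h i) x ^ Suc i - 1 ^ Suc i))"
      by (rule vge_mult0(2), use y in \<open>simp add: vge_def\<close>, rule vge_power_cong)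
        (use that h in auto)
    then have "vge 1 (poly (u i (h i)) x - x / p ^ i)"
      by (simp add: pu algebra_simps)
    then have w: "poly (u i (h i)) x \<noteq> 0 \<and> v (poly (u i (h i)) x) = 0"
      using v_perturb[of "x / p ^ i" "poly (u i (h i)) x"] y by simp
    then show ?thesis using m(2) by (simp add: s_def)
  qed
  have s2: "vge 1 (poly (s i) x)"
    if x: "vge 0 x" "vge (int i + 1) x \<and> vge 0 (poly (h i) x) \<or> vge 1 (poly (h i) x)" for i x
  proof -
    have ip: "vge (- int i) (inverse p ^ i)" by (simp add: vge_def v_power v_inverse p)
    have "vge 1 (poly (u i (h i)) x)"
    \<comment> \<open>Where \<open>h i\<close> has positive valuation, its power
      \<open>i + 1\<close> beats the pole of order \<open>i\<close>; where \<open>v x\<close>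
      exceeds \<open>i\<close>, the factor \<open>X\<close> does.\<close>
    proof (cases "vge 1 (poly (h i) x)")
      case True
      have "vge (- int i + (0 + int (Suc i) * 1)) (inverse p ^ i * (x * poly (h i) x ^ Suc i))"
        by (intro vge_mult ip vge_power True x)
      then show ?thesis by (simp add: pu field_simps)
    next
      case False
      then have "vge (- int i + (int i + 1 + int (Suc i) * 0)) (inverse p ^ i * (x * poly (h i) x ^ Suc i))"
        by (intro vge_mult ip vge_power) (use x in auto)
      then show ?thesis by (simp add: pu field_simps)
    qed
    then have "vge (int m) (poly (u i (h i)) x ^ m)" using vge_power[of 1 _ m] by simp
    then show ?thesis using m(1) vge_mono[of "int m" _ 1] by (simp add: s_def)
  qed
  have hh: "(vge (int i) x \<longrightarrow> vge 1 (poly (h i) x - 1)) \<and> (\<not> vge (int i) x \<longrightarrow> vge 1 (poly (h i) x))"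
    if x: "vge 0 x" for i x
  proof (induction i)
    case 0
    then show ?case using x by (simp add: h0)
  next
    case (Suc i)
    have h0: "vge 0 (poly (h i) x)"
    proof (cases "vge (int i) x")
      case True
      then show ?thesis using Suc unit_perturb by (simp add: vge_def)
    qed (use Suc in \<open>auto intro: vge_1_0\<close>)
    consider "x \<noteq> 0" "v x = int i" | "vge (int (Suc i)) x" | "\<not> vge (int i) x"
      by (fastforce simp: vge_def)
    then show ?case
    proof cases
      case 1
      then have h1: "vge 1 (poly (h i) x - 1)" using Suc by (simp add: vge_def)
      have "vge 1 (poly (h i) x - 1 - (poly (s i) x - 1))"
        by (rule vge_diff[OF h1 s1[OF 1 h1]])
      then show ?thesis using 1 by (simp add: hS vge_def)
    next
      case 2
      then have i: "vge (int i + 1) x" by (simp add: add.commute)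
      have "vge 1 (poly (h i) x - 1)" using vge_mono[OF 2, of "int i"] Suc by simp
      moreover have "vge 1 (poly (s i) x)" using s2 x i h0 by blast
      ultimately have "vge 1 (poly (h i) x - 1 - poly (s i) x)" by (rule vge_diff)
      then show ?thesis using 2 by (simp add: hS algebra_simps)
    next
      case 3
      then have "vge 1 (poly (h i) x)" "vge 1 (poly (s i) x)" using Suc s2 x by blast+
      then show ?thesis using 3 vge_mono[of "int (Suc i)" x "int i"] by (auto simp: hS vge_diff)
    qed
  qed
  show thesis
  proof (rule that[of s])
    fix i x assume "x \<noteq> 0" "v x = int i"
    then show "vge 1 (poly (s i) x - 1)" using s1 hh[of x i] by (simp add: vge_def)
  next
    fix i x assume x: "vge 0 x" "x = 0 \<or> v x \<noteq> int i"
    have "vge (int i + 1) x \<or> \<not> vge (int i) x" using x(2) by (auto simp: vge_def)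
    then show "vge 1 (poly (s i) x)"
    proof
      assume i: "vge (int i + 1) x"
      then have "vge 1 (poly (h i) x - 1)" using hh[OF x(1), of i] vge_mono[OF i, of "int i"] by simp
      then have "poly (h i) x \<noteq> 0 \<and> v (poly (h i) x) = 0" by (rule unit_perturb)
      then show ?thesis using s2[OF x(1)] i by (simp add: vge_def)
    qed (use hh[OF x(1)] s2[OF x(1)] in blast)
  qed
qed

end

section \<open>Factorizations and minimal covers\<close>

lemma prime_elem_dvd_prodE:
  assumes "finite I" "prime_elem p" "p dvd (\<Prod>i\<in>I. f i)"
  shows "\<exists>i\<in>I. p dvd f i"
  using assms
proof (induction I rule: finite_induct)
  case empty
  then show ?case using prime_elem_not_unit by auto
qed (auto simp: prime_elem_dvd_mult_iff)

text \<open>Unique factorization in \<open>K[X]\<close>, by handing each prime \<open>F w\<close> to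
  the factor it divides. The constants are recorded because scalars are units of \<open>K[X]\<close>
  but not of the ring of integer-valued polynomials: they carry the powers of the
  uniformizer.\<close>

lemma divisor_of_prime_elem_prod:
  fixes F :: "'w \<Rightarrow> 'a::field poly"
  assumes "finite I" "\<And>w. w \<in> I \<Longrightarrow> prime_elem (F w)" "c \<noteq> 0"
    and "g * h = smult c (\<Prod>w\<in>I. F w)"
  shows "\<exists>J c' d'. J \<subseteq> I \<and> c' \<noteq> 0 \<and> d' \<noteq> 0 \<and> c = c' * d' \<and>
           g = smult c' (\<Prod>w\<in>J. F w) \<and> h = smult d' (\<Prod>w\<in>I - J. F w)"
  using assms
proof (induction I arbitrary: g h rule: finite_induct)
  case empty
  then have gh: "g * h = [:c:]" by simp
  then have nz: "g \<noteq> 0" "h \<noteq> 0" using empty by auto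
  have "degree g + degree h = 0" using degree_mult_eq[OF nz] gh by simp
  then obtain a b where ab: "g = [:a:]" "h = [:b:]" by (metis add_is_0 degree_eq_zeroE)
  then have "c = a * b" "a \<noteq> 0" "b \<noteq> 0" using gh nz by (auto simp: mult.commute)
  then show ?case using ab by auto
next
  case (insert w I)
  have pw: "prime_elem (F w)" using insert.prems by simp
  then have F0: "F w \<noteq> 0" by auto
  have prod: "g * h = F w * smult c (\<Prod>w\<in>I. F w)"
    using insert by (simp add: mult.left_commute)
  then have "F w dvd g \<or> F w dvd h" using pw by (metis dvd_triv_left prime_elem_dvd_mult_iff)
  then show ?case
  proof
    assume "F w dvd g"
    then obtain g' where g': "g = F w * g'" by (elim dvdE)
    then have "F w * (g' * h) = F w * smult c (\<Prod>w\<in>I. F w)" using prod by (simp only: mult.assoc)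
    then have "g' * h = smult c (\<Prod>w\<in>I. F w)" using F0 mult_left_cancel by blast
    then obtain J c' d' where J: "J \<subseteq> I" "c' \<noteq> 0" "d' \<noteq> 0" "c = c' * d'"
      "g' = smult c' (\<Prod>w\<in>J. F w)" "h = smult d' (\<Prod>w\<in>I - J. F w)"
      using insert.IH[of g' h] insert.prems by auto
    have "w \<notin> J" "finite J" "insert w I - insert w J = I - J"
      using J insert.hyps by (auto intro: finite_subset)
    then have "g = smult c' (\<Prod>w\<in>insert w J. F w)" "h = smult d' (\<Prod>w\<in>insert w I - insert w J. F w)"
      using J g' by auto
    then show ?thesis using J by (metis insert_mono)
  next
    assume "F w dvd h"
    then obtain h' where h': "h = F w * h'" by (elim dvdE)
    then have "F w * (g * h') = F w * smult c (\<Prod>w\<in>I. F w)"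
      using prod by (simp add: ac_simps)
    then have "g * h' = smult c (\<Prod>w\<in>I. F w)" using F0 mult_left_cancel by blast
    then obtain J c' d' where J: "J \<subseteq> I" "c' \<noteq> 0" "d' \<noteq> 0" "c = c' * d'"
      "g = smult c' (\<Prod>w\<in>J. F w)" "h' = smult d' (\<Prod>w\<in>I - J. F w)"
      using insert.IH[of g h'] insert.prems by auto
    have "insert w I - J = insert w (I - J)" "w \<notin> I - J" "finite (I - J)"
      using J insert.hyps by auto
    then have "h = smult d' (\<Prod>w\<in>insert w I - J. F w)"
      using J h' by auto
    then show ?thesis using J by (metis subset_insertI2)
  qed
qed

text \<open>Disjointness refers to positions rather than to members of \<open>Js\<close>, since the
  empty set may occur repeatedly, once for every constant factor.\<close>

lemma factors_of_prime_elem_prod: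
  fixes F :: "'w \<Rightarrow> 'a::field poly"
  assumes "finite I" "\<And>w. w \<in> I \<Longrightarrow> prime_elem (F w)" "c \<noteq> 0"
    and "prod_list us = smult c (\<Prod>w\<in>I. F w)"
  shows "\<exists>cs Js. length cs = length us \<and> length Js = length us \<and> 0 \<notin> set cs \<and> c = prod_list cs \<and>
           \<Union>(set Js) = I \<and> (\<forall>i<length us. us ! i = smult (cs ! i) (\<Prod>w\<in>Js ! i. F w)) \<and>
           (\<forall>i<length us. \<forall>j<length us. i \<noteq> j \<longrightarrow> Js ! i \<inter> Js ! j = {})"
  using assms
proof (induction us arbitrary: I c)
  case Nil
  have "I = {}"
  proof (rule ccontr)
    assume "I \<noteq> {}"
    then obtain w where w: "w \<in> I" by blast
    then have "F w dvd 1" using Nil by (simp add: dvd_smult dvd_prod_eqI) (metis dvd_prodI dvd_smult)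
    then show False using Nil.prems(2)[OF w] by simp
  qed
  then have "c = 1" using Nil by (simp add: one_pCons)
  then show ?case using \<open>I = {}\<close> by auto
next
  case (Cons u us)
  obtain J c' d' where J: "J \<subseteq> I" "c' \<noteq> 0" "d' \<noteq> 0" "c = c' * d'"
      "u = smult c' (\<Prod>w\<in>J. F w)" "prod_list us = smult d' (\<Prod>w\<in>I - J. F w)"
    using divisor_of_prime_elem_prod[of I F c u "prod_list us"] Cons.prems by auto
  obtain cs Js where IH: "length cs = length us" "length Js = length us" "0 \<notin> set cs" "d' = prod_list cs"
      "\<Union>(set Js) = I - J" "\<forall>i<length us. us ! i = smult (cs ! i) (\<Prod>w\<in>Js ! i. F w)"
      "\<forall>i<length us. \<forall>j<length us. i \<noteq> j \<longrightarrow> Js ! i \<inter> Js ! j = {}"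
    using Cons.IH[of "I - J" d'] Cons.prems J by auto
  have d: "J \<inter> Js ! i = {}" if "i < length us" for i
    using IH(2,5) that nth_mem[of i Js] by auto
  show ?case
  proof (intro exI conjI)
    show "\<forall>i<length (u # us). (u # us) ! i = smult ((c' # cs) ! i) (\<Prod>w\<in>(J # Js) ! i. F w)"
      using IH J by (auto simp: less_Suc_eq_0_disj)
    show "\<forall>i<length (u # us). \<forall>j<length (u # us). i \<noteq> j \<longrightarrow> (J # Js) ! i \<inter> (J # Js) ! j = {}"
    proof (intro allI impI)
      fix i j
      assume "i < length (u # us)" "j < length (u # us)" "i \<noteq> j"
      then show "(J # Js) ! i \<inter> (J # Js) ! j = {}"
        using IH(7) d by (cases i; cases j) (auto simp: Int_commute)
    qed
  qed (use IH J in auto)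
qed

text \<open>This produces the re-indexing that \<open>essentially_same_in\<close> asks for.\<close>

lemma distinct_same_set_bij:
  assumes "distinct xs" "distinct ys" "set xs = set ys"
  obtains \<pi> where "bij_betw \<pi> {..<length ys} {..<length xs}"
    "\<And>i. i < length ys \<Longrightarrow> xs ! \<pi> i = ys ! i"
proof -
  have b1: "bij_betw ((!) xs) {..<length xs} (set xs)" and b2: "bij_betw ((!) ys) {..<length ys} (set xs)"
    using assms bij_betw_nth by (metis, metis)
  define \<pi> where "\<pi> = inv_into {..<length xs} ((!) xs) \<circ> (!) ys"
  have "bij_betw \<pi> {..<length ys} {..<length xs}"
    unfolding \<pi>_def by (rule bij_betw_trans[OF b2 bij_betw_inv_into[OF b1]])
  moreover have "xs ! \<pi> i = ys ! i" if "i < length ys" for i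
    using that b1 assms(3) by (simp add: \<pi>_def bij_betw_def f_inv_into_f)
  ultimately show thesis using that by blast
qed

text \<open>The interface between the combinatorics of factorizations and the construction of the
  polynomials. \<open>no_root\<close> makes every valuation genuine, \<open>deg_inj\<close> keeps
  the \<open>F w\<close> from being associated. The last three assumptions describe the minimum over
  the valuation ring of the valuation of a product: positive exactly for covers, and never above one
  because of \<open>total\<close>.\<close>

locale cover_configuration = discrete_valuation v for v :: "'a::field \<Rightarrow> int" +
  fixes \<Omega> :: "'w set" and b :: 'w and B :: "nat \<Rightarrow> 'w set" and k :: nat and F :: "'w \<Rightarrow> 'a poly"
  assumes finite_Omega: "finite \<Omega>" and b_in: "b \<in> \<Omega>"
    and blocks: "i \<in> {1..k} \<Longrightarrow> B i \<subseteq> \<Omega> - {b}"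
    and blocks_nonempty: "i \<in> {1..k} \<Longrightarrow> B i \<noteq> {}"
    and blocks_disjoint: "i \<in> {1..k} \<Longrightarrow> j \<in> {1..k} \<Longrightarrow> i \<noteq> j \<Longrightarrow> B i \<inter> B j = {}"
    and irr: "w \<in> \<Omega> \<Longrightarrow> irreducible (F w)"
    and deg_inj: "inj_on (\<lambda>w. degree (F w)) \<Omega>"
    and no_root: "w \<in> \<Omega> \<Longrightarrow> poly (F w) x \<noteq> 0"
    and F_int: "w \<in> \<Omega> \<Longrightarrow> vge 0 x \<Longrightarrow> 0 \<le> v (poly (F w) x)"
    and cover_ge: "b \<in> I \<Longrightarrow> I \<subseteq> \<Omega> \<Longrightarrow> i \<in> {1..k} \<Longrightarrow> \<Omega> - B i \<subseteq> I \<Longrightarrow> vge 0 x \<Longrightarrow>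
                     1 \<le> (\<Sum>w\<in>I. v (poly (F w) x))"
    and noncover: "I \<subseteq> \<Omega> \<Longrightarrow> \<not> (b \<in> I \<and> (\<exists>i\<in>{1..k}. \<Omega> - B i \<subseteq> I)) \<Longrightarrow>
                     \<exists>x. vge 0 x \<and> (\<Sum>w\<in>I. v (poly (F w) x)) = 0"
    and total: "\<exists>x. vge 0 x \<and> (\<Sum>w\<in>\<Omega>. v (poly (F w) x)) = 1"
begin

definition cover :: "'w set \<Rightarrow> bool" where
  "cover I \<longleftrightarrow> b \<in> I \<and> (\<exists>i\<in>{1..k}. \<Omega> - B i \<subseteq> I)"

text \<open>The valuation of the fixed divisor of the product over \<open>I\<close>, that is, the
  minimum of the valuations of its values on the valuation ring.\<close>

definition fdiv :: "'w set \<Rightarrow> int" where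
  "fdiv I = (if cover I then 1 else 0)"

definition el :: "'a \<Rightarrow> 'w set \<Rightarrow> 'a poly" where
  "el c I = smult c (\<Prod>w\<in>I. F w)"

abbreviation "IV \<equiv> Int_poly val_ring"

lemma cover_b: "cover I \<Longrightarrow> b \<in> I"
  by (simp add: cover_def)

lemma fin: "I \<subseteq> \<Omega> \<Longrightarrow> finite I"
  using finite_Omega finite_subset by blast

lemma prime_F: "w \<in> \<Omega> \<Longrightarrow> prime_elem (F w)"
  using irr field_poly_irreducible_imp_prime by blast

lemma F_nz: "w \<in> \<Omega> \<Longrightarrow> F w \<noteq> 0"
  using no_root by fastforce

lemma deg_F: "w \<in> \<Omega> \<Longrightarrow> 0 < degree (F w)"
  using irr F_nz by (metis irreducible_not_unit is_unit_iff_degree not_gr_zero)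

lemma prod_nz: "I \<subseteq> \<Omega> \<Longrightarrow> (\<Prod>w\<in>I. F w) \<noteq> 0"
  using fin F_nz by (auto simp: prod_zero_iff)

lemma poly_el: "poly (el c I) x = c * (\<Prod>w\<in>I. poly (F w) x)"
  by (simp add: el_def poly_prod)

lemma v_poly_el:
  assumes "I \<subseteq> \<Omega>" "c \<noteq> 0"
  shows "poly (el c I) x \<noteq> 0" "v (poly (el c I) x) = v c + (\<Sum>w\<in>I. v (poly (F w) x))"
proof -
  have nz: "\<And>w. w \<in> I \<Longrightarrow> poly (F w) x \<noteq> 0" using assms no_root by blast
  then have p: "(\<Prod>w\<in>I. poly (F w) x) \<noteq> 0" using fin[OF assms(1)] by simp
  then show "poly (el c I) x \<noteq> 0" using assms by (simp add: poly_el)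
  show "v (poly (el c I) x) = v c + (\<Sum>w\<in>I. v (poly (F w) x))"
    using assms p nz fin[OF assms(1)] by (simp add: poly_el v_mult v_prod)
qed

lemma sum_mono_sub:
  assumes "J \<subseteq> I" "I \<subseteq> \<Omega>" "vge 0 x"
  shows "(\<Sum>w\<in>J. v (poly (F w) x)) \<le> (\<Sum>w\<in>I. v (poly (F w) x))"
  using assms fin F_int by (intro sum_mono2) auto

text \<open>The pole of the constant must be compensated by the fixed divisor. For necessity the
  product is evaluated where the minimum is attained: at the point of \<open>total\<close> for a
  cover, at the point of \<open>noncover\<close> otherwise.\<close>

lemma el_in_iff:
  assumes I: "I \<subseteq> \<Omega>" and c: "c \<noteq> 0"
  shows "el c I \<in> IV \<longleftrightarrow> 0 \<le> v c + fdiv I"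
proof -
  have "el c I \<in> IV \<longleftrightarrow> (\<forall>x. vge 0 x \<longrightarrow> 0 \<le> v c + (\<Sum>w\<in>I. v (poly (F w) x)))"
    using v_poly_el[OF I c] by (auto simp: Int_poly_def val_ring_def vge_def)
  also have "\<dots> \<longleftrightarrow> 0 \<le> v c + fdiv I"
  proof
    assume H: "\<forall>x. vge 0 x \<longrightarrow> 0 \<le> v c + (\<Sum>w\<in>I. v (poly (F w) x))"
    show "0 \<le> v c + fdiv I"
    proof (cases "cover I")
      case True
      obtain x where x: "vge 0 x" "(\<Sum>w\<in>\<Omega>. v (poly (F w) x)) = 1" using total by blast
      then have "(\<Sum>w\<in>I. v (poly (F w) x)) \<le> 1" using sum_mono_sub[OF I order.refl x(1)] by simp
      then show ?thesis using H x(1) True by (force simp: fdiv_def)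
    next
      case False
      then show ?thesis using noncover[OF I] H by (force simp: fdiv_def cover_def)
    qed
  next
    assume H: "0 \<le> v c + fdiv I"
    show "\<forall>x. vge 0 x \<longrightarrow> 0 \<le> v c + (\<Sum>w\<in>I. v (poly (F w) x))"
    proof (intro allI impI)
      fix x assume x: "vge 0 x"
      have "fdiv I \<le> (\<Sum>w\<in>I. v (poly (F w) x))"
      proof (cases "cover I")
        case True
        then show ?thesis using cover_ge I x by (auto simp: fdiv_def cover_def)
      next
        case False
        then show ?thesis using F_int I x by (auto simp: fdiv_def intro!: sum_nonneg)
      qed
      then show "0 \<le> v c + (\<Sum>w\<in>I. v (poly (F w) x))" using H by simp
    qed
  qed
  finally show ?thesis .
qed

lemma el_mult:
  assumes "I \<subseteq> \<Omega>" "J \<subseteq> \<Omega>" "I \<inter> J = {}"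
  shows "el c I * el d J = el (c * d) (I \<union> J)"
  using assms fin by (simp add: el_def prod.union_disjoint mult.commute)

lemma const_in: "[:c:] \<in> IV \<longleftrightarrow> vge 0 c"
  by (auto simp: Int_poly_def val_ring_def intro: exI[of _ 0] vge_0)

text \<open>A unit of \<open>IV\<close> is a unit of \<open>K[X]\<close>, hence constant, and both
  it and its inverse must lie in the valuation ring.\<close>

lemma unit_iff: "f \<in> units_in IV \<longleftrightarrow> (\<exists>c. c \<noteq> 0 \<and> v c = 0 \<and> f = [:c:])"
proof
  assume "f \<in> units_in IV"
  then obtain g where g: "f \<in> IV" "g \<in> IV" "f * g = 1" by (auto simp: units_in_def)
  then have "degree f = 0" "degree g = 0" "f \<noteq> 0"
    using is_unit_iff_degree[of f] is_unit_iff_degree[of g]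
    by (metis dvd_triv_left dvd_triv_right mult_zero_left mult_zero_right zero_neq_one)+
  then obtain c d where cd: "f = [:c:]" "g = [:d:]" by (metis degree_eq_zeroE)
  then have e: "c * d = 1" using g(3) by (simp add: one_pCons mult.commute)
  then have nz: "c \<noteq> 0" "d \<noteq> 0" by auto
  then have "v c + v d = 0" using v_mult[of c d] e by simp
  moreover have "0 \<le> v c" "0 \<le> v d" using g cd const_in nz by (auto simp: vge_def)
  ultimately show "\<exists>c. c \<noteq> 0 \<and> v c = 0 \<and> f = [:c:]" using cd nz by auto
next
  assume "\<exists>c. c \<noteq> 0 \<and> v c = 0 \<and> f = [:c:]"
  then obtain c where c: "c \<noteq> 0" "v c = 0" "f = [:c:]" by blast
  have "[:inverse c:] \<in> IV" "f \<in> IV" "f * [:inverse c:] = 1"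
    using c by (auto simp: const_in vge_def v_inverse one_pCons)
  then show "f \<in> units_in IV" unfolding units_in_def by blast
qed

lemma el_unit_iff:
  assumes "I \<subseteq> \<Omega>" "c \<noteq> 0"
  shows "el c I \<in> units_in IV \<longleftrightarrow> I = {} \<and> v c = 0"
proof
  assume "el c I \<in> units_in IV"
  then obtain d where d: "d \<noteq> 0" "v d = 0" "el c I = [:d:]" unfolding unit_iff by blast
  have "I = {}"
  proof (rule ccontr)
    assume "I \<noteq> {}"
    then obtain w where w: "w \<in> I" by blast
    have "F w dvd el c I" unfolding el_def using w fin[OF assms(1)] by (intro dvd_smult dvd_prodI)
    then have "degree (F w) \<le> degree [:d:]" using d by (intro dvd_imp_degree_le) auto
    then show False using deg_F[of w] w assms by auto
  qed
  then show "I = {} \<and> v c = 0" using d by (auto simp: el_def one_pCons)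
next
  assume "I = {} \<and> v c = 0"
  then show "el c I \<in> units_in IV" using assms by (auto simp: unit_iff el_def one_pCons)
qed

lemma el_nz: "I \<subseteq> \<Omega> \<Longrightarrow> c \<noteq> 0 \<Longrightarrow> el c I \<noteq> 0"
  using prod_nz by (simp add: el_def)

text \<open>Divisibility makes two irreducible polynomials associated, hence equal in
  degree.\<close>

lemma F_dvd_F: "w \<in> \<Omega> \<Longrightarrow> w' \<in> \<Omega> \<Longrightarrow> F w dvd F w' \<Longrightarrow> w = w'"
proof -
  assume w: "w \<in> \<Omega>" "w' \<in> \<Omega>" "F w dvd F w'"
  then obtain g where g: "F w' = F w * g" by (elim dvdE)
  have "is_unit g" using irreducibleD[OF irr[OF w(2)] g] prime_F[OF w(1)] by auto
  then have "g \<noteq> 0" by auto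
  then have "degree g = 0" using \<open>is_unit g\<close> is_unit_iff_degree by blast
  then have "degree (F w') = degree (F w)" using g F_nz[OF w(1)] \<open>g \<noteq> 0\<close> by (simp add: degree_mult_eq)
  then show "w = w'" using deg_inj w by (auto dest: inj_onD)
qed

lemma F_dvd_el_iff:
  assumes "I \<subseteq> \<Omega>" "c \<noteq> 0" "w \<in> \<Omega>"
  shows "F w dvd el c I \<longleftrightarrow> w \<in> I"
proof
  assume "F w dvd el c I"
  then have "F w dvd (\<Prod>w\<in>I. F w)" using assms by (simp add: el_def dvd_smult_iff)
  then obtain w' where "w' \<in> I" "F w dvd F w'"
    using prime_elem_dvd_prodE[OF fin[OF assms(1)] prime_F[OF assms(3)]] by blast
  then show "w \<in> I" using F_dvd_F assms by auto
qed (use assms fin in \<open>auto simp: el_def intro!: dvd_smult dvd_prodI\<close>)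

text \<open>A decomposition splits \<open>I\<close> into \<open>J\<close> and \<open>I - J\<close>,
  and integrality allows the two constants poles of order at most \<open>fdiv J\<close> and
  \<open>fdiv (I - J)\<close>. Together they must produce a pole of order \<open>fdiv I\<close>,
  which \<open>min\<close> rules out unless one part is empty; that part is then a constant of
  valuation zero.\<close>

lemma irreducible_el:
  assumes I: "I \<subseteq> \<Omega>" "I \<noteq> {}" and c: "c \<noteq> 0" "v c = - fdiv I"
    and min: "\<And>J. J \<subseteq> I \<Longrightarrow> J \<noteq> {} \<Longrightarrow> J \<noteq> I \<Longrightarrow> fdiv J + fdiv (I - J) < fdiv I"
  shows "irreducible_in IV (el c I)"
  unfolding irreducible_in_def
proof (intro conjI notI)
  show "el c I \<in> IV" using el_in_iff I c by simp
  show "el c I = 0 \<Longrightarrow> False" using el_nz I c by blast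
  show "el c I \<in> units_in IV \<Longrightarrow> False" using el_unit_iff I c by simp
  assume "\<exists>g\<in>IV - units_in IV. \<exists>h\<in>IV - units_in IV. el c I = g * h"
  then obtain g h where gh: "g \<in> IV" "h \<in> IV" "g \<notin> units_in IV" "h \<notin> units_in IV"
    "g * h = smult c (\<Prod>w\<in>I. F w)" by (metis DiffD1 DiffD2 el_def)
  obtain J c' d' where J: "J \<subseteq> I" "c' \<noteq> 0" "d' \<noteq> 0" "c = c' * d'" "g = el c' J" "h = el d' (I - J)"
    using divisor_of_prime_elem_prod[OF fin[OF I(1)] _ c(1) gh(5)] prime_F I unfolding el_def by blast
  have sub: "J \<subseteq> \<Omega>" "I - J \<subseteq> \<Omega>" using J I by auto
  have ge: "0 \<le> v c' + fdiv J" "0 \<le> v d' + fdiv (I - J)"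
    using gh J el_in_iff sub by auto
  have vc: "v c = v c' + v d'" using J v_mult by simp
  have "J = {} \<or> J = I"
    using min[of J] J ge vc c by force
  then show False
  proof
    assume "J = {}"
    moreover from this have "fdiv J = 0" by (auto simp: fdiv_def dest: cover_b)
    ultimately have "v c' = 0 \<or> v d' < - fdiv I" using vc c ge by auto
    then show False using gh J \<open>J = {}\<close> el_unit_iff[OF sub(1) J(2)] ge by auto
  next
    assume "J = I"
    moreover from this have "fdiv (I - J) = 0" by (auto simp: fdiv_def dest: cover_b)
    ultimately have "v d' = 0 \<or> v c' < - fdiv I" using vc c ge by auto
    then show False using gh J \<open>J = I\<close> el_unit_iff[OF sub(2) J(3)] ge by auto
  qed
qed

text \<open>If the fixed divisor is additive along a splitting, each part can absorb its own share
  of the pole, and the element decomposes.\<close>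

lemma irreducible_el_minimal:
  assumes irr_el: "irreducible_in IV (el c I)"
    and I: "I \<subseteq> \<Omega>" and c: "c \<noteq> 0" "v c = - fdiv I"
    and J: "J \<subseteq> I" "J \<noteq> {}" "J \<noteq> I"
  shows "fdiv J + fdiv (I - J) \<noteq> fdiv I"
proof
  assume eq: "fdiv J + fdiv (I - J) = fdiv I"
  obtain p where p: "p \<noteq> 0" "v p = 1" using v_surj by blast
  define d where "d = (if cover J then inverse p else 1)"
  have d: "d \<noteq> 0" "v d = - fdiv J" using p by (auto simp: d_def fdiv_def v_inverse)
  have cd: "c / d \<noteq> 0" "v (c / d) = - fdiv (I - J)" using c d eq by (simp_all add: v_divide)
  have sub: "J \<subseteq> \<Omega>" "I - J \<subseteq> \<Omega>" using J I by auto
  have "el c I = el d J * el (c / d) (I - J)"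
    using el_mult[OF sub, of d "c / d"] J d by (simp add: Un_absorb1)
  moreover have "el d J \<in> IV - units_in IV" "el (c / d) (I - J) \<in> IV - units_in IV"
    using el_in_iff el_unit_iff sub d cd J by auto
  ultimately show False using irr_el unfolding irreducible_in_def by blast
qed

text \<open>A factorization partitions \<open>\<Omega>\<close>. Only the part containing
  \<open>b\<close> can be a cover, so it alone carries the pole; irreducibility shrinks it to the
  complement of a block and breaks everything else into singletons.\<close>

theorem factorizations_of_cover_configuration:
  assumes k: "0 < k"
  shows "\<exists>H \<in> IV. \<exists>A :: nat \<Rightarrow> 'a poly list.
           (\<forall>i\<in>{1..k}. factorization_in IV H (A i) \<and> length (A i) = Suc (card (B i))) \<and>
           (\<forall>i\<in>{1..k}. \<forall>j\<in>{1..k}. i \<noteq> j \<longrightarrow> \<not> essentially_same_in IV (A i) (A j)) \<and>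
           (\<forall>us. factorization_in IV H us \<longrightarrow> (\<exists>i\<in>{1..k}. essentially_same_in IV (A i) us))"
proof -
  obtain p where p: "p \<noteq> 0" "v p = 1" using v_surj by blast
  define cc where "cc J = (if cover J then inverse p else 1)" for J
  have cc: "cc J \<noteq> 0" "v (cc J) = - fdiv J" for J using p by (auto simp: cc_def fdiv_def v_inverse)
  define H where "H = el (inverse p) \<Omega>"
  have "\<exists>l. distinct l \<and> set l = B i" if "i \<in> {1..k}" for i
    using blocks[OF that] finite_Omega finite_distinct_list by (metis finite_Diff finite_subset)
  then obtain l where l: "\<And>i. i \<in> {1..k} \<Longrightarrow> distinct (l i) \<and> set (l i) = B i" by metis
  define Js where "Js i = (\<Omega> - B i) # map (\<lambda>w. {w}) (l i)" for i
  define A where "A i = map (\<lambda>J. el (cc J) J) (Js i)" for i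
  have setJs: "set (Js i) = insert (\<Omega> - B i) ((\<lambda>w. {w}) ` B i)" if "i \<in> {1..k}" for i
    using l[OF that] by (simp add: Js_def)
  have bJ: "b \<in> \<Omega> - B i" "b \<notin> B i" if "i \<in> {1..k}" for i using blocks[OF that] b_in by auto
  have distJs: "distinct (Js i)" if "i \<in> {1..k}" for i
    using l[OF that] bJ[OF that] by (auto simp: Js_def distinct_map inj_on_def)
  have cov_Omega: "cover (\<Omega> - B i)" if "i \<in> {1..k}" for i
    using that bJ[OF that] by (auto simp: cover_def)
  \<comment> \<open>A cover properly inside \<open>\<Omega> - B i\<close> contains
    \<open>\<Omega> - B j\<close> for some \<open>j \<noteq> i\<close>, hence also the non-empty
    block \<open>B i\<close>, which is disjoint from \<open>B j\<close>.\<close>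
  have not_cov: "\<not> cover J" if i: "i \<in> {1..k}" and J: "J \<subseteq> \<Omega> - B i" "J \<noteq> \<Omega> - B i" for i J
  proof
    assume "cover J"
    then obtain j where j: "j \<in> {1..k}" "\<Omega> - B j \<subseteq> J" by (auto simp: cover_def)
    then have "i \<noteq> j" using J by auto
    then have "B i \<inter> B j = {}" using blocks_disjoint i j by blast
    moreover obtain w where "w \<in> B i" using blocks_nonempty[OF i] by blast
    ultimately show False using j J blocks[OF i] by blast
  qed
  have fact: "factorization_in IV H (A i)" and len: "length (A i) = Suc (card (B i))"
    if i: "i \<in> {1..k}" for i
  proof -
    show "length (A i) = Suc (card (B i))"
      using l[OF i] distinct_card[of "l i"] by (simp add: A_def Js_def)
    have "irreducible_in IV (el (cc J) J)" if J: "J \<in> set (Js i)" for J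
    proof (rule irreducible_el)
      show "J \<subseteq> \<Omega>" "J \<noteq> {}" using J setJs[OF i] blocks[OF i] bJ[OF i] by auto
      show "cc J \<noteq> 0" "v (cc J) = - fdiv J" by (fact cc)+
      fix J' assume J': "J' \<subseteq> J" "J' \<noteq> {}" "J' \<noteq> J"
      have "J = \<Omega> - B i" using J J' setJs[OF i] by auto
      then have "\<not> cover J'" "\<not> cover (J - J')" "cover J"
        using not_cov[OF i, of J'] not_cov[OF i, of "J - J'"] cov_Omega[OF i] J' by auto
      then show "fdiv J' + fdiv (J - J') < fdiv J" by (simp add: fdiv_def)
    qed
    then have "\<forall>a\<in>set (A i). irreducible_in IV a" by (auto simp: A_def)
    moreover have "prod_list (A i) = H"
    proof -
      have "el (cc {w}) {w} = F w" if "w \<in> B i" for w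
        using that bJ[OF i] cover_b[of "{w}"] by (auto simp: el_def cc_def)
      then have "prod_list (map (\<lambda>w. el (cc {w}) {w}) (l i)) = (\<Prod>w\<in>B i. F w)"
        using l[OF i] by (metis (mono_tags, lifting) map_cong prod.distinct_set_conv_list)
      then have "prod_list (A i) = el (inverse p) (\<Omega> - B i) * el 1 (B i)"
        using cov_Omega[OF i] by (simp add: A_def Js_def o_def cc_def el_def)
      also have "\<dots> = el (inverse p) (\<Omega> - B i \<union> B i)"
        using blocks[OF i] by (subst el_mult) auto
      also have "\<Omega> - B i \<union> B i = \<Omega>" using blocks[OF i] by auto
      finally show ?thesis by (simp add: H_def)
    qed
    ultimately show "factorization_in IV H (A i)" by (simp add: factorization_in_def)
  qed
  have "cover \<Omega>" using k b_in by (auto simp: cover_def)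
  then have HI: "H \<in> IV" using el_in_iff[of \<Omega> "inverse p"] p by (simp add: H_def fdiv_def v_inverse)
  have diff: "\<not> essentially_same_in IV (A i) (A j)"
    if i: "i \<in> {1..k}" and j: "j \<in> {1..k}" and ij: "i \<noteq> j" for i j
  proof
    assume "essentially_same_in IV (A i) (A j)"
    then obtain \<pi> where "bij_betw \<pi> {..<length (A j)} {..<length (A i)}"
      and u: "\<forall>a<length (A j). \<exists>\<epsilon>\<in>units_in IV. A j ! a = \<epsilon> * A i ! \<pi> a"
      unfolding essentially_same_in_def by blast
    then have \<pi>: "\<pi> 0 < length (A i)" using len[OF j] by (auto simp: bij_betw_def)
    \<comment> \<open>Position 0 of \<open>A j\<close> holds the only factor divisible by
      \<open>F b\<close>; its partner in \<open>A i\<close> must be the factor with the same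
      property, so the complements of the two blocks coincide.\<close>
    obtain \<epsilon> where "\<epsilon> \<in> units_in IV" "A j ! 0 = \<epsilon> * A i ! \<pi> 0" using u len[OF j] by auto
    then obtain e where e: "e \<noteq> 0" "A j ! 0 = [:e:] * A i ! \<pi> 0" unfolding unit_iff by blast
    define J where "J = Js i ! \<pi> 0"
    have J: "J \<in> set (Js i)" "A i ! \<pi> 0 = el (cc J) J" using \<pi> by (auto simp: J_def A_def)
    have sub: "J \<subseteq> \<Omega>" "\<Omega> - B j \<subseteq> \<Omega>" using J setJs[OF i] blocks[OF i] by auto
    have "el (cc (\<Omega> - B j)) (\<Omega> - B j) = el (e * cc J) J"
      using e J by (simp add: A_def Js_def el_def)
    then have "w \<in> \<Omega> - B j \<longleftrightarrow> w \<in> J" if "w \<in> \<Omega>" for w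
      using F_dvd_el_iff[OF sub(1) _ that, of "e * cc J"] F_dvd_el_iff[OF sub(2) cc(1) that, of "\<Omega> - B j"]
        cc(1) e(1) by simp
    then have "\<Omega> - B j = J" using sub by blast
    then have "b \<in> J" using bJ[OF j] by blast
    then have "J = \<Omega> - B i" using J(1) setJs[OF i] bJ[OF i] by auto
    then have "\<Omega> - B j = \<Omega> - B i" using \<open>\<Omega> - B j = J\<close> by simp
    then have "B i = B j" using blocks[OF i] blocks[OF j] by blast
    then show False using blocks_disjoint[OF i j ij] blocks_nonempty[OF i] by blast
  qed
  have all: "\<exists>i\<in>{1..k}. essentially_same_in IV (A i) us" if us: "factorization_in IV H us" for us
  proof -
    let ?n = "length us"
    have irr_us: "irreducible_in IV (us ! a)" if "a < ?n" for a
      using us that by (auto simp: factorization_in_def)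
    have "prod_list us = smult (inverse p) (\<Prod>w\<in>\<Omega>. F w)"
      using us by (simp add: factorization_in_def H_def el_def)
    then obtain cs Ks where len_cs: "length cs = ?n" "length Ks = ?n" and cs0: "0 \<notin> set cs"
      and cs_prod: "inverse p = prod_list cs" and UnK: "\<Union>(set Ks) = \<Omega>"
      and us_el: "\<forall>a<?n. us ! a = smult (cs ! a) (\<Prod>w\<in>Ks ! a. F w)"
      and disj: "\<forall>i<?n. \<forall>j<?n. i \<noteq> j \<longrightarrow> Ks ! i \<inter> Ks ! j = {}"
      using factors_of_prime_elem_prod[where I = \<Omega> and F = F and c = "inverse p" and us = us]
        finite_Omega prime_F p by auto
    have us_eq: "us ! a = el (cs ! a) (Ks ! a)" if "a < ?n" for a
      using us_el that by (simp add: el_def)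
    have Ksub: "Ks ! a \<subseteq> \<Omega>" if "a < ?n" for a using UnK that len_cs nth_mem[of a Ks] by auto
    have c0: "cs ! a \<noteq> 0" if "a < ?n" for a using cs0 that len_cs by (metis nth_mem)
    have ge: "- fdiv (Ks ! a) \<le> v (cs ! a)" if "a < ?n" for a
      using irr_us[OF that] el_in_iff[OF Ksub c0] that us_eq[OF that] by (simp add: irreducible_in_def)
    have "v (prod_list xs) = sum_list (map v xs)" if "0 \<notin> set xs" for xs
      using that by (induction xs) (auto simp: v_mult prod_list_zero_iff)
    then have "sum_list (map v cs) = - 1" using cs_prod cs0 p by (metis v_inverse)
    then have sum_v: "(\<Sum>a<?n. v (cs ! a)) = - 1" using len_cs by (simp add: sum_list_sum_nth atLeast0LessThan)
    obtain a0 where a0: "a0 < ?n" "b \<in> Ks ! a0" using UnK b_in len_cs by (metis UnionE in_set_conv_nth)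
    have no_b: "b \<notin> Ks ! a" if "a < ?n" "a \<noteq> a0" for a using disj a0 that by blast
    have fd0: "fdiv (Ks ! a) = 0" if "a < ?n" "a \<noteq> a0" for a
      using no_b[OF that] by (auto simp: fdiv_def dest: cover_b)
    have ge0: "0 \<le> v (cs ! a)" if "a < ?n" "a \<noteq> a0" for a using ge[OF that(1)] fd0[OF that] by simp
    \<comment> \<open>The valuations of the constants add up to -1. They are non-negative away from
      \<open>a0\<close> and at least -1 at \<open>a0\<close>, so \<open>a0\<close> takes the whole
      pole and all others vanish.\<close>
    have split: "v (cs ! a0) + (\<Sum>a\<in>{..<?n} - {a0}. v (cs ! a)) = - 1"
      using sum_v a0 by (simp add: sum.remove[of _ a0])
    moreover have "0 \<le> (\<Sum>a\<in>{..<?n} - {a0}. v (cs ! a))" using ge0 by (intro sum_nonneg) auto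
    moreover have "-1 \<le> - fdiv (Ks ! a0)" by (simp add: fdiv_def)
    ultimately have v0: "v (cs ! a0) = -1" "fdiv (Ks ! a0) = 1"
      and s0: "(\<Sum>a\<in>{..<?n} - {a0}. v (cs ! a)) = 0" using ge[OF a0(1)] by linarith+
    have vc: "v (cs ! a) = - fdiv (Ks ! a)" if "a < ?n" for a
    proof (cases "a = a0")
      case False
      have "v (cs ! a) = 0"
        using s0 ge0 that False sum_nonneg_eq_0_iff[of "{..<?n} - {a0}" "\<lambda>a. v (cs ! a)"] by auto
      then show ?thesis using fd0 that False by simp
    qed (use v0 in simp)
    have min: "fdiv J + fdiv (Ks ! a - J) \<noteq> fdiv (Ks ! a)"
      if a: "a < ?n" and J: "J \<subseteq> Ks ! a" "J \<noteq> {}" "J \<noteq> Ks ! a" for a J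
      using irreducible_el_minimal[OF _ Ksub[OF a] c0[OF a] vc[OF a] J] irr_us[OF a] us_eq[OF a] by simp
    have ne: "Ks ! a \<noteq> {}" if a: "a < ?n" for a
    proof
      assume e: "Ks ! a = {}"
      then have "fdiv (Ks ! a) = 0" by (auto simp: fdiv_def dest: cover_b)
      then have "us ! a \<in> units_in IV" using el_unit_iff[OF Ksub[OF a] c0[OF a]] e vc[OF a] us_eq[OF a] by simp
      then show False using irr_us[OF a] by (simp add: irreducible_in_def)
    qed
    \<comment> \<open>No subset of a part without \<open>b\<close> is a cover, so every splitting of
      such a part is additive; irreducibility leaves only singletons.\<close>
    have single: "\<exists>w. Ks ! a = {w}" if a: "a < ?n" "a \<noteq> a0" for a
    proof (rule ccontr)
      assume H: "\<nexists>w. Ks ! a = {w}"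
      obtain w where w: "w \<in> Ks ! a" using ne[OF a(1)] by blast
      have "fdiv {w} = 0" "fdiv (Ks ! a - {w}) = 0"
        using no_b[OF a] w by (auto simp: fdiv_def dest: cover_b)
      then show False using min[OF a(1), of "{w}"] fd0[OF a] w H by (metis add_0 empty_not_insert insert_subset empty_subsetI)
    qed
    obtain i where i: "i \<in> {1..k}" "\<Omega> - B i \<subseteq> Ks ! a0"
      using v0(2) by (auto simp: fdiv_def cover_def split: if_splits)
    \<comment> \<open>A vertex of \<open>B i\<close> in this part could be split off while the rest
      remains a cover.\<close>
    have K0: "Ks ! a0 = \<Omega> - B i"
    proof (rule ccontr)
      assume "Ks ! a0 \<noteq> \<Omega> - B i"
      then obtain w where w: "w \<in> Ks ! a0" "w \<in> B i" using i Ksub[OF a0(1)] by blast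
      then have wb: "w \<noteq> b" using bJ[OF i(1)] by auto
      then have "fdiv {w} = 0" by (auto simp: fdiv_def dest: cover_b)
      moreover have "fdiv (Ks ! a0 - {w}) = 1"
        using i w wb a0 by (auto simp: fdiv_def cover_def)
      moreover have "{w} \<noteq> Ks ! a0" using wb a0(2) by auto
      ultimately show False using min[OF a0(1), of "{w}"] v0 w by simp
    qed
    have "set Ks = set (Js i)"
    proof
      show "set Ks \<subseteq> set (Js i)"
      proof
        fix K assume "K \<in> set Ks"
        then obtain a where a: "a < ?n" "K = Ks ! a" using len_cs by (metis in_set_conv_nth)
        show "K \<in> set (Js i)"
        proof (cases "a = a0")
          case False
          then obtain w where w: "K = {w}" using single a by blast
          then have "w \<notin> Ks ! a0" using disj a a0 False by blast
          then have "w \<in> B i" using K0 w a Ksub by blast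
          then show ?thesis using setJs[OF i(1)] w by simp
        qed (use a K0 setJs[OF i(1)] in simp)
      qed
      show "set (Js i) \<subseteq> set Ks"
      proof
        fix J assume "J \<in> set (Js i)"
        then consider "J = \<Omega> - B i" | w where "w \<in> B i" "J = {w}" using setJs[OF i(1)] by auto
        then show "J \<in> set Ks"
        proof cases
          case 1
          then show ?thesis using K0 a0 len_cs by (metis nth_mem)
        next
          case 2
          then have "w \<in> \<Union>(set Ks)" using UnK blocks[OF i(1)] by auto
          then obtain a where a: "a < ?n" "w \<in> Ks ! a" using len_cs by (metis UnionE in_set_conv_nth)
          then have "a \<noteq> a0" using K0 2 by auto
          then have "Ks ! a = {w}" using single a by fastforce
          then show ?thesis using 2 a len_cs by (metis nth_mem)
        qed
      qed
    qed
    moreover have "distinct Ks"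
      unfolding distinct_conv_nth len_cs using disj ne by (metis Int_absorb)
    ultimately obtain \<pi> where \<pi>: "bij_betw \<pi> {..<length Ks} {..<length (Js i)}"
      "\<And>a. a < length Ks \<Longrightarrow> Js i ! \<pi> a = Ks ! a"
      using distinct_same_set_bij[OF distJs[OF i(1)]] by metis
    have lenA: "length (A i) = length (Js i)" by (simp add: A_def)
    have "length (Js i) = ?n" using bij_betw_same_card[OF \<pi>(1)] len_cs by simp
    moreover have "\<exists>\<epsilon>\<in>units_in IV. us ! a = \<epsilon> * A i ! \<pi> a" if a: "a < ?n" for a
    proof -
      have "\<pi> a < length (Js i)" using \<pi>(1) a len_cs by (auto simp: bij_betw_def)
      then have "A i ! \<pi> a = el (cc (Ks ! a)) (Ks ! a)" using \<pi>(2) a len_cs by (simp add: A_def)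
      then have "us ! a = [:cs ! a / cc (Ks ! a):] * A i ! \<pi> a"
        using us_eq[OF a] cc by (simp add: el_def)
      moreover have "cs ! a / cc (Ks ! a) \<noteq> 0" "v (cs ! a / cc (Ks ! a)) = 0"
        using c0[OF a] vc[OF a] cc by (simp_all add: v_divide)
      then have "[:cs ! a / cc (Ks ! a):] \<in> units_in IV" unfolding unit_iff by blast
      ultimately show ?thesis by blast
    qed
    ultimately have "essentially_same_in IV (A i) us"
      unfolding essentially_same_in_def using \<pi>(1) lenA len_cs by auto
    then show ?thesis using i by blast
  qed
  show ?thesis using HI fact len diff all by blast
qed

end

section \<open>Polynomials realising the cover configuration\<close>

text \<open>The conclusion of the theorem as a property of \<open>V\<close> alone, so that it can be
  negated as a whole in the argument with two primes.\<close>

definition prescribed_lengths :: "'a::field set \<Rightarrow> bool" where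
  "prescribed_lengths V \<longleftrightarrow> (\<forall>(k::nat) n. 0 < k \<longrightarrow> (\<forall>i\<in>{1..k}. 1 < n i) \<longrightarrow>
     (\<exists>H \<in> Int_poly V. \<exists>A :: nat \<Rightarrow> 'a poly list.
           (\<forall>i\<in>{1..k}. factorization_in (Int_poly V) H (A i) \<and> length (A i) = n i) \<and>
           (\<forall>i\<in>{1..k}. \<forall>j\<in>{1..k}. i \<noteq> j \<longrightarrow> \<not> essentially_same_in (Int_poly V) (A i) (A j)) \<and>
           (\<forall>us. factorization_in (Int_poly V) H us \<longrightarrow>
                  (\<exists>i\<in>{1..k}. essentially_same_in (Int_poly V) (A i) us))))"

context discrete_valuation
begin

text \<open>Density in the \<open>v\<close>-adic topology on coefficients. The degree of
  \<open>F\<close> may exceed that of \<open>G\<close>, since the extra coefficients only need to be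
  \<open>v\<close>-adically small.\<close>

definition irreducibles_dense :: bool where
  "irreducibles_dense \<longleftrightarrow>
     (\<forall>G e D. \<exists>F. irreducible F \<and> D < degree F \<and> (\<forall>i. vge e (coeff (F - G) i)))"

lemma approximating_family:
  assumes dense: irreducibles_dense and fin: "finite W"
  shows "\<exists>F. inj_on (\<lambda>w. degree (F w)) W \<and>
           (\<forall>w\<in>W. irreducible (F w) \<and> 1 < degree (F w) \<and> (\<forall>i. vge e (coeff (F w - G w) i)))"
  using fin
proof (induction W rule: finite_induct)
  case (insert w W)
  obtain F where F: "inj_on (\<lambda>w. degree (F w)) W"
    "\<forall>w\<in>W. irreducible (F w) \<and> 1 < degree (F w) \<and> (\<forall>i. vge e (coeff (F w - G w) i))"
    using insert.IH by blast
  \<comment> \<open>The sum is merely a bound for all degrees chosen so far; the summand 1 keeps the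
    new degree above one.\<close>
  obtain f where f: "irreducible f" "1 + (\<Sum>u\<in>W. degree (F u)) < degree f" "\<forall>i. vge e (coeff (f - G w) i)"
    using dense unfolding irreducibles_dense_def by blast
  have less: "degree (F u) < degree f" if "u \<in> W" for u
    using f(2) member_le_sum[OF that, of "\<lambda>u. degree (F u)"] insert.hyps by simp
  have "inj_on (\<lambda>u. degree ((F(w := f)) u)) (insert w W)"
  proof (rule inj_onI)
    fix x y
    assume "x \<in> insert w W" "y \<in> insert w W" "degree ((F(w := f)) x) = degree ((F(w := f)) y)"
    then show "x = y"
      using F(1) less[of x] less[of y] by (auto simp: inj_on_def split: if_splits)
  qed
  moreover have "\<forall>u\<in>insert w W. irreducible ((F(w := f)) u) \<and> 1 < degree ((F(w := f)) u) \<and>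
      (\<forall>i. vge e (coeff ((F(w := f)) u - G u) i))"
    using F(2) f by simp
  ultimately show ?case by blast
qed simp

lemma irreducible_no_root:
  assumes "irreducible (F :: 'a poly)" "1 < degree F"
  shows "poly F x \<noteq> 0"
proof
  assume "poly F x = 0"
  then obtain g where g: "F = [:- x, 1:] * g" by (auto simp: poly_eq_0_iff_dvd)
  then have "g dvd 1" using irreducibleD[OF assms(1) g] by (auto simp: is_unit_iff_degree)
  moreover have "g \<noteq> 0" using assms(2) g by auto
  ultimately have "degree F = 1" unfolding g by (subst degree_mult_eq) (auto simp: is_unit_iff_degree)
  then show False using assms(2) by simp
qed

text \<open>Every pair of vertices from different blocks gets a shell on which precisely the two
  polynomials of this pair have positive valuation. The distinguished polynomial has positive
  valuation exactly on the remaining shells; adding a uniformizer to a square makes that valuation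
  equal to one.\<close>

theorem prescribed_factorization_lengths:
  assumes m: "0 < m" "\<And>u. u \<noteq> 0 \<Longrightarrow> v u = 0 \<Longrightarrow> vge 1 (u ^ m - 1)" and dense: irreducibles_dense
  shows "prescribed_lengths val_ring"
  unfolding prescribed_lengths_def
proof (intro allI impI)
  fix k :: nat and n :: "nat \<Rightarrow> nat"
  assume k: "0 < k" and "\<forall>i\<in>{1..k}. 1 < n i"
  then have n: "1 < n i" if "i \<in> {1..k}" for i using that by blast
  \<comment> \<open>The first coordinate names the block. Blocks are numbered from 1, which leaves
    \<open>(0, 0)\<close> for \<open>b\<close>. A block of \<open>n i - 1\<close> vertices, together
    with the factor of its complement, gives length \<open>n i\<close>.\<close>
  define B where "B i = {i} \<times> {..<n i - 1}" for i
  define b :: "nat \<times> nat" where "b = (0, 0)"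
  define \<Omega>' where "\<Omega>' = (\<Union>i\<in>{1..k}. B i)"
  define C where "C = {(u, w). u \<in> \<Omega>' \<and> w \<in> \<Omega>' \<and> fst u \<noteq> fst w}"
  have fin': "finite \<Omega>'" by (simp add: \<Omega>'_def B_def)
  have "C \<subseteq> \<Omega>' \<times> \<Omega>'" by (auto simp: C_def)
  then have finC: "finite C" using fin' finite_subset by blast
  have b: "b \<notin> \<Omega>'" by (auto simp: \<Omega>'_def B_def b_def)
  have fst_mem: "fst w \<in> {1..k}" "w \<in> B (fst w)" if "w \<in> \<Omega>'" for w using that by (auto simp: \<Omega>'_def B_def)
  have fst_B: "fst w = i" if "w \<in> B i" for w i using that by (auto simp: B_def)
  \<comment> \<open>\<open>pl\<close> assigns to each pair its shell, the set of \<open>x\<close>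
    with \<open>v x = int (pl c)\<close>.\<close>
  obtain pl :: "(nat \<times> nat) \<times> nat \<times> nat \<Rightarrow> nat" where pl: "inj_on pl C"
    using finite_imp_inj_to_nat_seg[OF finC] by blast
  obtain s :: "nat \<Rightarrow> 'a poly" where
    s1: "\<And>i x. x \<noteq> 0 \<Longrightarrow> v x = int i \<Longrightarrow> vge 1 (poly (s i) x - 1)" and
    s2: "\<And>i x. vge 0 x \<Longrightarrow> x = 0 \<or> v x \<noteq> int i \<Longrightarrow> vge 1 (poly (s i) x)"
    using shell_indicators[OF m] by blast
  define S where "S T = (\<Sum>i\<in>T. s i)" for T
  have S1: "vge 1 (poly (S T) x - 1)" if "finite T" "x \<noteq> 0" "v x = int i" "i \<in> T" for T x i
  proof -
    have "poly (S T) x - 1 = (poly (s i) x - 1) + (\<Sum>j\<in>T - {i}. poly (s j) x)"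
      using that by (simp add: S_def poly_sum sum.remove)
    also have "vge 1 \<dots>"
      using that by (intro vge_add s1 vge_sum s2) (auto simp: vge_def)
    finally show ?thesis .
  qed
  have S2: "vge 1 (poly (S T) x)" if "vge 0 x" "\<And>i. i \<in> T \<Longrightarrow> x = 0 \<or> v x \<noteq> int i" for T x
    unfolding S_def poly_sum using that by (intro vge_sum s2) auto
  obtain p where p: "p \<noteq> 0" "v p = 1" using v_surj by blast
  define T where "T w = pl ` {c \<in> C. fst c = w \<or> snd c = w}" for w
  have finT: "finite (T w)" for w using finC by (simp add: T_def)
  define G where "G w = (if w = b then S (pl ` C) ^ 2 + [:p:] else 1 - S (T w))" for w
  \<comment> \<open>Precision 2 preserves valuation exactly one for \<open>F b\<close>; for the
    other polynomials precision 1 is enough to tell zero from positive valuation.\<close>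
  obtain F where F: "inj_on (\<lambda>w. degree (F w)) (insert b \<Omega>')"
    "\<And>w. w \<in> insert b \<Omega>' \<Longrightarrow> irreducible (F w) \<and> 1 < degree (F w) \<and> (\<forall>i. vge 2 (coeff (F w - G w) i))"
    using approximating_family[OF dense finite_insert[THEN iffD2, OF fin'], of b 2 G] by blast
  have F0: "poly (F w) x \<noteq> 0" if "w \<in> insert b \<Omega>'" for w x
    using irreducible_no_root F(2)[OF that] by blast
  have FG: "vge 2 (poly (F w) x - poly (G w) x)" if "w \<in> insert b \<Omega>'" "vge 0 x" for w x
    using vge_poly[of 2 "F w - G w" x] F(2)[OF that(1)] that(2) by simp
  have FG1: "vge 1 (poly (F w) x - poly (G w) x)" if "w \<in> insert b \<Omega>'" "vge 0 x" for w x
    using FG[OF that] by (rule vge_mono) simp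
  have on_T: "1 \<le> v (poly (F w) x)" if w: "w \<in> \<Omega>'" and x: "x \<noteq> 0" "v x = int i" "i \<in> T w" for w x i
  proof -
    have "vge 1 (- (poly (S (T w)) x - 1))" using S1[OF finT x] unfolding vge_minus .
    then have "vge 1 (poly (G w) x)" using w b by (auto simp: G_def)
    then have "vge 1 (poly (F w) x - poly (G w) x + poly (G w) x)"
      using w x by (intro vge_add FG1) (auto simp: vge_def)
    then show ?thesis using F0[of w x] w by (simp add: vge_def)
  qed
  have off_T: "v (poly (F w) x) = 0" if w: "w \<in> \<Omega>'" and x: "vge 0 x" "\<And>i. i \<in> T w \<Longrightarrow> x = 0 \<or> v x \<noteq> int i" for w x
  proof -
    have "vge 1 (- poly (S (T w)) x)" using S2[OF x] by simp
    then have "vge 1 (poly (F w) x - poly (G w) x + - poly (S (T w)) x)"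
      using w x by (intro vge_add FG1) auto
    moreover have "poly (G w) x = 1 - poly (S (T w)) x" using w b by (auto simp: G_def)
    ultimately have "vge 1 (poly (F w) x - 1)" by simp
    then show ?thesis using unit_perturb by blast
  qed
  have b_on: "v (poly (F b) x) = 0" if x: "x \<noteq> 0" "v x = int i" "i \<in> pl ` C" for x i
  proof -
    have "vge 1 (poly (S (pl ` C)) x - 1)" using S1[OF _ x] finC by simp
    then have "vge 1 (poly (S (pl ` C)) x ^ 2 - 1 ^ 2)"
      using unit_perturb by (intro vge_power_cong) (auto simp: vge_def)
    moreover have "vge 1 p" using p by (simp add: vge_def)
    ultimately have "vge 1 ((poly (S (pl ` C)) x ^ 2 - 1) + p)" by (simp add: vge_add)
    then have "vge 1 (poly (F b) x - poly (G b) x + ((poly (S (pl ` C)) x ^ 2 - 1) + p))"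
      using x by (intro vge_add[OF FG1]) (auto simp: vge_def)
    then have "vge 1 (poly (F b) x - 1)" by (simp add: G_def poly_power)
    then show ?thesis using unit_perturb by blast
  qed
  have b_off: "v (poly (F b) x) = 1" if x: "vge 0 x" "\<And>i. i \<in> pl ` C \<Longrightarrow> x = 0 \<or> v x \<noteq> int i" for x
  proof -
    have "vge (int 2 * 1) (poly (S (pl ` C)) x ^ 2)" by (intro vge_power S2 x)
    then have "vge 2 (poly (F b) x - poly (G b) x + poly (S (pl ` C)) x ^ 2)"
      using x by (intro vge_add[OF FG]) auto
    then have "vge (v p + 1) (poly (F b) x - p)" using p by (simp add: G_def poly_power)
    then show ?thesis using v_perturb[OF p(1)] p by simp
  qed
  have nonneg: "0 \<le> v (poly (F w) x)" if "w \<in> insert b \<Omega>'" "vge 0 x" for w x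
  proof (cases "w = b")
    case True
    have "v (poly (F b) x) = 0 \<or> v (poly (F b) x) = 1" using b_on[of x] b_off[OF that(2)] by blast
    then show ?thesis using True by auto
  next
    case False
    then have w: "w \<in> \<Omega>'" using that by simp
    show ?thesis
    proof (cases "\<exists>i\<in>T w. x \<noteq> 0 \<and> v x = int i")
      case True
      then show ?thesis using on_T[OF w, of x] by force
    next
      case False
      then have "v (poly (F w) x) = 0" using that(2) by (intro off_T w) auto
      then show ?thesis by simp
    qed
  qed
  \<comment> \<open>The point 0 lies on no shell. It serves as witness for \<open>total\<close>, and
    for \<open>noncover\<close> when \<open>b\<close> is missing.\<close>
  have at_0: "v (poly (F b) 0) = 1" "\<And>w. w \<in> \<Omega>' \<Longrightarrow> v (poly (F w) 0) = 0"
    using b_off[of 0] off_T[of _ 0] by auto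
  interpret cover_configuration v "insert b \<Omega>'" b B k F
  proof unfold_locales
    show "B i \<subseteq> insert b \<Omega>' - {b}" if "i \<in> {1..k}" for i using b that by (auto simp: \<Omega>'_def)
    show "B i \<noteq> {}" if "i \<in> {1..k}" for i using n[OF that] by (auto simp: B_def lessThan_empty_iff)
    show "B i \<inter> B j = {}" if "i \<noteq> j" for i j using that by (auto simp: B_def)
    show "\<exists>x. vge 0 x \<and> (\<Sum>w\<in>insert b \<Omega>'. v (poly (F w) x)) = 1"
      using at_0 b fin' by (intro exI[of _ 0]) simp
  next
    fix I i x
    assume I: "b \<in> I" "I \<subseteq> insert b \<Omega>'" "insert b \<Omega>' - B i \<subseteq> I" and x: "vge 0 x"
    have finI: "finite I" using I fin' finite_subset by auto
    \<comment> \<open>On the shell of a pair both of its polynomials have positive valuation, and at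
      most one vertex of the pair lies in the block \<open>B i\<close>. Off all shells
      \<open>F b\<close> has positive valuation.\<close>
    have "\<exists>w\<in>I. 1 \<le> v (poly (F w) x)"
    proof (cases "\<exists>c\<in>C. x \<noteq> 0 \<and> v x = int (pl c)")
      case True
      then obtain u w where c: "(u, w) \<in> C" "x \<noteq> 0" "v x = int (pl (u, w))" by auto
      then have uw: "u \<in> \<Omega>'" "w \<in> \<Omega>'" "fst u \<noteq> fst w" by (auto simp: C_def)
      have "pl (u, w) \<in> T u" "pl (u, w) \<in> T w" using c(1) by (auto simp: T_def)
      then have "1 \<le> v (poly (F u) x)" "1 \<le> v (poly (F w) x)" using on_T uw c by blast+
      moreover have "u \<in> I \<or> w \<in> I" using uw fst_B I(3) by blast
      ultimately show ?thesis by blast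
    next
      case False
      then have "v (poly (F b) x) = 1" using b_off[OF x] by auto
      then show ?thesis using I by force
    qed
    then obtain w where w: "w \<in> I" "1 \<le> v (poly (F w) x)" by blast
    have "v (poly (F w) x) \<le> (\<Sum>w\<in>I. v (poly (F w) x))"
      using member_le_sum[OF w(1), of "\<lambda>w. v (poly (F w) x)"] nonneg I x finI by blast
    then show "1 \<le> (\<Sum>w\<in>I. v (poly (F w) x))" using w by simp
  next
    fix I assume I: "I \<subseteq> insert b \<Omega>'" "\<not> (b \<in> I \<and> (\<exists>i\<in>{1..k}. insert b \<Omega>' - B i \<subseteq> I))"
    show "\<exists>x. vge 0 x \<and> (\<Sum>w\<in>I. v (poly (F w) x)) = 0"
    proof (cases "b \<in> I")
      case False
      then have "(\<Sum>w\<in>I. v (poly (F w) 0)) = 0" using at_0 I by (intro sum.neutral) auto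
      then show ?thesis using vge_0 by blast
    next
      case True
      then have nc: "\<not> (insert b \<Omega>' - B i \<subseteq> I)" if "i \<in> {1..k}" for i using I that by blast
      \<comment> \<open>Block 1 yields a missing vertex \<open>u\<close>; the block of
        \<open>u\<close> then yields a second missing vertex \<open>w\<close> outside it. On the
        shell of \<open>(u, w)\<close> all polynomials with index in \<open>I\<close> have valuation
        zero.\<close>
      obtain u where u: "u \<in> \<Omega>'" "u \<notin> I" using nc[of 1] k True by auto
      obtain w where w: "w \<in> \<Omega>'" "w \<notin> I" "fst u \<noteq> fst w"
        using nc[of "fst u"] fst_mem[OF u(1)] True fst_mem(2) by fastforce
      have c: "(u, w) \<in> C" using u w by (simp add: C_def)
      define x where "x = p ^ pl (u, w)"
      have x: "x \<noteq> 0" "v x = int (pl (u, w))" using p by (simp_all add: x_def v_power)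
      have x0: "vge 0 x" using x by (simp add: vge_def)
      have "v (poly (F y) x) = 0" if y: "y \<in> I" for y
      proof (cases "y = b")
        case True
        then show ?thesis using b_on[OF x] c by simp
      next
        case False
        then have y': "y \<in> \<Omega>'" using y I by auto
        have "pl (u, w) \<notin> T y"
        proof
          assume "pl (u, w) \<in> T y"
          then obtain c' where "c' \<in> C" "fst c' = y \<or> snd c' = y" "pl c' = pl (u, w)"
            unfolding T_def by auto
          then have "y = u \<or> y = w" using pl c by (metis fst_conv inj_onD snd_conv)
          then show False using y u w by auto
        qed
        then show ?thesis using off_T[OF y' x0] x by auto
      qed
      then show ?thesis using x0 by (metis (no_types, lifting) sum.neutral)
    qed
  qed (use fin' F F0 nonneg in auto)
  have "Suc (card (B i)) = n i" if "i \<in> {1..k}" for i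
    using n[OF that] by (simp add: B_def card_cartesian_product)
  then show "\<exists>H \<in> Int_poly val_ring. \<exists>A :: nat \<Rightarrow> 'a poly list.
      (\<forall>i\<in>{1..k}. factorization_in (Int_poly val_ring) H (A i) \<and> length (A i) = n i) \<and>
      (\<forall>i\<in>{1..k}. \<forall>j\<in>{1..k}. i \<noteq> j \<longrightarrow> \<not> essentially_same_in (Int_poly val_ring) (A i) (A j)) \<and>
      (\<forall>us. factorization_in (Int_poly val_ring) H us \<longrightarrow>
        (\<exists>i\<in>{1..k}. essentially_same_in (Int_poly val_ring) (A i) us))"
    using factorizations_of_cover_configuration[OF k] by simp
qed

end

section \<open>Valuation rings and finite extensions\<close>

lemma
  assumes R: "is_subring R"
  shows subring_0: "0 \<in> R" and subring_1: "1 \<in> R"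
    and subring_diff: "x \<in> R \<Longrightarrow> y \<in> R \<Longrightarrow> x - y \<in> R"
    and subring_mult: "x \<in> R \<Longrightarrow> y \<in> R \<Longrightarrow> x * y \<in> R"
    and subring_minus: "x \<in> R \<Longrightarrow> - x \<in> R"
    and subring_add: "x \<in> R \<Longrightarrow> y \<in> R \<Longrightarrow> x + y \<in> R"
proof -
  show 1: "1 \<in> R" and d: "\<And>x y. x \<in> R \<Longrightarrow> y \<in> R \<Longrightarrow> x - y \<in> R"
    and "x \<in> R \<Longrightarrow> y \<in> R \<Longrightarrow> x * y \<in> R" for x y
    using R by (auto simp: is_subring_def)
  show 0: "0 \<in> R" using d[OF 1 1] by simp
  show m: "- x \<in> R" if "x \<in> R" for x using d[OF 0 that] by simp
  show "x + y \<in> R" if "x \<in> R" "y \<in> R" for x y using d[OF that(1) m[OF that(2)]] by simp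
qed

lemma subring_power: "is_subring R \<Longrightarrow> x \<in> R \<Longrightarrow> x ^ n \<in> R"
  by (induction n) (auto intro: subring_1 subring_mult)

lemma subring_sum: "is_subring R \<Longrightarrow> (\<And>i. i \<in> I \<Longrightarrow> f i \<in> R) \<Longrightarrow> (\<Sum>i\<in>I. f i) \<in> R"
  by (induction I rule: infinite_finite_induct) (auto intro: subring_0 subring_add)

lemma subring_of_int: "is_subring R \<Longrightarrow> of_int a \<in> R"
proof (induction a rule: int_induct[where k = 0])
  case base
  then show ?case by (simp add: subring_0)
next
  case (step1 i)
  then show ?case by (simp add: subring_add subring_1)
next
  case (step2 i)
  then show ?case by (simp add: subring_diff subring_1)
qed

lemma subring_UNIV: "is_subring UNIV"
  by (simp add: is_subring_def)

lemma subfield_UNIV: "is_subfield UNIV"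
  by (simp add: is_subfield_def subring_UNIV)

lemma subfield_subring: "is_subfield L \<Longrightarrow> is_subring L"
  by (simp add: is_subfield_def)

lemma subfield_inverse: "is_subfield L \<Longrightarrow> x \<in> L \<Longrightarrow> inverse x \<in> L"
  by (cases "x = 0") (auto simp: is_subfield_def)

lemma subfield_divide: "is_subfield L \<Longrightarrow> x \<in> L \<Longrightarrow> y \<in> L \<Longrightarrow> x / y \<in> L"
  by (simp add: divide_inverse subring_mult subfield_subring subfield_inverse)

text \<open>For a valuation ring this is the maximal ideal.\<close>

definition nonunits :: "'a::field set \<Rightarrow> 'a set" where
  "nonunits W = {x \<in> W. x = 0 \<or> inverse x \<notin> W}"

text \<open>Valuation rings without a value group: \<open>x / y \<in> W\<close> takes the place of
  comparing the values of \<open>x\<close> and \<open>y\<close>.\<close>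

locale valuation_subring =
  fixes L W :: "'a::field set"
  assumes L: "is_subfield L" and W: "is_subring W" and WL: "W \<subseteq> L"
    and total: "x \<in> L \<Longrightarrow> x \<noteq> 0 \<Longrightarrow> x \<in> W \<or> inverse x \<in> W"
begin

abbreviation "M \<equiv> nonunits W"

lemmas W_0 = subring_0[OF W] and W_1 = subring_1[OF W] and W_add = subring_add[OF W]
  and W_diff = subring_diff[OF W] and W_mult = subring_mult[OF W] and W_minus = subring_minus[OF W]
  and W_power = subring_power[OF W]

lemmas L_divide = subfield_divide[OF L]

lemma M_W: "x \<in> M \<Longrightarrow> x \<in> W"
  by (simp add: nonunits_def)

lemma unit_iff: "x \<in> W \<Longrightarrow> x \<notin> M \<longleftrightarrow> x \<noteq> 0 \<and> inverse x \<in> W"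
  by (simp add: nonunits_def)

lemma M_0: "0 \<in> M" and M_1: "1 \<notin> M"
  using W_0 W_1 by (auto simp: nonunits_def)

lemma M_mult: "a \<in> W \<Longrightarrow> x \<in> M \<Longrightarrow> a * x \<in> M"
proof -
  assume a: "a \<in> W" and x: "x \<in> M"
  have "inverse x \<in> W" if "a * x \<noteq> 0" "inverse (a * x) \<in> W"
  proof -
    have "a * inverse (a * x) \<in> W" using a that W_mult by blast
    then show ?thesis using that by (simp add: field_simps)
  qed
  then show ?thesis using a x W_mult by (auto simp: nonunits_def)
qed

lemma M_mult2: "x \<in> M \<Longrightarrow> a \<in> W \<Longrightarrow> x * a \<in> M"
  using M_mult[of a x] by (simp add: mult.commute)

lemma M_minus: "x \<in> M \<Longrightarrow> - x \<in> M"
  using M_mult[of "-1" x] W_1 W_minus by simp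

lemma not_in_imp_inverse_M: "x \<in> L \<Longrightarrow> x \<notin> W \<Longrightarrow> inverse x \<in> M"
  using total[of x] W_0 by (cases "x = 0") (auto simp: nonunits_def)

text \<open>If \<open>y\<close> divides \<open>x\<close> in \<open>W\<close>, then
  \<open>x + y\<close> is a multiple of \<open>y\<close>; of two non-zero elements one divides the
  other.\<close>

lemma M_add: "x \<in> M \<Longrightarrow> y \<in> M \<Longrightarrow> x + y \<in> M"
proof -
  have *: "x + y \<in> M" if "x \<in> M" "y \<in> M" "y \<noteq> 0" "x / y \<in> W" for x y
  proof -
    have "(x / y + 1) * y \<in> M" using that by (intro M_mult W_add W_1)
    moreover have "(x / y + 1) * y = x + y" using that by (simp add: distrib_right)
    ultimately show ?thesis by simp
  qed
  assume xy: "x \<in> M" "y \<in> M"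
  show ?thesis
  proof (cases "x = 0 \<or> y = 0")
    case False
    have "x / y \<in> L" using xy M_W WL by (intro L_divide) auto
    then have "x / y \<in> W \<or> y / x \<in> W" using total[of "x / y"] False by auto
    then show ?thesis using *[of x y] *[of y x] xy False by (auto simp: add.commute)
  qed (use xy in auto)
qed

lemma M_diff: "x \<in> M \<Longrightarrow> y \<in> M \<Longrightarrow> x - y \<in> M"
  using M_add[of x "- y"] M_minus by simp

lemma M_sum: "(\<And>i. i \<in> I \<Longrightarrow> f i \<in> M) \<Longrightarrow> (\<Sum>i\<in>I. f i) \<in> M"
  by (induction I rule: infinite_finite_induct) (auto intro: M_0 M_add)

lemma M_prime: "x \<in> W \<Longrightarrow> y \<in> W \<Longrightarrow> x * y \<in> M \<Longrightarrow> x \<in> M \<or> y \<in> M"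
  using W_mult by (auto simp: nonunits_def)

lemma unit_mult: "x \<in> W - M \<Longrightarrow> y \<in> W - M \<Longrightarrow> x * y \<in> W - M"
  using M_prime W_mult by blast

lemma unit_inverse: "x \<in> W - M \<Longrightarrow> inverse x \<in> W - M"
  by (auto simp: nonunits_def)

lemma unit_nz: "x \<in> W - M \<Longrightarrow> x \<noteq> 0"
  using M_0 by auto

lemma one_plus_M: "x \<in> M \<Longrightarrow> 1 + x \<in> W - M"
  using M_diff[of "1 + x" x] M_1 M_W W_1 W_add by auto

lemma power_M: "x \<in> M \<Longrightarrow> 0 < n \<Longrightarrow> x ^ n \<in> M"
  by (cases n) (auto simp: intro: M_mult2 W_power M_W)

text \<open>If \<open>x\<close> were outside \<open>W\<close>, its inverse would lie in
  \<open>M\<close>, and multiplying \<open>x ^ n\<close> by a power of it would put 1 into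
  \<open>M\<close>.\<close>

lemma power_in_W: "x \<in> L \<Longrightarrow> 0 < n \<Longrightarrow> x ^ n \<in> W \<Longrightarrow> x \<in> W"
proof (rule ccontr)
  assume x: "x \<in> L" "0 < n" "x ^ n \<in> W" "x \<notin> W"
  then have "inverse x ^ n \<in> M" using not_in_imp_inverse_M power_M by blast
  then have "x ^ n * inverse x ^ n \<in> M" using x M_mult by blast
  moreover have "x \<noteq> 0" using x W_0 by auto
  ultimately show False using M_1 by (simp add: power_mult_distrib[symmetric])
qed

text \<open>The form, free of value groups, of the existence of a member of least value;
  divisibility in \<open>W\<close> is total on \<open>L\<close>.\<close>

lemma minimal_value:
  assumes "finite I" "\<And>i. i \<in> I \<Longrightarrow> f i \<in> L" "\<exists>i\<in>I. f i \<noteq> 0"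
  shows "\<exists>i\<in>I. f i \<noteq> 0 \<and> (\<forall>j\<in>I. f j / f i \<in> W)"
  using assms
proof (induction I rule: finite_induct)
  case (insert i I)
  show ?case
  proof (cases "\<exists>j\<in>I. f j \<noteq> 0")
    case False
    then have "f i \<noteq> 0" "\<forall>j\<in>I. f j = 0" using insert by auto
    then show ?thesis using W_0 W_1 by auto
  next
    case True
    then obtain j where j: "j \<in> I" "f j \<noteq> 0" "\<forall>l\<in>I. f l / f j \<in> W" using insert by auto
    show ?thesis
    proof (cases "f i / f j \<in> W")
      case True
      then show ?thesis using j by auto
    next
      case False
      have "f i / f j \<in> L" using insert j L_divide by auto
      moreover have i0: "f i \<noteq> 0" using False W_0 by auto
      ultimately have "f j / f i \<in> W" using total[of "f i / f j"] False j(2) by simp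
      moreover from this have "f l / f i \<in> W" if "l \<in> I" for l
        using W_mult[of "f l / f j" "f j / f i"] j that by simp
      ultimately show ?thesis using W_1 i0 by auto
    qed
  qed
qed simp

text \<open>In a vanishing sum the least value is attained twice: were it attained once, division by
  that term would show that -1 lies in \<open>M\<close>.\<close>

lemma sum_zero_same_value:
  assumes "finite I" "\<And>i. i \<in> I \<Longrightarrow> f i \<in> L" "\<exists>i\<in>I. f i \<noteq> 0" "(\<Sum>i\<in>I. f i) = 0"
  shows "\<exists>i\<in>I. \<exists>j\<in>I. i \<noteq> j \<and> f i \<noteq> 0 \<and> f j \<noteq> 0 \<and> f j / f i \<in> W - M"
proof -
  obtain i where i: "i \<in> I" "f i \<noteq> 0" "\<forall>j\<in>I. f j / f i \<in> W" using minimal_value[OF assms(1-3)] by blast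
  have "\<exists>j\<in>I - {i}. f j / f i \<notin> M"
  proof (rule ccontr)
    assume "\<not> ?thesis"
    then have "(\<Sum>j\<in>I - {i}. f j / f i) \<in> M" by (intro M_sum) auto
    moreover have "(\<Sum>j\<in>I - {i}. f j / f i) = - 1"
    proof -
      have "(\<Sum>j\<in>I - {i}. f j) = - f i"
        using assms(4) sum.remove[OF assms(1) i(1), of f] by (simp add: add_eq_0_iff)
      then show ?thesis using i(2) by (simp add: sum_divide_distrib[symmetric])
    qed
    ultimately show False using M_minus[of "-1"] M_1 by simp
  qed
  then obtain j where j: "j \<in> I" "j \<noteq> i" "f j / f i \<notin> M" by blast
  then have "f j \<noteq> 0" using M_0 by auto
  moreover have "f j / f i \<in> W - M" using i j by simp
  ultimately show ?thesis using i(1,2) j(1,2) by metis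
qed

end

section \<open>Linear dependence over a subfield\<close>

lemma homogeneous_system_solution:
  fixes a :: "'i \<Rightarrow> 'b \<Rightarrow> 'a::field"
  assumes L: "is_subfield L" and "finite B" "finite I" "card B < card I"
    and "\<And>i b. i \<in> I \<Longrightarrow> b \<in> B \<Longrightarrow> a i b \<in> L"
  shows "\<exists>c. (\<forall>i\<in>I. c i \<in> L) \<and> (\<exists>i\<in>I. c i \<noteq> 0) \<and> (\<forall>b\<in>B. (\<Sum>i\<in>I. c i * a i b) = 0)"
  using assms(2-)
proof (induction B arbitrary: a I rule: finite_induct)
  case empty
  then obtain i where "i \<in> I" by fastforce
  then show ?case using subring_1[OF subfield_subring[OF L]] by (intro exI[of _ "\<lambda>_. 1"]) auto
next
  case (insert b B)
  note Lc = subring_diff[OF subfield_subring[OF L]] subring_mult[OF subfield_subring[OF L]]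
    subring_minus[OF subfield_subring[OF L]] subring_sum[OF subfield_subring[OF L]] subfield_divide[OF L]
  show ?case
  proof (cases "\<forall>i\<in>I. a i b = 0")
    case True
    have "\<exists>c. (\<forall>i\<in>I. c i \<in> L) \<and> (\<exists>i\<in>I. c i \<noteq> 0) \<and> (\<forall>b\<in>B. (\<Sum>i\<in>I. c i * a i b) = 0)"
      using insert by (intro insert.IH) auto
    then show ?thesis using True by auto
  next
    case False
    then obtain k where k: "k \<in> I" "a k b \<noteq> 0" by blast
    \<comment> \<open>Elimination of the equation \<open>b\<close> with pivot \<open>k\<close>: the
      remaining unknowns solve the reduced system, and \<open>d\<close> is the value this forces on
      the unknown \<open>k\<close>.\<close>
    define a' where "a' i b' = a i b' - a i b / a k b * a k b'" for i b'
    have "\<exists>c. (\<forall>i\<in>I - {k}. c i \<in> L) \<and> (\<exists>i\<in>I - {k}. c i \<noteq> 0) \<and>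
            (\<forall>b\<in>B. (\<Sum>i\<in>I - {k}. c i * a' i b) = 0)"
    proof (rule insert.IH)
      show "card B < card (I - {k})" using insert k by simp
      show "\<And>i b. i \<in> I - {k} \<Longrightarrow> b \<in> B \<Longrightarrow> a' i b \<in> L"
        unfolding a'_def using insert k by (intro Lc) auto
    qed (use insert in auto)
    then obtain c where c: "\<forall>i\<in>I - {k}. c i \<in> L" "\<exists>i\<in>I - {k}. c i \<noteq> 0"
      "\<forall>b\<in>B. (\<Sum>i\<in>I - {k}. c i * a' i b) = 0" by blast
    define d where "d = - (\<Sum>i\<in>I - {k}. c i * (a i b / a k b))"
    define c' where "c' = c(k := d)"
    have sum: "(\<Sum>i\<in>I. c' i * a i b') = (\<Sum>i\<in>I - {k}. c i * a' i b')" for b'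
    proof -
      have "(\<Sum>i\<in>I. c' i * a i b') = d * a k b' + (\<Sum>i\<in>I - {k}. c i * a i b')"
        using sum.remove[OF insert.prems(1) k(1), of "\<lambda>i. c' i * a i b'"] by (simp add: c'_def)
      also have "d * a k b' = (\<Sum>i\<in>I - {k}. - (c i * (a i b / a k b) * a k b'))"
        by (simp add: d_def sum_distrib_right sum_negf)
      also have "\<dots> + (\<Sum>i\<in>I - {k}. c i * a i b') = (\<Sum>i\<in>I - {k}. c i * a' i b')"
        by (simp add: sum.distrib[symmetric] a'_def algebra_simps)
      finally show ?thesis .
    qed
    have "d \<in> L" unfolding d_def using c k insert.prems by (intro Lc) auto
    then have "\<forall>i\<in>I. c' i \<in> L" using c by (auto simp: c'_def)
    moreover have "\<exists>i\<in>I. c' i \<noteq> 0" using c(2) by (auto simp: c'_def)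
    moreover have "a' i b = 0" for i using k by (simp add: a'_def)
    then have "\<forall>b'\<in>insert b B. (\<Sum>i\<in>I. c' i * a i b') = 0" using c(3) by (auto simp: sum)
    ultimately show ?thesis by blast
  qed
qed

text \<open>With \<open>n\<close> the size of a spanning set, \<open>n + 1\<close> unknown
  coefficients face \<open>n\<close> equations. The elements form a sequence, which may repeat
  members.\<close>

lemma finite_extension_dependence:
  assumes "finite_extension L (UNIV :: 'a::field set)"
  obtains n where "\<And>x :: nat \<Rightarrow> 'a. \<exists>c. (\<forall>i\<le>n. c i \<in> L) \<and> (\<exists>i\<le>n. c i \<noteq> 0) \<and> (\<Sum>i\<le>n. c i * x i) = 0"
proof -
  obtain B where L: "is_subfield L" and B: "finite B"
    "\<And>x. \<exists>c. (\<forall>b\<in>B. c b \<in> L) \<and> x = (\<Sum>b\<in>B. c b * b)"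
    using assms unfolding finite_extension_def by blast
  have "\<exists>c. (\<forall>i\<le>card B. c i \<in> L) \<and> (\<exists>i\<le>card B. c i \<noteq> 0) \<and> (\<Sum>i\<le>card B. c i * x i) = 0"
    for x :: "nat \<Rightarrow> 'a"
  proof -
    have "\<forall>i. \<exists>c. (\<forall>b\<in>B. c b \<in> L) \<and> x i = (\<Sum>b\<in>B. c b * b)" using B(2) by blast
    then obtain a where "\<forall>i. (\<forall>b\<in>B. a i b \<in> L) \<and> x i = (\<Sum>b\<in>B. a i b * b)" by (rule choice[THEN exE])
    then have a: "\<And>i b. b \<in> B \<Longrightarrow> a i b \<in> L" "\<And>i. x i = (\<Sum>b\<in>B. a i b * b)" by blast+
    obtain c where c: "\<forall>i\<in>{..card B}. c i \<in> L" "\<exists>i\<in>{..card B}. c i \<noteq> 0"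
      "\<forall>b\<in>B. (\<Sum>i\<le>card B. c i * a i b) = 0"
      using homogeneous_system_solution[OF L B(1), of "{..card B}" a] a by auto
    have "(\<Sum>i\<le>card B. c i * x i) = (\<Sum>i\<le>card B. \<Sum>b\<in>B. c i * a i b * b)"
      by (simp add: a(2) sum_distrib_left mult.assoc)
    also have "\<dots> = (\<Sum>b\<in>B. (\<Sum>i\<le>card B. c i * a i b) * b)"
      by (subst sum.swap) (simp add: sum_distrib_right)
    also have "\<dots> = 0" using c(3) by simp
    finally show ?thesis using c by auto
  qed
  then show thesis using that by blast
qed

text \<open>Here \<open>K\<close> is the smaller field, and \<open>W\<close> is a valuation ring of
  the ambient one.\<close>

locale finite_over_subfield = valuation_subring UNIV W for W :: "'a::field set" +
  fixes K :: "'a set"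
  assumes fin_ext: "finite_extension K (UNIV :: 'a set)"
begin

lemma K: "is_subfield K"
  using fin_ext by (simp add: finite_extension_def)

text \<open>The value group of \<open>K\<close> has finite index: a linear relation among
  \<open>n + 1\<close> elements contains two terms of equal value, and their ratio is a
  unit.\<close>

lemma ratio_in_subfield_up_to_unit:
  obtains n where "\<And>x :: nat \<Rightarrow> 'a. (\<And>i. i \<le> n \<Longrightarrow> x i \<noteq> 0) \<Longrightarrow>
    \<exists>i j l u. i < j \<and> j \<le> n \<and> l \<in> K \<and> l \<noteq> 0 \<and> u \<in> W - M \<and> x j = l * u * x i"
proof -
  obtain n where n: "\<And>x :: nat \<Rightarrow> 'a. \<exists>c. (\<forall>i\<le>n. c i \<in> K) \<and> (\<exists>i\<le>n. c i \<noteq> 0) \<and> (\<Sum>i\<le>n. c i * x i) = 0"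
    using finite_extension_dependence[OF fin_ext] by blast
  have "\<exists>i j l u. i < j \<and> j \<le> n \<and> l \<in> K \<and> l \<noteq> 0 \<and> u \<in> W - M \<and> x j = l * u * x i"
    if x: "\<And>i. i \<le> n \<Longrightarrow> x i \<noteq> 0" for x :: "nat \<Rightarrow> 'a"
  proof -
    obtain c where c: "\<forall>i\<le>n. c i \<in> K" "\<exists>i\<le>n. c i \<noteq> 0" "(\<Sum>i\<le>n. c i * x i) = 0" using n by blast
    then obtain i j where ij: "i \<le> n" "j \<le> n" "i \<noteq> j" "c i * x i \<noteq> 0" "c j * x j \<noteq> 0"
      "c j * x j / (c i * x i) \<in> W - M"
      using sum_zero_same_value[of "{..n}" "\<lambda>i. c i * x i"] x by auto
    define u where "u = c j * x j / (c i * x i)"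
    have u: "u \<in> W - M" using ij unfolding u_def by blast
    then have u': "inverse u \<in> W - M" by (rule unit_inverse)
    have "x j = c i / c j * u * x i" "x i = c j / c i * inverse u * x j"
      using ij by (auto simp: u_def field_simps)
    moreover have "c i / c j \<in> K" "c j / c i \<in> K" "c i / c j \<noteq> 0" "c j / c i \<noteq> 0"
      using ij c(1) subfield_divide[OF K] by auto
    moreover have "i < j \<or> j < i" using ij(3) by auto
    ultimately show ?thesis using ij(1,2) u u' by blast
  qed
  then show thesis using that by blast
qed

text \<open>The relation is taken among the powers of \<open>x\<close>. The bound on the exponent is
  uniform in \<open>x\<close>, which later permits a common exponent.\<close>

lemma power_in_subfield_up_to_unit:
  obtains n where "\<And>x. x \<noteq> 0 \<Longrightarrow> \<exists>m l u. 0 < m \<and> m \<le> n \<and> l \<in> K \<and> l \<noteq> 0 \<and> u \<in> W - M \<and> x ^ m = l * u"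
proof -
  obtain n where n: "\<And>x :: nat \<Rightarrow> 'a. (\<And>i. i \<le> n \<Longrightarrow> x i \<noteq> 0) \<Longrightarrow>
    \<exists>i j l u. i < j \<and> j \<le> n \<and> l \<in> K \<and> l \<noteq> 0 \<and> u \<in> W - M \<and> x j = l * u * x i"
    using ratio_in_subfield_up_to_unit by blast
  have "\<exists>m l u. 0 < m \<and> m \<le> n \<and> l \<in> K \<and> l \<noteq> 0 \<and> u \<in> W - M \<and> x ^ m = l * u" if x: "x \<noteq> 0" for x
  proof -
    obtain i j l u where "i < j" "j \<le> n" "l \<in> K" "l \<noteq> 0" "u \<in> W - M" "x ^ j = l * u * x ^ i"
      using n[of "\<lambda>i. x ^ i"] x by auto
    moreover from this have "x ^ (j - i) * x ^ i = l * u * x ^ i" by (simp add: power_add[symmetric])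
    ultimately show ?thesis using x by (intro exI[of _ "j - i"]) (auto simp: algebra_simps)
  qed
  then show thesis using that by blast
qed

text \<open>If \<open>K\<close> lay in \<open>W\<close>, every non-zero \<open>x\<close> would have
  a positive power in \<open>W\<close>, and hence lie in \<open>W\<close> itself.\<close>

lemma subfield_not_subset: "W \<noteq> UNIV \<Longrightarrow> \<not> K \<subseteq> W"
proof
  assume W: "W \<noteq> UNIV" "K \<subseteq> W"
  obtain n where n: "\<And>x. x \<noteq> 0 \<Longrightarrow> \<exists>m l u. 0 < m \<and> m \<le> n \<and> l \<in> K \<and> l \<noteq> 0 \<and> u \<in> W - M \<and> x ^ m = l * u"
    using power_in_subfield_up_to_unit by blast
  have "x \<in> W" for x
  proof (cases "x = 0")
    case False
    then obtain m l u where "0 < m" "l \<in> K" "u \<in> W - M" "x ^ m = l * u" using n by blast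
    then show ?thesis using W W_mult power_in_W by (metis DiffD1 UNIV_I subsetD)
  qed (simp add: W_0)
  then show False using W by blast
qed

text \<open>Without a generator there is an infinite chain from \<open>t\<close> of strictly
  decreasing values in \<open>M\<close>. Finite index makes some ratio \<open>x i / x j\<close> an
  element of \<open>M \<inter> K\<close> up to a unit, hence divisible by \<open>t\<close>; then
  \<open>x i\<close> lies in \<open>t M\<close>, although \<open>x i\<close> divides
  \<open>t\<close>.\<close>

lemma principal_from_subfield:
  assumes t: "t \<in> M" "t \<noteq> 0" "\<And>x. x \<in> M \<inter> K \<Longrightarrow> x / t \<in> W"
  shows "\<exists>s\<in>M. s \<noteq> 0 \<and> (\<forall>x\<in>M. x / s \<in> W)"
proof (rule ccontr)
  assume not: "\<not> ?thesis"
  have "\<exists>x. x \<in> M \<and> x \<noteq> 0 \<and> s / x \<in> M" if s: "s \<in> M" "s \<noteq> 0" for s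
  proof -
    obtain x where x: "x \<in> M" "x / s \<notin> W" using not s by blast
    then show ?thesis using not_in_imp_inverse_M[of "x / s"] W_0 by force
  qed
  then obtain g where g: "\<And>s. s \<in> M \<Longrightarrow> s \<noteq> 0 \<Longrightarrow> g s \<in> M \<and> g s \<noteq> 0 \<and> s / g s \<in> M" by metis
  define x where "x i = (g ^^ i) t" for i
  have x: "x i \<in> M \<and> x i \<noteq> 0" for i by (induction i) (auto simp: x_def t g)
  have step: "x i / x (Suc i) \<in> M" for i using g x[of i] by (simp add: x_def)
  have quot: "x i / x (i + Suc d) \<in> M" for i d
  proof (induction d)
    case (Suc d)
    then have "x i / x (i + Suc d) * (x (i + Suc d) / x (Suc (i + Suc d))) \<in> M"
      using step M_mult2 M_W by blast
    then show ?case using x[of "i + Suc d"] by simp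
  qed (use step in simp)
  obtain n where n: "\<And>x :: nat \<Rightarrow> 'a. (\<And>i. i \<le> n \<Longrightarrow> x i \<noteq> 0) \<Longrightarrow>
    \<exists>i j l u. i < j \<and> j \<le> n \<and> l \<in> K \<and> l \<noteq> 0 \<and> u \<in> W - M \<and> x j = l * u * x i"
    using ratio_in_subfield_up_to_unit by blast
  obtain i j l u where ij: "i < j" and l: "l \<in> K" "l \<noteq> 0" and u: "u \<in> W - M" and eq: "x j = l * u * x i"
    using n[of x] x by blast
  have "x i / x j \<in> M" using quot[of i "j - Suc i"] ij by simp
  then have "x i / x j * u \<in> M" using u M_mult2 by blast
  moreover have "x i / x j * u = inverse l" using eq unit_nz[OF u] x[of i] l by (simp add: field_simps)
  ultimately have "inverse l / t \<in> W" using t(3) subfield_inverse[OF K l(1)] by auto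
  then have "inverse l / t * inverse u * x j \<in> M"
    using unit_inverse[OF u] x by (intro M_mult W_mult) auto
  then have xt: "x i / t \<in> M" using eq unit_nz[OF u] l by (simp add: field_simps)
  have "t / x i \<in> W"
  proof (cases i)
    case 0
    then show ?thesis using t W_1 by (simp add: x_def)
  next
    case (Suc d)
    then show ?thesis using quot[of 0 d] M_W by (simp add: x_def)
  qed
  then have "t / x i * (x i / t) \<in> M" using xt M_mult by blast
  then show False using M_1 t x[of i] by simp
qed

text \<open>The residue degree is at most the field degree. A maximal family with independent
  residues spans the residue field, so finitely many coefficient choices represent all
  residues.\<close>

lemma finite_residues_from_subfield:
  assumes S: "finite S" "\<And>x. x \<in> W \<inter> K \<Longrightarrow> \<exists>s\<in>S. x - s \<in> M"
  shows "\<exists>S'. finite S' \<and> (\<forall>x\<in>W. \<exists>s\<in>S'. x - s \<in> M)"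
proof -
  \<comment> \<open>\<open>P r\<close> says that some \<open>r\<close> elements of \<open>W\<close>
    have residues linearly independent over the residue field of
    \<open>W \<inter> K\<close>.\<close>
  define P where "P r \<longleftrightarrow> (\<exists>w::nat \<Rightarrow> 'a. (\<forall>i<r. w i \<in> W) \<and>
    (\<forall>c. (\<forall>i<r. c i \<in> W \<inter> K) \<longrightarrow> (\<Sum>i<r. c i * w i) \<in> M \<longrightarrow> (\<forall>i<r. c i \<in> M)))" for r
  obtain n where n: "\<And>x :: nat \<Rightarrow> 'a. \<exists>c. (\<forall>i\<le>n. c i \<in> K) \<and> (\<exists>i\<le>n. c i \<noteq> 0) \<and> (\<Sum>i\<le>n. c i * x i) = 0"
    using finite_extension_dependence[OF fin_ext] by blast
  have bound: "r \<le> n" if "P r" for r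
  proof (rule ccontr)
    assume "\<not> r \<le> n"
    then have r: "{..n} \<subseteq> {..<r}" by auto
    obtain w where w: "\<And>c. (\<forall>i<r. c i \<in> W \<inter> K) \<Longrightarrow> (\<Sum>i<r. c i * w i) \<in> M \<Longrightarrow> (\<forall>i<r. c i \<in> M)"
      using \<open>P r\<close> unfolding P_def by blast
    obtain c where c: "\<forall>i\<le>n. c i \<in> K" "\<exists>i\<le>n. c i \<noteq> 0" "(\<Sum>i\<le>n. c i * w i) = 0" using n by blast
    obtain k where k: "k \<le> n" "c k \<noteq> 0" "\<forall>j\<le>n. c j / c k \<in> W"
      using minimal_value[of "{..n}" c] c by auto
    \<comment> \<open>Division by a coefficient of least value brings the relation into
      \<open>W\<close> and makes one coefficient equal to 1.\<close>
    define d where "d i = (if i \<le> n then c i / c k else 0)" for i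
    have "(\<Sum>i<r. d i * w i) = (\<Sum>i\<le>n. d i * w i)"
      by (rule sum.mono_neutral_right) (use r in \<open>auto simp: d_def\<close>)
    also have "\<dots> = (\<Sum>i\<le>n. c i * w i) / c k" by (simp add: d_def sum_divide_distrib)
    also have "\<dots> = 0" using c by simp
    finally have "(\<Sum>i<r. d i * w i) \<in> M" using M_0 by simp
    moreover have "\<forall>i<r. d i \<in> W \<inter> K"
      using k c(1) W_0 subring_0[OF subfield_subring[OF K]] subfield_divide[OF K] by (auto simp: d_def)
    ultimately have "d k \<in> M" using w k r by auto
    then show False using k M_1 by (simp add: d_def)
  qed
  have "P 0" by (simp add: P_def)
  then obtain r where r: "P r" "\<not> P (Suc r)" using bound by (metis not_less_eq_eq nat_induct)
  then obtain w where w: "\<And>i. i < r \<Longrightarrow> w i \<in> W"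
    "\<And>c. (\<forall>i<r. c i \<in> W \<inter> K) \<Longrightarrow> (\<Sum>i<r. c i * w i) \<in> M \<Longrightarrow> (\<forall>i<r. c i \<in> M)"
    unfolding P_def by blast
  define S' where "S' = (\<lambda>s. \<Sum>i<r. s i * w i) ` (PiE {..<r} (\<lambda>_. S))"
  have "finite S'" unfolding S'_def using S(1) by (intro finite_imageI finite_PiE) auto
  moreover have "\<exists>s\<in>S'. y - s \<in> M" if y: "y \<in> W" for y
  proof -
    have "\<forall>i<Suc r. (w(r := y)) i \<in> W" using w(1) y by (auto simp: less_Suc_eq)
    then obtain c where c: "\<forall>i<Suc r. c i \<in> W \<inter> K" "(\<Sum>i<Suc r. c i * (w(r := y)) i) \<in> M"
      "\<exists>i<Suc r. c i \<notin> M" using r(2) unfolding P_def by blast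
    have sum: "(\<Sum>i<r. c i * w i) + c r * y \<in> M" using c(2) by simp
    have cr: "c r \<notin> M"
    proof
      assume "c r \<in> M"
      then have "(\<Sum>i<r. c i * w i) + c r * y - c r * y \<in> M"
        using sum y by (intro M_diff M_mult2)
      then have "\<forall>i<r. c i \<in> M" using w(2) c(1) by simp
      then show False using c(3) \<open>c r \<in> M\<close> by (auto simp: less_Suc_eq)
    qed
    then have u: "c r \<noteq> 0" "inverse (c r) \<in> W" using c(1) unit_iff by auto
    define d where "d i = - c i * inverse (c r)" for i
    have d: "d i \<in> W \<inter> K" if "i < r" for i
      unfolding d_def using c(1) that u W_mult W_minus subfield_inverse[OF K]
        subring_mult[OF subfield_subring[OF K]] subring_minus[OF subfield_subring[OF K]] by auto
    have "inverse (c r) * ((\<Sum>i<r. c i * w i) + c r * y) \<in> M" using u sum M_mult by blast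
    then have yd: "y - (\<Sum>i<r. d i * w i) \<in> M"
      using u(1) by (simp add: d_def distrib_left sum_distrib_left sum_negf ac_simps)
    have "\<forall>i. \<exists>s. i < r \<longrightarrow> s \<in> S \<and> d i - s \<in> M" using S(2) d by blast
    then obtain s where s: "\<And>i. i < r \<Longrightarrow> s i \<in> S \<and> d i - s i \<in> M" by metis
    define s' where "s' = restrict s {..<r}"
    have "(\<Sum>i<r. (d i - s i) * w i) \<in> M" using s w(1) by (intro M_sum M_mult2) auto
    then have "y - (\<Sum>i<r. d i * w i) + (\<Sum>i<r. (d i - s i) * w i) \<in> M" using yd M_add by blast
    then have "y - (\<Sum>i<r. s' i * w i) \<in> M"
      by (simp add: s'_def left_diff_distrib sum_subtractf)
    moreover have "s' \<in> PiE {..<r} (\<lambda>_. S)" using s by (auto simp: s'_def)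
    ultimately show ?thesis unfolding S'_def by blast
  qed
  ultimately show ?thesis by blast
qed

end

section \<open>Polynomials over subrings\<close>

text \<open>\<open>R\<close> is an arbitrary set, so that the definition also covers polynomials
  with coefficients in the maximal ideal.\<close>

definition polys_over :: "'a::comm_ring_1 set \<Rightarrow> 'a poly set" where
  "polys_over R = {p. \<forall>i. coeff p i \<in> R}"

context
  fixes R :: "'a::comm_ring_1 set"
  assumes R: "is_subring R"
begin

lemma polys_over_const: "a \<in> R \<Longrightarrow> [:a:] \<in> polys_over R"
  using subring_0[OF R] by (auto simp: polys_over_def coeff_pCons split: nat.split)

lemma polys_over_monom: "a \<in> R \<Longrightarrow> monom a n \<in> polys_over R"
  using subring_0[OF R] by (auto simp: polys_over_def)

lemma polys_over_add: "p \<in> polys_over R \<Longrightarrow> q \<in> polys_over R \<Longrightarrow> p + q \<in> polys_over R"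
  using subring_add[OF R] by (auto simp: polys_over_def)

lemma polys_over_diff: "p \<in> polys_over R \<Longrightarrow> q \<in> polys_over R \<Longrightarrow> p - q \<in> polys_over R"
  using subring_diff[OF R] by (auto simp: polys_over_def)

lemma polys_over_mult: "p \<in> polys_over R \<Longrightarrow> q \<in> polys_over R \<Longrightarrow> p * q \<in> polys_over R"
  by (auto simp: polys_over_def coeff_mult intro!: subring_sum[OF R] subring_mult[OF R])

lemma polys_over_smult: "a \<in> R \<Longrightarrow> p \<in> polys_over R \<Longrightarrow> smult a p \<in> polys_over R"
  using subring_mult[OF R] by (auto simp: polys_over_def)

lemma polys_over_sum: "(\<And>i. i \<in> I \<Longrightarrow> f i \<in> polys_over R) \<Longrightarrow> (\<Sum>i\<in>I. f i) \<in> polys_over R"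
  by (auto simp: polys_over_def coeff_sum intro!: subring_sum[OF R])

lemma polys_over_0: "0 \<in> polys_over R" and polys_over_1: "1 \<in> polys_over R"
  using polys_over_const[OF subring_0[OF R]] polys_over_const[OF subring_1[OF R]] by (auto simp: one_pCons)

lemma polys_over_prod: "(\<And>i. i \<in> I \<Longrightarrow> f i \<in> polys_over R) \<Longrightarrow> (\<Prod>i\<in>I. f i) \<in> polys_over R"
  by (induction I rule: infinite_finite_induct) (auto intro: polys_over_1 polys_over_mult)

lemma subring_adjoin_element: "is_subring {poly p x | p. p \<in> polys_over R}"
  unfolding is_subring_def
proof (intro conjI ballI)
  show "1 \<in> {poly p x | p. p \<in> polys_over R}" using polys_over_1 by (auto intro!: exI[of _ 1])
next
  fix a b assume "a \<in> {poly p x | p. p \<in> polys_over R}" "b \<in> {poly p x | p. p \<in> polys_over R}"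
  then obtain p q where "a = poly p x" "b = poly q x" "p \<in> polys_over R" "q \<in> polys_over R" by auto
  then show "a - b \<in> {poly p x | p. p \<in> polys_over R}" "a * b \<in> {poly p x | p. p \<in> polys_over R}"
    using polys_over_diff[of p q] polys_over_mult[of p q] by (force, force)
qed

end

lemma coeff_Poly_map:
  "coeff (Poly (map c [0..<n])) i = (if i < n then c i else 0)"
  by (simp add: nth_default_def)

section \<open>Extension of valuation rings\<close>

lemma subring_chain_Union:
  assumes "C \<noteq> {}" "\<And>R. R \<in> C \<Longrightarrow> is_subring R" "\<And>R S. R \<in> C \<Longrightarrow> S \<in> C \<Longrightarrow> R \<subseteq> S \<or> S \<subseteq> R"
  shows "is_subring (\<Union>C)"
  unfolding is_subring_def
proof (intro conjI ballI)
  show "1 \<in> \<Union>C" using assms(1,2) subring_1 by blast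
next
  fix x y assume "x \<in> \<Union>C" "y \<in> \<Union>C"
  then obtain R where "R \<in> C" "x \<in> R" "y \<in> R" using assms(3) by (meson UnionE subsetD)
  then show "x - y \<in> \<Union>C" "x * y \<in> \<Union>C" using assms(2) subring_diff subring_mult by blast+
qed

text \<open>Chevalley's extension theorem: a subring of the big field that is maximal among those meeting
  \<open>L\<close> in \<open>W\<close> is a valuation ring.\<close>

theorem (in valuation_subring) extension_exists:
  "\<exists>R. valuation_subring UNIV R \<and> R \<inter> L = W"
proof -
  define A where "A = {R. is_subring R \<and> R \<inter> L = W}"
  have "W \<in> A" using W WL by (auto simp: A_def)
  have "\<exists>R\<in>A. \<forall>X\<in>A. R \<subseteq> X \<longrightarrow> X = R"
  proof (rule subset_Zorn_nonempty)
    fix C assume C: "C \<noteq> {}" "subset.chain A C"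
    then have CA: "\<And>R. R \<in> C \<Longrightarrow> R \<in> A" "\<And>R S. R \<in> C \<Longrightarrow> S \<in> C \<Longrightarrow> R \<subseteq> S \<or> S \<subseteq> R"
      by (auto simp: subset_chain_def)
    then have "is_subring (\<Union>C)" by (intro subring_chain_Union C) (auto simp: A_def)
    moreover have "\<Union>C \<inter> L = W" using CA(1) C(1) by (fastforce simp: A_def)
    ultimately show "\<Union>C \<in> A" by (simp add: A_def)
  qed (use \<open>W \<in> A\<close> in blast)
  then obtain R where "R \<in> A" and max: "\<And>X. X \<in> A \<Longrightarrow> R \<subseteq> X \<Longrightarrow> X = R" by blast
  then have R: "is_subring R" and RL: "R \<inter> L = W" by (auto simp: A_def)
  note R_closed = subring_0[OF R] subring_1[OF R] subring_add[OF R] subring_diff[OF R]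
    subring_mult[OF R] subring_minus[OF R]
  have M_L: "m \<in> L" "m \<in> R" if "m \<in> M" for m using that M_W WL RL by auto
  have no_inv: "m * r \<noteq> 1" if m: "m \<in> M" and r: "r \<in> R" for m r
  proof
    assume e: "m * r = 1"
    then have "r = inverse m" "m \<noteq> 0" by (metis inverse_unique, auto)
    then have "inverse m \<in> R \<inter> L" using r m M_L subfield_inverse[OF L] by auto
    then show False using m RL \<open>m \<noteq> 0\<close> by (auto simp: nonunits_def)
  qed
  have one_plus: "1 + m * r \<noteq> 0 \<and> inverse (1 + m * r) \<in> R" if m: "m \<in> M" and r: "r \<in> R" for m r
  proof -
    define s where "s = 1 + m * r"
    have s: "s \<in> R" using m r M_L R_closed by (simp add: s_def)
    have s0: "s \<noteq> 0"
    proof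
      assume "s = 0"
      then have "m * (- r) = 1" by (simp add: s_def add_eq_0_iff)
      then show False using no_inv[OF m, of "- r"] r subring_minus[OF R] by simp
    qed
    have pow: "\<exists>b\<in>R. s ^ k = 1 + m * b" for k
    proof (induction k)
      case (Suc k)
      then obtain b where "b \<in> R" "s ^ k = 1 + m * b" by blast
      then have "s ^ Suc k = 1 + m * (r + b + m * r * b)" by (simp add: s_def algebra_simps)
      moreover have "r + b + m * r * b \<in> R" using \<open>b \<in> R\<close> m r M_L R_closed by simp
      ultimately show ?case by blast
    qed (use R_closed in \<open>auto intro: bexI[of _ 0]\<close>)
    \<comment> \<open>Maximality is applied to \<open>R[1/s]\<close>. Every power of
      \<open>s\<close> again has the form \<open>1 + m * b\<close>, which is why this ring still
      meets \<open>L\<close> in \<open>W\<close>.\<close>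
    define R' where "R' = {a / s ^ k | a k. a \<in> R}"
    have "is_subring R'"
      unfolding is_subring_def
    proof (intro conjI ballI)
      have "1 = 1 / s ^ 0" by simp
      then show "1 \<in> R'" unfolding R'_def using R_closed by blast
    next
      fix x y assume "x \<in> R'" "y \<in> R'"
      then obtain a k b l where ab: "x = a / s ^ k" "y = b / s ^ l" "a \<in> R" "b \<in> R"
        unfolding R'_def by blast
      then have "x - y = (a * s ^ l - b * s ^ k) / s ^ (k + l)" "x * y = (a * b) / s ^ (k + l)"
        unfolding ab(1,2) using s0 by (simp_all add: field_simps power_add)
      moreover have "a * s ^ l - b * s ^ k \<in> R" "a * b \<in> R"
        using ab s R_closed subring_power[OF R] by auto
      ultimately show "x - y \<in> R'" "x * y \<in> R'" unfolding R'_def by blast+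
    qed
    moreover have RR': "R \<subseteq> R'"
    proof
      fix a assume "a \<in> R"
      then have "a / s ^ 0 \<in> R'" unfolding R'_def by blast
      then show "a \<in> R'" by simp
    qed
    moreover have "R' \<inter> L = W"
    proof
      show "W \<subseteq> R' \<inter> L" using RR' RL by blast
      show "R' \<inter> L \<subseteq> W"
      proof (rule subsetI, rule ccontr)
        fix y assume y: "y \<in> R' \<inter> L" "y \<notin> W"
        define m' where "m' = inverse y"
        have m': "m' \<in> M" "m' \<noteq> 0"
          using y not_in_imp_inverse_M W_0 by (auto simp: m'_def)
        obtain a k where a: "a \<in> R" "y = a / s ^ k" using y unfolding R'_def by blast
        obtain b where b: "b \<in> R" "s ^ k = 1 + m * b" using pow by blast
        have "y * m' = 1" using m' by (auto simp: m'_def)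
        then have "m' * a = 1 + m * b" using a b(2) s0 by (simp add: field_simps)
        then have e: "1 = m' * a - m * b" by simp
        \<comment> \<open>One of \<open>m\<close>, \<open>m'\<close> divides the other in
          \<open>W\<close>; pulling it out of the equation exhibits an element of \<open>M\<close>
          invertible in \<open>R\<close>, contrary to \<open>no_inv\<close>.\<close>
        have "m / m' \<in> W \<or> m' / m \<in> W \<and> m \<noteq> 0"
          using total[of "m / m'"] m m' M_L L_divide W_0 by (cases "m = 0") auto
        then show False
        proof
          assume "m / m' \<in> W"
          then have "a - m / m' * b \<in> R" using a b RL R_closed by blast
          moreover have "m' * (a - m / m' * b) = m' * a - m * b" using m'(2) by (simp add: right_diff_distrib)
          ultimately show False using no_inv[OF m'(1)] e by metis
        next
          assume h: "m' / m \<in> W \<and> m \<noteq> 0"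
          then have "m' / m * a - b \<in> R" using a b RL R_closed by blast
          moreover have "m * (m' / m * a - b) = m' * a - m * b" using h by (simp add: right_diff_distrib)
          ultimately show False using no_inv[OF m] e by metis
        qed
      qed
    qed
    ultimately have "R' = R" using max by (simp add: A_def)
    moreover have "1 / s ^ 1 \<in> R'" unfolding R'_def using R_closed by blast
    ultimately show ?thesis using s0 by (simp add: s_def inverse_eq_divide)
  qed
  have relation: "\<exists>m\<in>M. \<exists>p\<in>polys_over R. m * poly p x = 1" if x: "x \<notin> R" for x
  proof -
    \<comment> \<open>By maximality \<open>R[x]\<close> contains some \<open>y\<close> in
      \<open>L\<close> outside \<open>W\<close>; the desired relation is
      \<open>inverse y * y = 1\<close>.\<close>
    define X where "X = {poly p x | p. p \<in> polys_over R}"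
    have X: "is_subring X" unfolding X_def by (rule subring_adjoin_element[OF R])
    have RX: "R \<subseteq> X" unfolding X_def using polys_over_const[OF R] by force
    have "x \<in> X" unfolding X_def using polys_over_monom[OF R, of 1 1] R_closed
      by (auto simp: poly_monom intro!: exI[of _ "monom 1 1"])
    then have "X \<notin> A" using max RX x by blast
    then obtain y where y: "y \<in> X" "y \<in> L" "y \<notin> W" using X RX RL by (auto simp: A_def)
    then have "y \<noteq> 0" using W_0 by blast
    then have "inverse y \<in> M" "inverse y * y = 1" using y not_in_imp_inverse_M by auto
    then show ?thesis using y(1) unfolding X_def by blast
  qed
  have no_relation: False
    if "x \<noteq> 0" "p \<in> polys_over R" "q \<in> polys_over R" "m1 \<in> M" "m2 \<in> M"
      "m1 * poly p x = 1" "m2 * poly q (inverse x) = 1" for x p q m1 m2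
    using that
  proof (induction "degree p + degree q" arbitrary: x p q m1 m2 rule: less_induct)
    case less
    \<comment> \<open>By symmetry \<open>q\<close> may be taken to have the smaller degree:
      otherwise \<open>x\<close> and \<open>inverse x\<close> trade places together with their
      relations.\<close>
    have main: False
      if x: "x \<noteq> 0" and pq: "p \<in> polys_over R" "q \<in> polys_over R" and m: "m1 \<in> M" "m2 \<in> M"
        and ep: "m1 * poly p x = 1" and eq: "m2 * poly q (inverse x) = 1" and deg: "degree q \<le> degree p"
        and IH: "\<And>p'. degree p' < degree p \<Longrightarrow> p' \<in> polys_over R \<Longrightarrow> m1 * poly p' x = 1 \<Longrightarrow> False"
      for x p q m1 m2
    proof -
      obtain q0 q' where q: "q = pCons q0 q'" by (cases q)
      have qi: "coeff q i \<in> R" for i using pq(2) by (simp add: polys_over_def)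
      have q0: "q0 \<in> R" using qi[of 0] by (simp add: q)
      have q': "coeff q' i \<in> R" for i using qi[of "Suc i"] by (simp add: q)
      \<comment> \<open>The constant term of \<open>q\<close> is absorbed into \<open>s\<close>, a
        unit of \<open>R\<close>. Multiplied by \<open>x ^ n\<close>, the relation expresses
        \<open>x ^ n\<close> by lower powers of \<open>x\<close>, so the leading term of
        \<open>p\<close> can be replaced without changing the value at \<open>x\<close>.\<close>
      define s where "s = 1 + m2 * (- q0)"
      have s: "s \<noteq> 0" "inverse s \<in> R" using one_plus[of m2 "- q0"] m q0 R_closed by (auto simp: s_def)
      have e: "s = m2 * (inverse x * poly q' (inverse x))" using eq by (simp add: q s_def algebra_simps)
      then have "q' \<noteq> 0" using s by auto
      then have n: "degree q' < degree p" using deg by (simp add: q)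
      define n where "n = degree p"
      define a where "a = lead_coeff p"
      have n0: "n > 0" using n n_def by auto
      define r where "r = (\<Sum>j\<le>degree q'. monom (coeff q' j) (n - 1 - j))"
      have r: "r \<in> polys_over R" unfolding r_def by (intro polys_over_sum polys_over_monom R q')
      have degr: "degree r \<le> n - 1" unfolding r_def
        by (intro degree_sum_le) (auto intro: order_trans[OF degree_monom_le])
      have rx: "poly r x = x ^ (n - 1) * poly q' (inverse x)"
      proof -
        have pw: "x ^ (n - 1 - j) = x ^ (n - 1) * inverse x ^ j" if "j \<le> degree q'" for j
        proof -
          have "j \<le> n - 1" using that n n_def by simp
          then have "x ^ (n - 1 - j) = x ^ (n - 1) / x ^ j" by (rule power_diff[OF x])
          then show ?thesis by (simp only: divide_inverse power_inverse)
        qed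
        have "poly r x = (\<Sum>j\<le>degree q'. coeff q' j * (x ^ (n - 1) * inverse x ^ j))"
          unfolding r_def poly_sum poly_monom by (rule sum.cong[OF refl]) (simp only: pw atMost_iff)
        also have "\<dots> = x ^ (n - 1) * poly q' (inverse x)"
          unfolding poly_altdef sum_distrib_left by (simp only: mult.left_commute)
        finally show ?thesis .
      qed
      have "x ^ n = inverse s * s * (x * x ^ (n - 1))" using s n0 by (simp add: power_eq_if)
      also have "\<dots> = inverse s * m2 * (x ^ (n - 1) * poly q' (inverse x))" using e x by simp
      finally have xn: "x ^ n = inverse s * m2 * poly r x" by (simp add: rx)
      define p' where "p' = p - monom a n + smult (a * inverse s * m2) r"
      have "degree (p - monom a n) < n"
      proof (rule degree_lessI)
        show "p - monom a n \<noteq> 0 \<or> n > 0" using n0 by simp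
        show "\<forall>k\<ge>n. coeff (p - monom a n) k = 0"
          using coeff_eq_0[of p] by (auto simp: a_def n_def le_less)
      qed
      moreover have "degree (smult (a * inverse s * m2) r) < n"
        using degr n0 degree_smult_le[of "a * inverse s * m2" r] by linarith
      ultimately have dp: "degree p' < n" unfolding p'_def by (rule degree_add_less)
      have a: "a \<in> R" using pq by (simp add: a_def polys_over_def)
      have "p' \<in> polys_over R" unfolding p'_def
        using pq(1) a r s m M_L R_closed
        by (intro polys_over_add polys_over_diff polys_over_monom polys_over_smult R) auto
      moreover have "poly p' x = poly p x" using xn by (simp add: p'_def poly_monom)
      ultimately show False using IH dp ep n_def by metis
    qed
    show False
    proof (cases "degree q \<le> degree p")
      case True
      show ?thesis
      proof (rule main[OF less.prems True])
        fix p' assume "degree p' < degree p" "p' \<in> polys_over R" "m1 * poly p' x = 1"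
        then show False using less.hyps[of p' q x m1 m2] less.prems by simp
      qed
    next
      case False
      show ?thesis
      proof (rule main[of "inverse x" q p m2 m1])
        fix p' assume "degree p' < degree q" "p' \<in> polys_over R" "m2 * poly p' (inverse x) = 1"
        then show False using less.hyps[of p p' x m1 m2] less.prems by simp
      qed (use less.prems False in auto)
    qed
  qed
  have "x \<in> R \<or> inverse x \<in> R" if x: "x \<noteq> 0" for x
    using relation[of x] relation[of "inverse x"] no_relation[OF x] by blast
  then have "valuation_subring UNIV R"
    using R by unfold_locales (auto simp: subfield_UNIV)
  then show ?thesis using RL by blast
qed

section \<open>Irreducible polynomials from a valuation ring\<close>

lemma finite_polys_over:
  assumes "finite S"
  shows "finite {p. degree p < n \<and> (\<forall>i. coeff p i \<in> S)}"
proof (rule finite_subset)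
  show "{p. degree p < n \<and> (\<forall>i. coeff p i \<in> S)} \<subseteq> Poly ` {xs. set xs \<subseteq> S \<and> length xs = n}"
  proof
    fix p assume p: "p \<in> {p. degree p < n \<and> (\<forall>i. coeff p i \<in> S)}"
    have "p = Poly (map (coeff p) [0..<n])"
      by (rule poly_eqI) (use p in \<open>auto simp: coeff_Poly_map coeff_eq_0 simp del: coeff_Poly_eq\<close>)
    then show "p \<in> Poly ` {xs. set xs \<subseteq> S \<and> length xs = n}"
      using p by (intro image_eqI) auto
  qed
  show "finite (Poly ` {xs. set xs \<subseteq> S \<and> length xs = n})"
    using assms by (intro finite_imageI finite_lists_length_eq)
qed

lemma irreducible_polyI:
  fixes f :: "'a::field poly"
  assumes "0 < degree f" "\<And>g h. f = g * h \<Longrightarrow> 0 < degree g \<Longrightarrow> 0 < degree h \<Longrightarrow> False"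
  shows "irreducible f"
proof (rule irreducibleI)
  show "f \<noteq> 0" using assms(1) by auto
  then show "\<not> f dvd 1" using assms(1) by (simp add: is_unit_iff_degree)
  fix g h assume f: "f = g * h"
  then have "g \<noteq> 0" "h \<noteq> 0" using assms(1) by auto
  then show "g dvd 1 \<or> h dvd 1" using assms(2)[OF f] is_unit_iff_degree by blast
qed

locale valuation_ring_UNIV = valuation_subring UNIV W for W :: "'a::field set"
begin

abbreviation "WX \<equiv> polys_over W"
abbreviation "MX \<equiv> polys_over M"

lemma WX_coeff: "f \<in> WX \<Longrightarrow> coeff f i \<in> W"
  by (simp add: polys_over_def)

lemma MX_coeff: "f \<in> MX \<Longrightarrow> coeff f i \<in> M"
  by (simp add: polys_over_def)

lemma MX_add: "f \<in> MX \<Longrightarrow> g \<in> MX \<Longrightarrow> f + g \<in> MX"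
  by (simp add: polys_over_def M_add)

lemma MX_mult: "f \<in> MX \<Longrightarrow> g \<in> WX \<Longrightarrow> f * g \<in> MX"
  by (auto simp: polys_over_def coeff_mult intro!: M_sum M_mult2)

lemma unit_plus_M: "x \<in> W - M \<Longrightarrow> y \<in> M \<Longrightarrow> x + y \<in> W - M"
  using M_diff[of "x + y" y] W_add M_W by auto

text \<open>One summand of the convolution is a unit and all others lie in \<open>M\<close>. It is
  used with lowest as well as with highest coefficients outside \<open>M\<close>.\<close>

lemma coeff_mult_not_M:
  assumes g: "g \<in> WX" and h: "h \<in> WX" and i: "coeff g i \<notin> M" and j: "coeff h j \<notin> M"
    and others: "\<And>a b. a + b = i + j \<Longrightarrow> a \<noteq> i \<Longrightarrow> coeff g a \<in> M \<or> coeff h b \<in> M"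
  shows "coeff (g * h) (i + j) \<in> W - M"
proof -
  have "coeff (g * h) (i + j) = coeff g i * coeff h j + (\<Sum>a\<in>{..i + j} - {i}. coeff g a * coeff h (i + j - a))"
    using sum.remove[of "{..i + j}" i "\<lambda>a. coeff g a * coeff h (i + j - a)"] by (simp add: coeff_mult)
  also have "\<dots> \<in> W - M"
  proof (rule unit_plus_M)
    show "coeff g i * coeff h j \<in> W - M" using assms WX_coeff by (intro unit_mult) auto
    show "(\<Sum>a\<in>{..i + j} - {i}. coeff g a * coeff h (i + j - a)) \<in> M"
    proof (rule M_sum)
      fix a assume a: "a \<in> {..i + j} - {i}"
      then have "coeff g a \<in> M \<or> coeff h (i + j - a) \<in> M" using others[of a "i + j - a"] by auto
      then show "coeff g a * coeff h (i + j - a) \<in> M"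
        using M_mult M_mult2 WX_coeff g h by blast
    qed
  qed
  finally show ?thesis .
qed

text \<open>Gauss's lemma: the lowest coefficients outside \<open>M\<close> of the two factors meet
  in a single summand.\<close>

lemma product_of_primitive:
  assumes g: "g \<in> WX" "\<exists>i. coeff g i \<notin> M" and h: "h \<in> WX" "\<exists>i. coeff h i \<notin> M"
  shows "\<exists>i. coeff (g * h) i \<in> W - M"
proof -
  define i where "i = (LEAST i. coeff g i \<notin> M)"
  define j where "j = (LEAST i. coeff h i \<notin> M)"
  have "coeff g i \<notin> M" "coeff h j \<notin> M" unfolding i_def j_def using LeastI_ex g h by metis+
  moreover have "coeff g a \<in> M" if "a < i" for a using that not_less_Least unfolding i_def by blast
  moreover have "coeff h a \<in> M" if "a < j" for a using that not_less_Least unfolding j_def by blast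
  moreover have "a < i \<or> b < j" if "a + b = i + j" "a \<noteq> i" for a b using that by linarith
  ultimately have "coeff (g * h) (i + j) \<in> W - M" by (intro coeff_mult_not_M g h) blast+
  then show ?thesis by blast
qed

lemma scale_to_primitive:
  assumes "f \<noteq> 0"
  obtains c where "c \<noteq> 0" "smult c f \<in> WX" "\<exists>i. coeff (smult c f) i \<notin> M"
proof -
  have "\<exists>i\<in>{..degree f}. coeff f i \<noteq> 0" using assms by (metis atMost_iff leading_coeff_0_iff order_refl)
  then obtain i where i: "coeff f i \<noteq> 0" "\<And>j. j \<le> degree f \<Longrightarrow> coeff f j / coeff f i \<in> W"
    using minimal_value[of "{..degree f}" "coeff f"] by auto
  have "coeff f j / coeff f i \<in> W" for j
    using i(2)[of j] W_0 by (cases "j \<le> degree f") (auto simp: coeff_eq_0)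
  then have "smult (inverse (coeff f i)) f \<in> WX" by (simp add: polys_over_def field_simps)
  moreover have "coeff (smult (inverse (coeff f i)) f) i \<notin> M" using i(1) M_1 by simp
  ultimately show thesis using that[of "inverse (coeff f i)"] i(1) by (metis nonzero_imp_inverse_nonzero)
qed

text \<open>After both factors are made primitive, the correcting constant \<open>e\<close> is a
  coefficient of \<open>f\<close> divided by a unit coefficient of the primitive product, so it lies
  in \<open>W\<close>.\<close>

lemma Gauss_factorization:
  assumes f: "f \<in> WX" "lead_coeff f \<notin> M" and gh: "f = g * h"
  obtains g' h' where "g' \<in> WX" "h' \<in> WX" "f = g' * h'" "degree g' = degree g" "degree h' = degree h"
    "lead_coeff g' \<notin> M" "lead_coeff h' \<notin> M"
proof -
  have nz: "g \<noteq> 0" "h \<noteq> 0" using f(2) M_0 gh by auto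
  obtain c where c: "c \<noteq> 0" "smult c g \<in> WX" "\<exists>i. coeff (smult c g) i \<notin> M"
    using scale_to_primitive[OF nz(1)] by blast
  obtain d where d: "d \<noteq> 0" "smult d h \<in> WX" "\<exists>i. coeff (smult d h) i \<notin> M"
    using scale_to_primitive[OF nz(2)] by blast
  define e where "e = inverse (c * d)"
  define g' where "g' = smult e (smult c g)"
  define h' where "h' = smult d h"
  have "d * (e * c) = 1" using c(1) d(1) by (simp add: e_def field_simps)
  then have f': "f = g' * h'" by (simp add: gh g'_def h'_def)
  obtain l where l: "coeff (smult c g * h') l \<in> W - M"
    using product_of_primitive[OF c(2,3) d(2,3)] by (auto simp: h'_def)
  have "e * coeff (smult c g * h') l = coeff f l" by (simp add: f' g'_def)
  then have "e = coeff f l * inverse (coeff (smult c g * h') l)"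
    using unit_nz[OF l] by (simp add: field_simps)
  then have e: "e \<in> W" using W_mult WX_coeff[OF f(1)] unit_inverse[OF l] by auto
  have g': "g' \<in> WX" unfolding g'_def using polys_over_smult[OF W e c(2)] .
  have h': "h' \<in> WX" using d by (simp add: h'_def)
  have lc: "lead_coeff f = lead_coeff g' * lead_coeff h'" by (simp add: f' lead_coeff_mult)
  have "e \<noteq> 0" using c d by (simp add: e_def)
  then have "degree g' = degree g" "degree h' = degree h" using c d by (simp_all add: g'_def h'_def)
  moreover have "lead_coeff g' \<notin> M" "lead_coeff h' \<notin> M"
    using lc f(2) M_mult M_mult2 WX_coeff[OF g'] WX_coeff[OF h'] by metis+
  ultimately show thesis using that g' h' f' by blast
qed

text \<open>In a proper factorization over \<open>W\<close> both constant terms lie in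
  \<open>M\<close>, so their product is divisible by \<open>t^2\<close>.\<close>

lemma Eisenstein:
  assumes t: "t \<in> M" "t \<noteq> 0" "\<And>x. x \<in> M \<Longrightarrow> x / t \<in> W"
    and f: "f \<in> WX" "0 < degree f" "lead_coeff f \<notin> M" "\<And>i. i < degree f \<Longrightarrow> coeff f i \<in> M"
      "coeff f 0 / t^2 \<notin> W"
  shows "irreducible f"
proof (rule irreducible_polyI[OF f(2)])
  fix g h assume "f = g * h" and deg: "0 < degree g" "0 < degree h"
  then obtain g' h' where *: "g' \<in> WX" "h' \<in> WX" "f = g' * h'" "degree g' = degree g"
    "degree h' = degree h" "lead_coeff g' \<notin> M" "lead_coeff h' \<notin> M"
    using Gauss_factorization[OF f(1,3)] by metis
  \<comment> \<open>If the constant term of \<open>q\<close> were a unit, the lowest coefficient of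
    \<open>p\<close> outside \<open>M\<close> would survive in \<open>f\<close> at an index below
    the degree of \<open>f\<close>.\<close>
  have const: "coeff q 0 \<in> M"
    if "p \<in> WX" "q \<in> WX" "f = p * q" "lead_coeff p \<notin> M" "0 < degree q" for p q
  proof (rule ccontr)
    assume q0: "coeff q 0 \<notin> M"
    define i where "i = (LEAST i. coeff p i \<notin> M)"
    have i: "coeff p i \<notin> M" "i \<le> degree p"
      unfolding i_def using that(4) LeastI[of "\<lambda>i. coeff p i \<notin> M"] Least_le[of "\<lambda>i. coeff p i \<notin> M"] by blast+
    have "coeff p a \<in> M" if "a < i" for a using that not_less_Least unfolding i_def by blast
    then have "coeff (p * q) (i + 0) \<in> W - M"
      using that i q0 by (intro coeff_mult_not_M) auto
    moreover have "p \<noteq> 0" "q \<noteq> 0" using that(3) f(2) by auto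
    then have "i < degree f" using i(2) that(3,5) by (simp add: degree_mult_eq)
    ultimately show False using f(4) that(3) by simp
  qed
  have "coeff g' 0 \<in> M" "coeff h' 0 \<in> M"
    using const[of h' g'] const[of g' h'] * deg by (auto simp: mult.commute)
  then have "coeff g' 0 / t * (coeff h' 0 / t) \<in> W" using t(3) W_mult by blast
  then show False using f(5) *(3) by (simp add: mult_poly_0_left coeff_mult power2_eq_square)
qed

text \<open>A factorization of \<open>F\<close> can be taken over \<open>W\<close>; since the
  leading coefficient of \<open>F\<close> is 1 modulo \<open>M\<close>, normalizing the factors to
  monic ones changes their product only modulo \<open>M\<close>.\<close>

lemma irreducible_mod_M:
  assumes f: "f \<in> WX" "0 < degree f"
    and irr: "\<And>g h. g \<in> WX \<Longrightarrow> h \<in> WX \<Longrightarrow> 0 < degree g \<Longrightarrow> 0 < degree h \<Longrightarrow> lead_coeff g = 1 \<Longrightarrow>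
                lead_coeff h = 1 \<Longrightarrow> f - g * h \<in> MX \<Longrightarrow> False"
    and F: "F - f \<in> MX" "degree F = degree f" "lead_coeff F - 1 \<in> M"
  shows "irreducible F"
proof (rule irreducible_polyI)
  show "0 < degree F" using f F by simp
  fix g h assume gh: "F = g * h" and deg: "0 < degree g" "0 < degree h"
  have "MX \<subseteq> WX" using M_W by (auto simp: polys_over_def)
  then have FW: "F \<in> WX" using polys_over_add[OF W f(1), of "F - f"] F(1) by auto
  have "lead_coeff F \<notin> M" using M_diff[of "lead_coeff F" "lead_coeff F - 1"] F(3) M_1 by auto
  then obtain g' h' where *: "g' \<in> WX" "h' \<in> WX" "F = g' * h'" "degree g' = degree g"
    "degree h' = degree h" "lead_coeff g' \<notin> M" "lead_coeff h' \<notin> M"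
    using Gauss_factorization[OF FW _ gh] by metis
  define a where "a = lead_coeff g'"
  define b where "b = lead_coeff h'"
  have ab: "a \<in> W - M" "b \<in> W - M" using * WX_coeff by (auto simp: a_def b_def)
  then have ab0: "a \<noteq> 0" "b \<noteq> 0" "inverse a \<in> W" "inverse b \<in> W"
    using unit_nz unit_inverse by blast+
  have lcF: "lead_coeff F = a * b" using *(3) by (simp add: lead_coeff_mult a_def b_def)
  define g1 where "g1 = smult (inverse a) g'"
  define h1 where "h1 = smult (inverse b) h'"
  have g1: "g1 \<in> WX" "0 < degree g1" "lead_coeff g1 = 1"
    using * deg ab0 polys_over_smult[OF W] by (auto simp: g1_def a_def)
  have h1: "h1 \<in> WX" "0 < degree h1" "lead_coeff h1 = 1"
    using * deg ab0 polys_over_smult[OF W] by (auto simp: h1_def b_def)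
  have "a * b * (inverse b * inverse a) = 1" using ab0(1,2) by (simp add: field_simps)
  then have F_eq: "F = smult (a * b) (g1 * h1)" using *(3) by (simp add: g1_def h1_def)
  have "f - g1 * h1 = smult (-1) (F - f) + smult (a * b - 1) (g1 * h1)"
    by (simp add: F_eq smult_diff_left)
  also have "\<dots> \<in> MX"
  proof (rule MX_add)
    show "smult (-1) (F - f) \<in> MX" using M_minus[OF MX_coeff[OF F(1)]] by (simp add: polys_over_def)
    show "smult (a * b - 1) (g1 * h1) \<in> MX"
      using M_mult2[OF F(3)] WX_coeff[OF polys_over_mult[OF W g1(1) h1(1)]]
      by (simp add: polys_over_def lcF)
  qed
  finally show False using irr g1 h1 by blast
qed

text \<open>The highest coefficient of \<open>u\<close> outside \<open>M\<close> meets the leading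
  coefficient 1 of \<open>g\<close>, which leaves a unit coefficient of positive index in
  \<open>g * u\<close>.\<close>

lemma monic_not_unit_mod_M:
  assumes g: "g \<in> WX" "0 < degree g" "lead_coeff g = 1" and u: "u \<in> WX"
  shows "1 - g * u \<notin> MX"
proof
  assume H: "1 - g * u \<in> MX"
  show False
  proof (cases "\<exists>j. coeff u j \<notin> M")
    case False
    then have "u \<in> MX" by (simp add: polys_over_def)
    then have "u * g \<in> MX" using MX_mult g by blast
    then have "1 - g * u + u * g \<in> MX" using H MX_add by blast
    then have "1 \<in> MX" by (simp add: mult.commute)
    then show False using MX_coeff[of 1 0] M_1 by simp
  next
    case True
    define j where "j = (GREATEST j. coeff u j \<notin> M)"
    have bound: "\<And>j. coeff u j \<notin> M \<Longrightarrow> j \<le> degree u" using M_0 by (metis coeff_eq_0 not_le_imp_less)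
    have j: "coeff u j \<notin> M" unfolding j_def using True bound by (metis (mono_tags, lifting) GreatestI_ex_nat)
    have jj: "coeff u i \<in> M" if "i > j" for i
      using that bound Greatest_le_nat[of "\<lambda>j. coeff u j \<notin> M" i "degree u"] unfolding j_def by fastforce
    have "coeff (g * u) (degree g + j) \<in> W - M"
    proof (rule coeff_mult_not_M[OF g(1) u])
      show "coeff g (degree g) \<notin> M" using g M_1 by simp
      fix a b assume "a + b = degree g + j" "a \<noteq> degree g"
      then show "coeff g a \<in> M \<or> coeff u b \<in> M"
        using jj[of b] M_0 by (cases "a < degree g") (auto simp: coeff_eq_0)
    qed (use j in auto)
    moreover have "coeff 1 (degree g + j) = (0::'a)" using g(2) by simp
    ultimately have "coeff (1 - g * u) (degree g + j) \<notin> M"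
      using M_minus[of "- coeff (g * u) (degree g + j)"] by auto
    then show False using H MX_coeff by blast
  qed
qed

lemma degree_eq_mod_M:
  assumes "lead_coeff f = 1" "lead_coeff g = 1" "f - g \<in> MX"
  shows "degree f = degree g"
proof (rule ccontr)
  assume "degree f \<noteq> degree g"
  then consider "degree f < degree g" | "degree g < degree f" by linarith
  then show False
  proof cases
    case 1
    then have "coeff (f - g) (degree g) = - 1" using assms by (simp add: coeff_eq_0)
    then show False using MX_coeff[OF assms(3)] M_minus[of "-1"] M_1 by (metis minus_minus)
  next
    case 2
    then have "coeff (f - g) (degree f) = 1" using assms by (simp add: coeff_eq_0)
    then show False using MX_coeff[OF assms(3)] M_1 by metis
  qed
qed

text \<open>Euclid's argument for the infinitude of primes, over the residue field: a monic polynomial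
  \<open>f\<close> of minimal positive degree among the divisors modulo \<open>M\<close> of \<open>1 + X \<Prod>g\<close>, where \<open>g\<close> ranges over
  representatives of the monic polynomials of degree at most \<open>D\<close>, is none of these \<open>g\<close>.\<close>

lemma irreducible_mod_M_exists:
  assumes S: "finite S" "\<And>x. x \<in> W \<Longrightarrow> \<exists>s\<in>S. x - s \<in> M"
  obtains f where "f \<in> WX" "D < degree f" "lead_coeff f = 1"
    "\<And>g h. g \<in> WX \<Longrightarrow> h \<in> WX \<Longrightarrow> 0 < degree g \<Longrightarrow> 0 < degree h \<Longrightarrow> lead_coeff g = 1 \<Longrightarrow>
       lead_coeff h = 1 \<Longrightarrow> f - g * h \<in> MX \<Longrightarrow> False"
proof -
  \<comment> \<open>0 and 1 are needed for the vanishing coefficients and the leading one; the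
    intersection is taken because \<open>S\<close> need not lie in \<open>W\<close>.\<close>
  define S' where "S' = insert 0 (insert 1 (S \<inter> W))"
  define \<G> where "\<G> = {g. degree g < Suc D \<and> (\<forall>i. coeff g i \<in> S')} \<inter> {g. 0 < degree g \<and> lead_coeff g = 1}"
  have S'W: "S' \<subseteq> W" using W_0 W_1 by (auto simp: S'_def)
  have fin\<G>: "finite \<G>" unfolding \<G>_def
    by (rule finite_Int, rule disjI1, rule finite_polys_over) (use S(1) in \<open>simp add: S'_def\<close>)
  have \<G>W: "g \<in> WX" if "g \<in> \<G>" for g using that S'W by (auto simp: \<G>_def polys_over_def)
  \<comment> \<open>The factor \<open>X\<close> gives \<open>R\<close> positive degree even if no
    \<open>g\<close> is available.\<close>
  define R where "R = [:0, 1:] * (\<Prod>g\<in>\<G>. g)"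
  define Q where "Q = 1 + R"
  have X: "[:0, 1:] \<in> WX" using polys_over_monom[OF W W_1, of 1] by (simp add: monom_altdef)
  have RW: "R \<in> WX" unfolding R_def by (intro polys_over_mult polys_over_prod W X \<G>W)
  have lcR: "lead_coeff R = 1"
    unfolding R_def lead_coeff_mult lead_coeff_prod by (simp add: \<G>_def)
  have nz: "(\<Prod>g\<in>\<G>. g) \<noteq> 0" using fin\<G> by (auto simp: \<G>_def)
  have degR: "0 < degree R" unfolding R_def using nz by (subst degree_mult_eq) auto
  have Q: "Q \<in> WX" "lead_coeff Q = 1" "0 < degree Q"
    using RW lcR degR polys_over_add[OF W polys_over_1[OF W]] lead_coeff_add_le[of 1 R] degree_add_eq_right[of 1 R]
    by (auto simp: Q_def)
  define P where "P f \<longleftrightarrow> f \<in> WX \<and> lead_coeff f = 1 \<and> 0 < degree f \<and> (\<exists>h\<in>WX. Q - f * h \<in> MX)" for f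
  have "Q - Q * 1 \<in> MX" using M_0 by (simp add: polys_over_def)
  then have "P Q" unfolding P_def using Q polys_over_1[OF W] by blast
  then obtain f where f: "P f" and min: "\<And>g. P g \<Longrightarrow> degree f \<le> degree g"
    using ex_has_least_nat[of P Q degree] by blast
  obtain h where h: "h \<in> WX" "Q - f * h \<in> MX" using f unfolding P_def by blast
  have fW: "f \<in> WX" "lead_coeff f = 1" "0 < degree f" using f by (auto simp: P_def)
  have "D < degree f"
  proof (rule ccontr)
    assume D: "\<not> D < degree f"
    define d where "d = degree f"
    have "\<forall>i. \<exists>s. s \<in> S' \<and> coeff f i - s \<in> M"
    proof
      fix i
      obtain s where s: "s \<in> S" "coeff f i - s \<in> M" using S(2) WX_coeff[OF fW(1)] by blast
      have "coeff f i - (coeff f i - s) \<in> W" by (intro W_diff WX_coeff fW M_W s)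
      then show "\<exists>s. s \<in> S' \<and> coeff f i - s \<in> M" using s by (auto simp: S'_def)
    qed
    then obtain s where s: "\<And>i. s i \<in> S' \<and> coeff f i - s i \<in> M" by metis
    define g where "g = Poly (map (\<lambda>i. if i < d then s i else 1) [0..<Suc d])"
    have cg: "coeff g i = (if i < d then s i else if i = d then 1 else 0)" for i
      unfolding g_def coeff_Poly_map by auto
    have "degree g = d"
      by (rule antisym) (auto intro!: degree_le le_degree simp: cg)
    then have g: "g \<in> \<G>" using D fW s by (auto simp: \<G>_def cg d_def S'_def)
    have fg: "f - g \<in> MX" using s M_0 fW(2) by (auto simp: polys_over_def cg d_def coeff_eq_0)
    have "Q - f * h + (f - g) * h \<in> MX" using h fg by (intro MX_add MX_mult)
    then have Qg: "Q - g * h \<in> MX" by (simp add: algebra_simps)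
    define k where "k = [:0, 1:] * (\<Prod>g\<in>\<G> - {g}. g)"
    have kW: "k \<in> WX" unfolding k_def by (intro polys_over_mult polys_over_prod W X \<G>W) auto
    have "R = g * k" unfolding R_def k_def using prod.remove[OF fin\<G> g, of "\<lambda>g. g"] by (simp add: mult.left_commute)
    \<comment> \<open>Modulo \<open>M\<close> the polynomial \<open>g\<close> divides both
      \<open>Q\<close> and \<open>R\<close>, hence 1.\<close>
    then have "1 - g * (h - k) \<in> MX" using Qg by (simp add: Q_def algebra_simps)
    then show False
      using monic_not_unit_mod_M[of g "h - k"] \<G>W[OF g] g polys_over_diff[OF W h(1) kW] by (auto simp: \<G>_def)
  qed
  moreover have False
    if gh: "g \<in> WX" "h' \<in> WX" "0 < degree g" "0 < degree h'" "lead_coeff g = 1" "lead_coeff h' = 1"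
      "f - g * h' \<in> MX" for g h'
  proof -
    have "degree f = degree (g * h')" using fW gh by (intro degree_eq_mod_M) (auto simp: lead_coeff_mult)
    also have "\<dots> = degree g + degree h'" using gh by (intro degree_mult_eq) auto
    finally have "degree g < degree f" using gh by simp
    moreover have "Q - f * h + (f - g * h') * h \<in> MX" using h gh by (intro MX_add MX_mult)
    then have "Q - g * (h' * h) \<in> MX" by (simp add: algebra_simps)
    then have "P g" unfolding P_def using gh h polys_over_mult[OF W gh(2) h(1)] by blast
    ultimately show False using min by force
  qed
  ultimately show thesis using that fW by blast
qed

end

text \<open>The ring of a discrete valuation is a maximal proper subring of the field, so
  non-inclusion already means that both rings together generate the field.\<close>

locale independent_valuations = discrete_valuation v + valuation_ring_UNIV W
  for v :: "'a::field \<Rightarrow> int" and W :: "'a set" +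
  assumes not_subset: "\<not> W \<subseteq> val_ring"
begin

text \<open>If \<open>y\<close> is a non-unit of \<open>W\<close> with large negative \<open>v\<close>-value, then \<open>y / (1 + y)\<close> is divisible by
  \<open>y\<close> in \<open>W\<close>, and \<open>v\<close>-adically close to one.\<close>

lemma weak_approximation:
  assumes t: "t \<in> M" "t \<noteq> 0" and s: "s \<noteq> 0"
  obtains c' where "vge e (c' - c)" "(c' - \<tau>) / s \<in> W"
proof (cases "c = \<tau>")
  case True
  then show thesis using that[of c] W_0 by simp
next
  case False
  define d where "d = c - \<tau>"
  have d: "d \<noteq> 0" using False by (simp add: d_def)
  \<comment> \<open>Division by \<open>s\<close> magnifies the gap \<open>d\<close> between the two
    targets; \<open>s'\<close> is an element of \<open>M\<close> that makes up for it.\<close>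
  have "\<exists>s'\<in>M. s' \<noteq> 0 \<and> s' * d / s \<in> W"
  proof (cases "s / d \<in> M")
    case True
    then show ?thesis using s d W_1 by (intro bexI[of _ "s / d"]) auto
  next
    case False
    have "d / s \<in> W"
      using not_in_imp_inverse_M[of "d / s"] False by auto
    then have "t * (d / s) \<in> W" using t M_W W_mult by blast
    then show ?thesis using t by auto
  qed
  then obtain s' where s': "s' \<in> M" "s' \<noteq> 0" "s' * d / s \<in> W" by blast
  obtain y where "y \<in> W" "\<not> vge 0 y" using not_subset by (auto simp: val_ring_def)
  then have y: "y \<in> W" "y \<noteq> 0" "v y < 0" by (auto simp: vge_def)
  \<comment> \<open>Large enough that \<open>y ^ n\<close> outweighs \<open>s'\<close> and that
    \<open>d / (1 + z)\<close> has valuation at least \<open>e\<close>.\<close>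
  define n where "n = nat (\<bar>v s'\<bar> + \<bar>e\<bar> + \<bar>v d\<bar> + 1)"
  define z where "z = s' * y ^ n"
  have "int n \<le> - (int n * v y)" using mult_left_mono[of "v y" "-1" "int n"] y(3) by simp
  moreover have "v z = v s' + int n * v y" using s' y by (simp add: z_def v_mult v_power)
  ultimately have vz: "v z < 0" "v z \<le> v d - e" unfolding n_def by linarith+
  have zM: "z \<in> M" unfolding z_def using s' y M_mult2 W_power by blast
  have z0: "z \<noteq> 0" using s' y by (simp add: z_def)
  have u: "1 + z \<in> W - M" using zM by (rule one_plus_M)
  have "vge (v z + 1) ((1 + z) - z)" using vz by (simp add: vge_def)
  then have v1z: "v (1 + z) = v z" "1 + z \<noteq> 0" using v_perturb[OF z0] by blast+
  \<comment> \<open>\<open>z / (1 + z)\<close> is \<open>v\<close>-adically near 1, which gives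
    \<open>c\<close>, and divisible by \<open>s'\<close> in \<open>W\<close>, which gives
    \<open>\<tau>\<close>.\<close>
  define c' where "c' = \<tau> + d * (z / (1 + z))"
  have "c' - c = - (d / (1 + z))" using v1z(2) by (simp add: c'_def d_def field_simps)
  then have vg: "vge e (c' - c)" using d v1z vz by (simp add: vge_def v_divide)
  have "(c' - \<tau>) / s = s' * d / s * (y ^ n * inverse (1 + z))"
    by (simp add: c'_def z_def divide_inverse mult.assoc mult.left_commute)
  moreover have "s' * d / s * (y ^ n * inverse (1 + z)) \<in> W"
    using unit_inverse[OF u] by (intro W_mult W_power s' y) auto
  ultimately have "(c' - \<tau>) / s \<in> W" by (simp only:)
  then show thesis using that vg by blast
qed

lemma polynomial_approximation:
  assumes t: "t \<in> M" "t \<noteq> 0" and s: "s \<noteq> 0" and D: "degree G \<le> degree f"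
  obtains F where "\<And>i. vge e (coeff (F - G) i)" "\<And>i. coeff (F - f) i / s \<in> W" "degree F \<le> degree f"
proof -
  have "\<forall>i. \<exists>c. vge e (c - coeff G i) \<and> (c - coeff f i) / s \<in> W"
    using weak_approximation[OF t s] by metis
  then obtain c where c: "\<And>i. vge e (c i - coeff G i) \<and> (c i - coeff f i) / s \<in> W" by metis
  define F where "F = Poly (map c [0..<Suc (degree f)])"
  have F: "coeff F i = (if i < Suc (degree f) then c i else 0)" for i
    unfolding F_def coeff_Poly_map ..
  have "vge e (coeff (F - G) i)" for i using c D by (simp add: F coeff_eq_0)
  moreover have "coeff (F - f) i / s \<in> W" for i using c W_0 by (simp add: F coeff_eq_0)
  moreover have "degree F \<le> degree f" by (rule degree_le) (simp add: F)
  ultimately show thesis using that by blast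
qed

text \<open>The target at \<open>W\<close> is the Eisenstein polynomial \<open>X^N + t\<close>.
  Approximating it modulo \<open>t^2\<close> keeps the constant term from becoming divisible by
  \<open>t^2\<close>.\<close>

theorem irreducibles_dense_principal:
  assumes t: "t \<in> M" "t \<noteq> 0" "\<And>x. x \<in> M \<Longrightarrow> x / t \<in> W"
  shows irreducibles_dense
  unfolding irreducibles_dense_def
proof (intro allI)
  fix G :: "'a poly" and e :: int and D :: nat
  \<comment> \<open>As \<open>N\<close> exceeds the degree of \<open>G\<close>, the leading
    coefficient can be near 0 for \<open>v\<close> and near 1 for \<open>W\<close>.\<close>
  define N where "N = Suc (max D (degree G))"
  define f where "f = monom 1 N + [:t:]"
  have cf: "coeff f i = (if i = N then 1 else if i = 0 then t else 0)" for i
    by (auto simp: f_def N_def coeff_pCons split: nat.split)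
  have degf: "degree f = N" by (rule antisym) (auto intro!: degree_le le_degree simp: cf)
  have "t^2 \<noteq> 0" "degree G \<le> degree f" using t(2) degf by (auto simp: N_def)
  then obtain F where F: "\<And>i. vge e (coeff (F - G) i)" "\<And>i. coeff (F - f) i / t^2 \<in> W" "degree F \<le> degree f"
    using polynomial_approximation[OF t(1,2), of "t^2" G f e] by blast
  define w where "w i = coeff (F - f) i / t^2" for i
  have w: "w i \<in> W" "coeff F i = coeff f i + t^2 * w i" for i using F(2)[of i] t(2) by (simp_all add: w_def)
  have tW: "t \<in> W" "t^2 \<in> M" using t M_W M_mult by (auto simp: power2_eq_square)
  have "coeff F N - 1 \<in> M" using w[of N] tW M_mult2 by (simp add: cf)
  then have lc: "coeff F N \<notin> M" using M_diff[of "coeff F N" "coeff F N - 1"] M_1 by auto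
  then have degF: "degree F = N" using F(3) degf M_0 le_degree[of F N] by (metis antisym)
  have "irreducible F"
  proof (rule Eisenstein[OF t])
    have "coeff f i \<in> W" for i using W_0 W_1 tW by (simp add: cf)
    then show "F \<in> WX" using w tW M_W W_add W_mult by (auto simp: polys_over_def)
    show "coeff F i \<in> M" if "i < degree F" for i
      using that w(1)[of i] M_add[OF _ M_mult2[OF tW(2) w(1)[of i]]] t M_0 by (auto simp: w(2) cf degF)
    show "coeff F 0 / t\<^sup>2 \<notin> W"
    proof
      assume H: "coeff F 0 / t\<^sup>2 \<in> W"
      have "coeff F 0 / t\<^sup>2 - w 0 = inverse t"
        using t(2) by (simp add: w(2) cf N_def field_simps power2_eq_square)
      then have "inverse t \<in> W" using W_diff[OF H w(1)[of 0]] by simp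
      then show False using t by (simp add: nonunits_def)
    qed
  qed (use lc degF in \<open>auto simp: N_def\<close>)
  then show "\<exists>F. irreducible F \<and> D < degree F \<and> (\<forall>i. vge e (coeff (F - G) i))"
    using F(1) degF by (auto simp: N_def)
qed

text \<open>The target at \<open>W\<close> is a monic polynomial irreducible modulo
  \<open>M\<close>; congruence modulo a non-zero \<open>t\<close> in \<open>M\<close> preserves this
  irreducibility.\<close>

theorem irreducibles_dense_finite_residues:
  assumes S: "finite S" "\<And>x. x \<in> W \<Longrightarrow> \<exists>s\<in>S. x - s \<in> M" and t: "t \<in> M" "t \<noteq> 0"
  shows irreducibles_dense
  unfolding irreducibles_dense_def
proof (intro allI)
  fix G :: "'a poly" and e :: int and D :: nat
  obtain f where f: "f \<in> WX" "max D (degree G) < degree f" "lead_coeff f = 1"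
    "\<And>g h. g \<in> WX \<Longrightarrow> h \<in> WX \<Longrightarrow> 0 < degree g \<Longrightarrow> 0 < degree h \<Longrightarrow> lead_coeff g = 1 \<Longrightarrow>
       lead_coeff h = 1 \<Longrightarrow> f - g * h \<in> MX \<Longrightarrow> False"
    using irreducible_mod_M_exists[OF S, of "max D (degree G)"] by metis
  obtain F where F: "\<And>i. vge e (coeff (F - G) i)" "\<And>i. coeff (F - f) i / t \<in> W" "degree F \<le> degree f"
    using polynomial_approximation[OF t t(2), of G f e] f(2) by force
  have cM: "coeff (F - f) i \<in> M" for i using M_mult2[OF t(1) F(2)[of i]] t(2) by simp
  then have "F - f \<in> MX" by (simp add: polys_over_def)
  moreover have l: "coeff F (degree f) - 1 \<in> M" using cM[of "degree f"] f(3) by simp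
  then have "coeff F (degree f) \<noteq> 0" using M_minus[of "-1"] M_1 by auto
  then have deg: "degree F = degree f" using F(3) le_degree by (metis antisym)
  ultimately have "irreducible F" using irreducible_mod_M[OF f(1) _ f(4)] f(2) l by simp
  then show "\<exists>F. irreducible F \<and> D < degree F \<and> (\<forall>i. vge e (coeff (F - G) i))"
    using F(1) deg f(2) by auto
qed

end

section \<open>Valuations and their rings\<close>

lemma valuation_subring_of_valuation:
  assumes "valuation_ring_of L W"
  shows "valuation_subring L W"
proof -
  obtain G :: "'a set monoid" and r v where v: "is_valuation L G r v" and W: "W = ring_of_valuation L G r v"
    using assms unfolding valuation_ring_of_def by blast
  define U where "U = L - {0}"
  have F: "is_subfield L" and O: "ordered_abelian_group G r"
    and vU: "\<And>x. x \<in> U \<Longrightarrow> v x \<in> carrier G"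
    and vm: "\<And>x y. x \<in> U \<Longrightarrow> y \<in> U \<Longrightarrow> v (x * y) = v x \<otimes>\<^bsub>G\<^esub> v y"
    and va: "\<And>x y. x \<in> U \<Longrightarrow> y \<in> U \<Longrightarrow> x + y \<noteq> 0 \<Longrightarrow> (v x, v (x + y)) \<in> r \<or> (v y, v (x + y)) \<in> r"
    using v by (auto simp: is_valuation_def U_def)
  interpret G: comm_group G using O by (simp add: ordered_abelian_group_def)
  note Fr = subfield_subring[OF F]
  have U: "1 \<in> U" "-1 \<in> U" "\<And>x y. x \<in> U \<Longrightarrow> y \<in> U \<Longrightarrow> x * y \<in> U" "\<And>x. x \<in> U \<Longrightarrow> inverse x \<in> U"
    "\<And>x. x \<in> U \<Longrightarrow> - x \<in> U"
    using F subring_1[OF Fr] subring_minus[OF Fr] subring_mult[OF Fr] subfield_inverse[OF F] by (auto simp: U_def)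
  have lin: "linear_order_on (carrier G) r"
    and tr: "\<And>a b c. a \<in> carrier G \<Longrightarrow> b \<in> carrier G \<Longrightarrow> c \<in> carrier G \<Longrightarrow>
               (a, b) \<in> r \<Longrightarrow> (a \<otimes>\<^bsub>G\<^esub> c, b \<otimes>\<^bsub>G\<^esub> c) \<in> r"
    using O by (auto simp: ordered_abelian_group_def)
  have refl: "\<And>a. a \<in> carrier G \<Longrightarrow> (a, a) \<in> r"
    and trans: "\<And>a b c. (a, b) \<in> r \<Longrightarrow> (b, c) \<in> r \<Longrightarrow> (a, c) \<in> r"
    and anti: "\<And>a b. (a, b) \<in> r \<Longrightarrow> (b, a) \<in> r \<Longrightarrow> a = b"
    and tot: "\<And>a b. a \<in> carrier G \<Longrightarrow> b \<in> carrier G \<Longrightarrow> (a, b) \<in> r \<or> (b, a) \<in> r"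
    using lin unfolding order_on_defs refl_on_def total_on_def
    by (blast, metis transD, metis antisymD, metis)
  have v1: "v 1 = \<one>\<^bsub>G\<^esub>" using vm[OF U(1,1)] vU[OF U(1)] by simp
  \<comment> \<open>The value of -1 squares to the identity, and an ordered group has no
    torsion.\<close>
  have vm1: "v (-1) = \<one>\<^bsub>G\<^esub>"
  proof -
    have g: "v (-1) \<in> carrier G" "v (-1) \<otimes>\<^bsub>G\<^esub> v (-1) = \<one>\<^bsub>G\<^esub>"
      using vm[OF U(2,2)] vU[OF U(2)] v1 by simp_all
    show ?thesis
      using tot[OF g(1) G.one_closed] tr[OF g(1) G.one_closed g(1)] tr[OF G.one_closed g(1) g(1)] g anti
      by auto
  qed
  have Wi: "x \<in> W \<longleftrightarrow> x = 0 \<or> x \<in> U \<and> (\<one>\<^bsub>G\<^esub>, v x) \<in> r" for x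
    by (auto simp: W ring_of_valuation_def U_def)
  have WL: "W \<subseteq> L" using subring_0[OF Fr] by (auto simp: Wi U_def)
  have neg: "- x \<in> W" if "x \<in> W" for x
    using that U(5)[of x] vm[OF U(2), of x] vm1 vU by (auto simp: Wi)
  have "is_subring W"
    unfolding is_subring_def
  proof (intro conjI ballI)
    show "1 \<in> W" using U v1 refl[OF G.one_closed] by (simp add: Wi)
  next
    fix x y assume xy: "x \<in> W" "y \<in> W"
    show "x * y \<in> W"
    proof (cases "x = 0 \<or> y = 0")
      case False
      then have *: "x \<in> U" "y \<in> U" "(\<one>\<^bsub>G\<^esub>, v x) \<in> r" "(\<one>\<^bsub>G\<^esub>, v y) \<in> r" using xy by (auto simp: Wi)
      then have "(v y, v (x * y)) \<in> r" using tr[OF G.one_closed vU vU, of x y] vm vU by simp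
      then show ?thesis using * trans U(3) by (metis Wi)
    qed (auto simp: Wi)
    have "x - y = x + (- y)" by simp
    moreover have "x + z \<in> W" if z: "z \<in> W" for z
    proof (cases "x = 0 \<or> z = 0 \<or> x + z = 0")
      case False
      then have *: "x \<in> U" "z \<in> U" "(\<one>\<^bsub>G\<^esub>, v x) \<in> r" "(\<one>\<^bsub>G\<^esub>, v z) \<in> r" using xy z by (auto simp: Wi)
      then have "(\<one>\<^bsub>G\<^esub>, v (x + z)) \<in> r" using va[of x z] False trans by blast
      moreover have "x + z \<in> U" using * False subring_add[OF Fr] by (auto simp: U_def)
      ultimately show ?thesis by (simp add: Wi)
    qed (use xy z in \<open>auto simp: Wi\<close>)
    ultimately show "x - y \<in> W" using neg[OF xy(2)] by metis
  qed
  moreover have "x \<in> W \<or> inverse x \<in> W" if x: "x \<in> L" "x \<noteq> 0" for x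
  proof -
    have xU: "x \<in> U" "inverse x \<in> U" using x U(4) by (auto simp: U_def)
    have e: "v x \<otimes>\<^bsub>G\<^esub> v (inverse x) = \<one>\<^bsub>G\<^esub>" using vm[OF xU] x v1 by simp
    show ?thesis
    proof (cases "(\<one>\<^bsub>G\<^esub>, v x) \<in> r")
      case False
      then have "(v x, \<one>\<^bsub>G\<^esub>) \<in> r" using tot vU[OF xU(1)] by blast
      then have "(\<one>\<^bsub>G\<^esub>, v (inverse x)) \<in> r"
        using tr[OF vU[OF xU(1)] G.one_closed vU[OF xU(2)]] e vU[OF xU(2)] by simp
      then show ?thesis using xU by (simp add: Wi)
    qed (use xU in \<open>simp add: Wi\<close>)
  qed
  ultimately show ?thesis using F WL by unfold_locales auto
qed

lemma discrete_valuation_of_ring: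
  assumes "discrete_valuation_ring_of UNIV V"
  obtains v where "discrete_valuation v" "V = discrete_valuation.val_ring v"
proof -
  obtain v where v: "is_valuation UNIV int_add_group {(a, b). a \<le> b} v" "v ` (UNIV - {0}) = UNIV"
    "V = ring_of_valuation UNIV int_add_group {(a, b). a \<le> b} v"
    using assms unfolding discrete_valuation_ring_of_def by blast
  have "\<exists>x. x \<noteq> 0 \<and> v x = 1" using v(2) by (metis DiffD2 UNIV_I imageE singletonI)
  then have d: "discrete_valuation v"
    using v(1) by unfold_locales (auto simp: is_valuation_def min_le_iff_disj)
  moreover have "V = discrete_valuation.val_ring v"
    unfolding v(3) discrete_valuation.val_ring_def[OF d] discrete_valuation.vge_def[OF d]
    by (auto simp: ring_of_valuation_def)
  ultimately show thesis using that by blast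
qed

section \<open>The ring of a discrete valuation\<close>

context discrete_valuation
begin

lemma val_ring_iff: "x \<in> val_ring \<longleftrightarrow> vge 0 x"
  by (simp add: val_ring_def)

lemma nonunits_val_ring: "x \<in> nonunits val_ring \<longleftrightarrow> vge 1 x"
  by (auto simp: nonunits_def val_ring_iff vge_def v_inverse)

lemma valuation_ring_UNIV: "valuation_ring_UNIV val_ring"
proof unfold_locales
  show "is_subring val_ring"
    by (auto simp: is_subring_def val_ring_iff intro: vge_diff vge_mult0)
  show "x \<in> val_ring \<or> inverse x \<in> val_ring" if "x \<noteq> 0" for x
    using that by (auto simp: val_ring_iff vge_def v_inverse)
qed (auto simp: subfield_UNIV)

lemma val_ring_not_UNIV: "val_ring \<noteq> UNIV"
proof -
  obtain p where p: "p \<noteq> 0" "v p = 1" using v_surj by blast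
  then have "inverse p \<notin> val_ring" by (auto simp: val_ring_iff vge_def v_inverse)
  then show ?thesis by blast
qed

lemma infinite_field: "infinite (UNIV :: 'a set)"
proof
  assume fin: "finite (UNIV :: 'a set)"
  obtain p where p: "p \<noteq> 0" "v p = 1" using v_surj by blast
  have "inj (\<lambda>n::nat. p ^ n)"
  proof (rule injI)
    fix m n :: nat assume "p ^ m = p ^ n"
    then have "v (p ^ m) = v (p ^ n)" by simp
    then show "m = n" using p by (simp add: v_power)
  qed
  then show False using fin finite_subset[OF subset_UNIV] finite_imageD infinite_UNIV_nat by blast
qed

end

section \<open>Maximal ideal and residue field of a valuation ring\<close>

context valuation_subring
begin

lemma ideal_M: "is_ideal M W"
  unfolding is_ideal_def using M_W M_0 M_add M_mult by auto

lemma maximal_ideal_eq: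
  assumes "is_maximal_ideal J W"
  shows "J = M"
proof -
  have J: "is_ideal J W" "J \<noteq> W" "\<And>I. is_ideal I W \<Longrightarrow> J \<subseteq> I \<Longrightarrow> I = J \<or> I = W"
    using assms by (auto simp: is_maximal_ideal_def)
  have "J \<subseteq> M"
  proof
    fix x assume x: "x \<in> J"
    show "x \<in> M"
    proof (rule ccontr)
      assume "x \<notin> M"
      then have "x \<noteq> 0" "inverse x \<in> W" using x J(1) unit_iff by (auto simp: is_ideal_def)
      then have "1 \<in> J" using x J(1) unfolding is_ideal_def by (metis left_inverse)
      then have "a * 1 \<in> J" if "a \<in> W" for a using that J(1) unfolding is_ideal_def by blast
      then have "J = W" using J(1) unfolding is_ideal_def by auto
      then show False using J(2) by blast
    qed
  qed
  then show ?thesis using J(3)[OF ideal_M] M_1 W_1 by blast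
qed

lemma finite_residues:
  assumes "finite_residue_field W"
  shows "\<exists>S. finite S \<and> (\<forall>x\<in>W. \<exists>s\<in>S. x - s \<in> M)"
proof -
  obtain J where "is_maximal_ideal J W" "finite (residue_classes W J)"
    using assms unfolding finite_residue_field_def by blast
  then have fin: "finite (residue_classes W M)" using maximal_ideal_eq by simp
  define S where "S = (\<lambda>C. SOME y. y \<in> C) ` residue_classes W M"
  have "\<exists>s\<in>S. x - s \<in> M" if x: "x \<in> W" for x
  proof -
    define C where "C = {(x, y). x \<in> W \<and> y \<in> W \<and> x - y \<in> M} `` {x}"
    have "C \<in> residue_classes W M" unfolding residue_classes_def C_def using x by (rule quotientI)
    moreover have "x \<in> C" using x M_0 by (simp add: C_def)
    then have "(SOME y. y \<in> C) \<in> C" by (rule someI)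
    moreover have "x - y \<in> M" if "y \<in> C" for y using that by (simp add: C_def)
    ultimately show ?thesis unfolding S_def by blast
  qed
  then show ?thesis using fin unfolding S_def by blast
qed

lemma principal_generator:
  assumes "nonzero_principal_maximal_ideal W"
  shows "\<exists>t\<in>M. t \<noteq> 0 \<and> (\<forall>x\<in>M. x / t \<in> W)"
proof -
  obtain J where "is_maximal_ideal J W" "J \<noteq> {0}" "is_principal_ideal J W"
    using assms unfolding nonzero_principal_maximal_ideal_def by blast
  then have "M \<noteq> {0}" "is_principal_ideal M W" using maximal_ideal_eq by auto
  then obtain t where t: "M = {a * t | a. a \<in> W}" unfolding is_principal_ideal_def by blast
  have "t \<noteq> 0"
  proof
    assume "t = 0"
    then have "M = {0}" using t W_0 by auto
    then show False using \<open>M \<noteq> {0}\<close> by blast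
  qed
  moreover have "1 * t \<in> M" unfolding t using W_1 by blast
  moreover have "x / t \<in> W" if "x \<in> M" for x using that t \<open>t \<noteq> 0\<close> by auto
  ultimately show ?thesis by auto
qed

text \<open>Among the first \<open>card S + 1\<close> powers two share a representative, so some
  \<open>u ^ d\<close> with \<open>d\<close> at most \<open>card S\<close> is 1 modulo
  \<open>M\<close>. The factorial makes the exponent the same for all units.\<close>

lemma unit_power_cong_1:
  assumes u: "u \<in> W - M" and S: "finite S" "\<And>i. \<exists>s\<in>S. u ^ i - s \<in> M"
  shows "u ^ fact (card S) - 1 \<in> M"
proof -
  have "\<forall>i. \<exists>s. s \<in> S \<and> u ^ i - s \<in> M" using S(2) by blast
  then obtain s where s: "\<And>i. s i \<in> S \<and> u ^ i - s i \<in> M" by metis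
  have "\<not> inj_on s {..card S}"
  proof
    assume "inj_on s {..card S}"
    then have "card {..card S} \<le> card S" using S(1) s by (intro card_inj_on_le[of s]) auto
    then show False by simp
  qed
  then obtain i j where ij: "i \<le> card S" "j \<le> card S" "i < j" "s i = s j"
    unfolding inj_on_def by (metis atMost_iff linorder_neqE_nat)
  define d where "d = j - i"
  have "(u ^ j - s j) - (u ^ i - s i) \<in> M" using s M_diff by blast
  then have "u ^ i * (u ^ d - 1) \<in> M"
    using ij by (simp add: d_def right_diff_distrib power_add[symmetric])
  moreover have "u ^ i \<in> W - M" for i
  proof (induction i)
    case (Suc i)
    then show ?case using unit_mult[OF u] by simp
  qed (use M_1 W_1 in simp)
  ultimately have d: "u ^ d - 1 \<in> M" using M_prime[of "u ^ i" "u ^ d - 1"] W_diff W_1 by blast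
  have pow: "(u ^ d) ^ e - 1 \<in> M" for e
  proof (induction e)
    case (Suc e)
    have "(u ^ d - 1) * (u ^ d) ^ e + ((u ^ d) ^ e - 1) \<in> M"
      using d Suc W_power u by (intro M_add M_mult2) auto
    then show ?case by (simp add: left_diff_distrib)
  qed (use M_0 in simp)
  have "d dvd fact (card S)" using ij by (intro dvd_fact) (auto simp: d_def)
  then obtain e where "fact (card S) = d * e" by (elim dvdE)
  then show ?thesis using pow[of e] by (simp add: power_mult)
qed

end

section \<open>Reduction to an independent valuation ring of a subfield\<close>

text \<open>The alternative of case (3) in terms of elements: a non-zero generator of the maximal
  ideal, or finitely many representatives of the residue classes.\<close>

definition principal_or_finite :: "'a::field set \<Rightarrow> bool" where
  "principal_or_finite W \<longleftrightarrow> (\<exists>t\<in>nonunits W. t \<noteq> 0 \<and> (\<forall>x\<in>nonunits W. x / t \<in> W)) \<or>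
     (\<exists>S. finite S \<and> (\<forall>x\<in>W. \<exists>s\<in>S. x - s \<in> nonunits W))"

lemma (in independent_valuations) irreducibles_dense_principal_or_finite:
  assumes "principal_or_finite W"
  shows irreducibles_dense
  using assms unfolding principal_or_finite_def
proof
  assume "\<exists>t\<in>M. t \<noteq> 0 \<and> (\<forall>x\<in>M. x / t \<in> W)"
  then obtain t where "t \<in> M" "t \<noteq> 0" "\<forall>x\<in>M. x / t \<in> W" by blast
  then show ?thesis using irreducibles_dense_principal[of t] by simp
next
  assume "\<exists>S. finite S \<and> (\<forall>x\<in>W. \<exists>s\<in>S. x - s \<in> M)"
  then obtain S where S: "finite S" "\<And>x. x \<in> W \<Longrightarrow> \<exists>s\<in>S. x - s \<in> M" by blast
  \<comment> \<open>If \<open>M\<close> were zero, \<open>W\<close> would be the whole field and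
    equal to its residue field; but a discretely valued field is infinite.\<close>
  have "\<exists>t\<in>M. t \<noteq> 0"
  proof (rule ccontr)
    assume M0: "\<not> ?thesis"
    have "x \<in> W" for x
    proof (rule ccontr)
      assume "x \<notin> W"
      then have "inverse x \<in> M" "x \<noteq> 0" using not_in_imp_inverse_M[of x] W_0 by auto
      then show False using M0 by auto
    qed
    then have "x \<in> S" for x using S(2)[of x] M0 by fastforce
    then have "UNIV \<subseteq> S" by (rule subsetI)
    then show False using finite_subset[OF _ S(1)] infinite_field by simp
  qed
  then obtain t where "t \<in> M" "t \<noteq> 0" by blast
  with S show ?thesis using irreducibles_dense_finite_residues by metis
qed

text \<open>\<open>W\<close> is extended to a valuation ring \<open>R\<close> of the whole field.
  \<open>R\<close> inherits the finiteness alternative along the finite extension and, containing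
  \<open>W\<close>, is not contained in \<open>V\<close>.\<close>

theorem prescribed_lengths_if_independent:
  assumes v: "discrete_valuation v" and V: "V = discrete_valuation.val_ring v"
    and S: "finite S" "\<And>x. x \<in> V \<Longrightarrow> \<exists>s\<in>S. x - s \<in> nonunits V"
    and L: "finite_extension L (UNIV :: 'a::field set)" and W: "valuation_subring L W"
    and indep: "\<not> W \<subseteq> V" and pf: "principal_or_finite W"
  shows "prescribed_lengths V"
proof -
  interpret discrete_valuation v by fact
  interpret V: valuation_ring_UNIV V unfolding V by (rule valuation_ring_UNIV)
  obtain R where R: "valuation_subring UNIV R" "R \<inter> L = W"
    using valuation_subring.extension_exists[OF W] by blast
  interpret R: finite_over_subfield R L
    using R(1) L by (simp add: finite_over_subfield_def finite_over_subfield_axioms_def)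
  have nonunits: "x \<in> nonunits W \<longleftrightarrow> x \<in> nonunits R \<and> x \<in> L" for x
    using R(2) subfield_inverse[OF R.K] by (auto simp: nonunits_def)
  have "principal_or_finite R"
    using pf unfolding principal_or_finite_def
  proof
    assume "\<exists>t\<in>nonunits W. t \<noteq> 0 \<and> (\<forall>x\<in>nonunits W. x / t \<in> W)"
    then obtain t where t: "t \<in> nonunits W" "t \<noteq> 0" "\<And>x. x \<in> nonunits W \<Longrightarrow> x / t \<in> W" by blast
    have "\<exists>s\<in>nonunits R. s \<noteq> 0 \<and> (\<forall>x\<in>nonunits R. x / s \<in> R)"
      using t R(2) by (intro R.principal_from_subfield[of t]) (auto simp: nonunits)
    then show "(\<exists>s\<in>nonunits R. s \<noteq> 0 \<and> (\<forall>x\<in>nonunits R. x / s \<in> R)) \<or>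
      (\<exists>S. finite S \<and> (\<forall>x\<in>R. \<exists>s\<in>S. x - s \<in> nonunits R))" ..
  next
    assume "\<exists>S. finite S \<and> (\<forall>x\<in>W. \<exists>s\<in>S. x - s \<in> nonunits W)"
    then obtain S where "finite S" "\<And>x. x \<in> W \<Longrightarrow> \<exists>s\<in>S. x - s \<in> nonunits W" by blast
    then have "\<exists>S. finite S \<and> (\<forall>x\<in>R. \<exists>s\<in>S. x - s \<in> nonunits R)"
      using R(2) nonunits by (intro R.finite_residues_from_subfield[of S]) blast+
    then show "(\<exists>s\<in>nonunits R. s \<noteq> 0 \<and> (\<forall>x\<in>nonunits R. x / s \<in> R)) \<or>
      (\<exists>S. finite S \<and> (\<forall>x\<in>R. \<exists>s\<in>S. x - s \<in> nonunits R))" ..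
  qed
  moreover have "independent_valuations v R"
    using indep R V v
    by (auto simp: independent_valuations_def independent_valuations_axioms_def valuation_ring_UNIV_def)
  ultimately have dense: irreducibles_dense
    using independent_valuations.irreducibles_dense_principal_or_finite by blast
  have m: "vge 1 (u ^ fact (card S) - 1)" if "u \<noteq> 0" "v u = 0" for u
  proof -
    have "u \<in> V - V.M" using that by (auto simp: V nonunits_val_ring val_ring_iff vge_def)
    then have "u ^ fact (card S) - 1 \<in> V.M"
      using V.W_power S by (intro V.unit_power_cong_1) auto
    then show ?thesis by (simp add: V nonunits_val_ring)
  qed
  have "0 < (fact (card S) :: nat)" by simp
  from prescribed_factorization_lengths[OF this m dense] show ?thesis unfolding V .
qed

section \<open>Localizations at prime elements\<close>

definition quotients :: "'a::field set \<Rightarrow> 'a set" where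
  "quotients A = {a / b | a b. a \<in> A \<and> b \<in> A \<and> b \<noteq> 0}"

lemma subfield_quotients:
  assumes A: "is_subring A"
  shows "is_subfield (quotients A)"
  unfolding is_subfield_def is_subring_def
proof (intro conjI ballI impI)
  have "1 = 1 / (1::'a)" by simp
  then show "1 \<in> quotients A" using subring_1[OF A] unfolding quotients_def by (metis (mono_tags, lifting) mem_Collect_eq one_neq_zero)
next
  fix x y assume "x \<in> quotients A" "y \<in> quotients A"
  then obtain a b c d where "x = a / b" "y = c / d" and mem: "a \<in> A" "b \<in> A" "b \<noteq> 0" "c \<in> A" "d \<in> A" "d \<noteq> 0"
    unfolding quotients_def by blast
  then have "x - y = (a * d - c * b) / (b * d)" "x * y = (a * c) / (b * d)"
    by (simp_all add: diff_frac_eq)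
  moreover have "a * d - c * b \<in> A" "b * d \<in> A" "b * d \<noteq> 0" "a * c \<in> A"
    using mem A by (auto simp: subring_diff subring_mult)
  ultimately show "x - y \<in> quotients A" "x * y \<in> quotients A" unfolding quotients_def by blast+
next
  fix x assume "x \<in> quotients A" "x \<noteq> 0"
  then obtain a b where "x = a / b" "a \<in> A" "b \<in> A" "b \<noteq> 0" "a \<noteq> 0" unfolding quotients_def by auto
  then show "inverse x \<in> quotients A" unfolding quotients_def by auto
qed

lemma subset_quotients: "is_subring A \<Longrightarrow> A \<subseteq> quotients A"
proof
  fix a assume "is_subring A" "a \<in> A"
  then have "a / 1 \<in> quotients A" unfolding quotients_def using subring_1 one_neq_zero by blast
  then show "a \<in> quotients A" by simp
qed

text \<open>\<open>t\<close> is a prime element of \<open>A\<close>, and \<open>strip\<close> says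
  that no non-zero element is divisible by all powers of \<open>t\<close>. These conditions make the
  localization at \<open>t\<close> a valuation ring of the quotient field with \<open>t\<close>
  generating its maximal ideal.\<close>

locale prime_localization =
  fixes A :: "'a::field set" and t :: 'a
  assumes A: "is_subring A" and t: "t \<in> A" "t \<noteq> 0" and one: "1 \<notin> (*) t ` A"
    and prime: "a \<in> A \<Longrightarrow> b \<in> A \<Longrightarrow> a * b \<in> (*) t ` A \<Longrightarrow> a \<in> (*) t ` A \<or> b \<in> (*) t ` A"
    and strip: "a \<in> A \<Longrightarrow> a \<noteq> 0 \<Longrightarrow> \<exists>k b. b \<in> A \<and> b \<notin> (*) t ` A \<and> a = t ^ k * b"
begin

definition local_ring :: "'a set" where
  "local_ring = {a / b | a b. a \<in> A \<and> b \<in> A \<and> b \<notin> (*) t ` A}"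

lemma zero_multiple: "0 \<in> (*) t ` A"
  using subring_0[OF A] by force

lemma local_ringI: "a \<in> A \<Longrightarrow> b \<in> A \<Longrightarrow> b \<notin> (*) t ` A \<Longrightarrow> a / b \<in> local_ring"
  unfolding local_ring_def by blast

lemma subset_local_ring: "A \<subseteq> local_ring"
  using local_ringI[OF _ subring_1[OF A] one] by auto

lemma valuation_subring_local_ring: "valuation_subring (quotients A) local_ring"
proof unfold_locales
  show "is_subfield (quotients A)" by (rule subfield_quotients[OF A])
  show "local_ring \<subseteq> quotients A"
    unfolding local_ring_def quotients_def using zero_multiple by blast
  show "is_subring local_ring"
    unfolding is_subring_def
  proof (intro conjI ballI)
    show "1 \<in> local_ring" using subset_local_ring subring_1[OF A] by blast
  next
    fix x y assume "x \<in> local_ring" "y \<in> local_ring"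
    then obtain a b c d where xy: "x = a / b" "y = c / d"
      and mem: "a \<in> A" "b \<in> A" "b \<notin> (*) t ` A" "c \<in> A" "d \<in> A" "d \<notin> (*) t ` A"
      unfolding local_ring_def by blast
    then have "b \<noteq> 0" "d \<noteq> 0" using zero_multiple by auto
    then have eq: "x - y = (a * d - c * b) / (b * d)" "x * y = (a * c) / (b * d)"
      by (simp_all add: diff_frac_eq xy)
    have bd: "b * d \<in> A" "b * d \<notin> (*) t ` A" using prime mem A by (auto simp: subring_mult)
    show "x - y \<in> local_ring" "x * y \<in> local_ring"
      unfolding eq using mem A by (auto intro!: local_ringI bd simp: subring_diff subring_mult)
  qed
  fix x assume "x \<in> quotients A" "x \<noteq> 0"
  then obtain a b where x: "x = a / b" and ab: "a \<in> A" "b \<in> A" "b \<noteq> 0" "a \<noteq> 0"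
    unfolding quotients_def by auto
  obtain k a' where a': "a' \<in> A" "a' \<notin> (*) t ` A" "a = t ^ k * a'" using strip ab by blast
  obtain l b' where b': "b' \<in> A" "b' \<notin> (*) t ` A" "b = t ^ l * b'" using strip ab by blast
  have nz: "a' \<noteq> 0" "b' \<noteq> 0" using a' b' zero_multiple by auto
  show "x \<in> local_ring \<or> inverse x \<in> local_ring"
  proof (cases "l \<le> k")
    case True
    then have "x = (t ^ (k - l) * a') / b'" using nz t by (simp add: x a'(3) b'(3) power_diff field_simps)
    then show ?thesis using a' b' A t by (auto intro!: local_ringI simp: subring_mult subring_power)
  next
    case False
    then have "inverse x = (t ^ (l - k) * b') / a'" using nz t by (simp add: x a'(3) b'(3) power_diff field_simps)
    then show ?thesis using a' b' A t by (auto intro!: local_ringI simp: subring_mult subring_power)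
  qed
qed

lemma principal_or_finite_local_ring: "principal_or_finite local_ring"
proof -
  have nonmult: "a \<in> (*) t ` A" if x: "a / b \<in> nonunits local_ring" "a \<in> A" "b \<in> A" "b \<noteq> 0" for a b
  proof (rule ccontr)
    assume a: "a \<notin> (*) t ` A"
    then have "b / a \<in> local_ring" using x by (intro local_ringI)
    then have "a = 0" using x(1,4) by (auto simp: nonunits_def)
    then show False using a zero_multiple by simp
  qed
  have "t \<in> nonunits local_ring"
  proof -
    have "inverse t \<notin> local_ring"
    proof
      assume "inverse t \<in> local_ring"
      then obtain a b where "inverse t = a / b" "a \<in> A" "b \<in> A" "b \<notin> (*) t ` A"
        unfolding local_ring_def by blast
      moreover from this have "b \<noteq> 0" using zero_multiple by auto
      ultimately have "b = t * a" using t by (simp add: field_simps)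
      then show False using \<open>a \<in> A\<close> \<open>b \<notin> (*) t ` A\<close> by blast
    qed
    then show ?thesis using t subset_local_ring by (auto simp: nonunits_def)
  qed
  moreover have "x / t \<in> local_ring" if x: "x \<in> nonunits local_ring" for x
  proof -
    obtain a b where ab: "x = a / b" "a \<in> A" "b \<in> A" "b \<notin> (*) t ` A"
      using x unfolding local_ring_def nonunits_def by blast
    moreover from this have "b \<noteq> 0" using zero_multiple by auto
    ultimately obtain a' where "a = t * a'" "a' \<in> A" using nonmult x by blast
    then show ?thesis using ab t by (auto intro: local_ringI)
  qed
  ultimately show ?thesis unfolding principal_or_finite_def using t(2) by blast
qed

text \<open>Every denominator is a power of \<open>t\<close> times a unit of the
  localization.\<close>

lemma quotients_subset:
  assumes V: "is_subring V" "local_ring \<subseteq> V" "inverse t \<in> V"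
  shows "quotients A \<subseteq> V"
proof
  fix x assume "x \<in> quotients A"
  then obtain a b where x: "x = a / b" and ab: "a \<in> A" "b \<in> A" "b \<noteq> 0" unfolding quotients_def by blast
  obtain k b' where b': "b' \<in> A" "b' \<notin> (*) t ` A" "b = t ^ k * b'" using strip ab by blast
  then have "a / b' * inverse t ^ k \<in> V"
    using V ab local_ringI by (intro subring_mult subring_power) auto
  then show "x \<in> V" by (simp add: x b'(3) field_simps)
qed

end

text \<open>Inverting two coprime primes inverts everything, so \<open>V\<close> cannot contain both localizations.\<close>

lemma prescribed_lengths_from_two_primes:
  fixes v :: "'a::field \<Rightarrow> int"
  assumes v: "discrete_valuation v" and V: "V = discrete_valuation.val_ring v"
    and S: "finite S" "\<And>x. x \<in> V \<Longrightarrow> \<exists>s\<in>S. x - s \<in> nonunits V"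
    and L: "finite_extension (quotients A) (UNIV :: 'a set)"
    and t: "prime_localization A t" and t': "prime_localization A t'" and ndvd: "t \<notin> (*) t' ` A"
  shows "prescribed_lengths V"
proof (rule ccontr)
  assume not: "\<not> ?thesis"
  interpret t: prime_localization A t by fact
  interpret t': prime_localization A t' by fact
  interpret discrete_valuation v by fact
  interpret V: valuation_ring_UNIV V unfolding V by (rule valuation_ring_UNIV)
  interpret V: finite_over_subfield V "quotients A" using L by unfold_locales
  \<comment> \<open>A localization outside \<open>V\<close> would be the independent valuation ring
    that proves the claim, so under the negated claim both lie in \<open>V\<close>.\<close>
  have "W \<subseteq> V" if "valuation_subring (quotients A) W" "principal_or_finite W" for W
    using prescribed_lengths_if_independent[OF v V S(1) _ L that(1) _ that(2)] S(2) not by blast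
  then have "t.local_ring \<subseteq> V" "t'.local_ring \<subseteq> V"
    using t.valuation_subring_local_ring t.principal_or_finite_local_ring
      t'.valuation_subring_local_ring t'.principal_or_finite_local_ring by blast+
  \<comment> \<open>\<open>t\<close> is not a multiple of \<open>t'\<close>, so it becomes a unit in
    the localization at \<open>t'\<close>.\<close>
  moreover have "inverse t \<in> t'.local_ring"
    using t'.local_ringI[OF subring_1[OF t.A] t.t(1) ndvd] by (simp add: inverse_eq_divide)
  ultimately have "quotients A \<subseteq> V" using t.quotients_subset[OF V.W] by blast
  then show False using V.subfield_not_subset val_ring_not_UNIV V by blast
qed

section \<open>Discreteness in finite extensions\<close>

context finite_over_subfield
begin

text \<open>Positive powers of \<open>p\<close> lie in \<open>M\<close>, so the value of
  \<open>p\<close> has infinite order.\<close>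

lemma powi_unit_cancel:
  assumes p: "p \<in> M" "p \<noteq> 0" and u: "u \<in> W - M" "u' \<in> W - M" and eq: "p powi k * u = p powi l * u'"
  shows "k = l"
proof -
  have *: "k \<le> l" if u: "u \<in> W - M" "u' \<in> W - M" and eq: "p powi k * u = p powi l * u'" for k l u u'
  proof (rule ccontr)
    assume "\<not> k \<le> l"
    then have kl: "k - l = int (nat (k - l))" "0 < nat (k - l)" by auto
    have "p powi k = p powi (k - l) * p powi l" using p(2) by (simp add: power_int_diff)
    then have "p powi l * (p powi (k - l) * u) = p powi l * u'" using eq by (simp add: mult.commute mult.left_commute)
    then have "p powi (k - l) * u = u'" using p(2) by simp
    moreover have "p powi (k - l) = p ^ nat (k - l)" using kl(1) by (metis power_int_of_nat)
    ultimately have "p ^ nat (k - l) * u = u'" by simp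
    moreover have "p ^ nat (k - l) * u \<in> M" using power_M[OF p(1) kl(2)] u M_mult2 by blast
    ultimately show False using u by simp
  qed
  show ?thesis using *[OF u eq] *[OF u(2,1) eq[symmetric]] by simp
qed

text \<open>Every power \<open>x^N\<close> is \<open>p powi w x\<close> up to units, which embeds the value group of \<open>W\<close> into the
  integers.\<close>

lemma discrete_if_powers:
  assumes p: "p \<in> M" "p \<noteq> 0"
    and powers: "\<And>x. x \<in> K \<Longrightarrow> x \<noteq> 0 \<Longrightarrow> \<exists>k u. u \<in> W - M \<and> x = p powi k * u"
  obtains v where "discrete_valuation v" "W = discrete_valuation.val_ring v"
proof -
  obtain n where n: "\<And>x. x \<noteq> 0 \<Longrightarrow> \<exists>m l u. 0 < m \<and> m \<le> n \<and> l \<in> K \<and> l \<noteq> 0 \<and> u \<in> W - M \<and> x ^ m = l * u"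
    using power_in_subfield_up_to_unit by blast
  \<comment> \<open>A common multiple of all exponents \<open>m\<close> up to \<open>n\<close>, so
    that a single power works for every \<open>x\<close>.\<close>
  define N :: nat where "N = fact n"
  have N: "0 < N" by (simp add: N_def)
  have upow: "u ^ d \<in> W - M" if "u \<in> W - M" for u d
  proof (induction d)
    case (Suc d)
    then show ?case using unit_mult[OF that] by simp
  qed (use M_1 W_1 in simp)
  have "\<exists>k u. u \<in> W - M \<and> x ^ N = p powi k * u" if x: "x \<noteq> 0" for x
  proof -
    obtain m l u where m: "0 < m" "m \<le> n" "l \<in> K" "l \<noteq> 0" "u \<in> W - M" "x ^ m = l * u" using n[OF x] by blast
    obtain k u' where k: "u' \<in> W - M" "l = p powi k * u'" using powers m by blast
    obtain d where d: "N = m * d" using m dvd_fact[of m n] by (auto simp: N_def)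
    have "x ^ N = (p powi k * (u' * u)) ^ d" by (simp add: d power_mult m k mult.assoc)
    also have "\<dots> = p powi (k * int d) * (u' * u) ^ d"
      by (simp add: power_mult_distrib power_int_power')
    finally show ?thesis using upow[OF unit_mult[OF k(1) m(5)]] by blast
  qed
  then have "\<forall>x. \<exists>k. x \<noteq> 0 \<longrightarrow> (\<exists>u. u \<in> W - M \<and> x ^ N = p powi k * u)" by blast
  then obtain w where w: "\<And>x. x \<noteq> 0 \<Longrightarrow> \<exists>u. u \<in> W - M \<and> x ^ N = p powi w x * u" by metis
  have w_eq: "w x = k" if "x \<noteq> 0" "u \<in> W - M" "x ^ N = p powi k * u" for x k u
    using w[OF that(1)] powi_unit_cancel[OF p] that(2,3) by metis
  have w_mult: "w (x * y) = w x + w y" if xy: "x \<noteq> 0" "y \<noteq> 0" for x y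
  proof -
    obtain a where a: "a \<in> W - M" "x ^ N = p powi w x * a" using w xy by blast
    obtain b where b: "b \<in> W - M" "y ^ N = p powi w y * b" using w xy by blast
    have "(x * y) ^ N = p powi (w x + w y) * (a * b)"
      using p(2) by (simp add: power_mult_distrib a b power_int_add)
    then show ?thesis using w_eq xy unit_mult[OF a(1) b(1)] by simp
  qed
  have w_W: "x \<in> W \<longleftrightarrow> 0 \<le> w x" if x: "x \<noteq> 0" for x
  proof -
    obtain a where a: "a \<in> W - M" "x ^ N = p powi w x * a" using w x by blast
    have "x \<in> W \<longleftrightarrow> x ^ N \<in> W" using power_in_W[OF UNIV_I N] W_power by blast
    also have "\<dots> \<longleftrightarrow> 0 \<le> w x"
    proof
      assume "0 \<le> w x"
      then have "p powi w x = p ^ nat (w x)" by (simp add: power_int_def)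
      then show "x ^ N \<in> W" using a W_mult W_power M_W[OF p(1)] by auto
    next
      assume xW: "x ^ N \<in> W"
      show "0 \<le> w x"
      proof (rule ccontr)
        assume neg: "\<not> 0 \<le> w x"
        then have "p powi w x = inverse (p ^ nat (- w x))" by (simp add: power_int_def power_inverse)
        then have "p ^ nat (- w x) * x ^ N = a" using a(2) p(2) by simp
        moreover have "p ^ nat (- w x) * x ^ N \<in> M" using power_M[OF p(1)] neg xW M_mult2 by simp
        ultimately show False using a(1) by simp
      qed
    qed
    finally show ?thesis .
  qed
  have w1: "w 1 = 0" using w_mult[of 1 1] by simp
  have w_inverse: "w (inverse x) = - w x" if "x \<noteq> 0" for x using w_mult[of x "inverse x"] that w1 by simp
  have w_power: "w (x ^ d) = int d * w x" if "x \<noteq> 0" for x d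
    by (induction d) (use that w1 w_mult in \<open>auto simp: algebra_simps\<close>)
  have "w p = int N" by (rule w_eq[of p 1]) (use p M_1 W_1 in auto)
  then have ex: "\<exists>g. 0 < g \<and> (\<exists>x. x \<noteq> 0 \<and> w x = int g)" using N p(2) by blast
  \<comment> \<open>The image of \<open>w\<close> is a non-trivial subgroup of the integers,
    \<open>w p\<close> being \<open>N\<close>; dividing by its positive generator makes the
    valuation surjective.\<close>
  define g where "g = (LEAST g. 0 < g \<and> (\<exists>x. x \<noteq> 0 \<and> w x = int g))"
  obtain y where g: "0 < g" and y: "y \<noteq> 0" "w y = int g"
    using LeastI_ex[OF ex] unfolding g_def by blast
  have least: "g \<le> g'" if "0 < g'" "\<exists>x. x \<noteq> 0 \<and> w x = int g'" for g'
    unfolding g_def using that by (intro Least_le) blast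
  have dvd: "int g dvd w x" if x: "x \<noteq> 0" for x
  proof (rule ccontr)
    assume nd: "\<not> int g dvd w x"
    \<comment> \<open>\<open>x\<close> times a power of \<open>y\<close> with \<open>w z\<close> the
      remainder of \<open>w x\<close> modulo \<open>g\<close>, against minimality of
      \<open>g\<close>.\<close>
    define z where "z = x * (if 0 \<le> w x div int g then inverse y ^ nat (w x div int g) else y ^ nat (- (w x div int g)))"
    have z0: "z \<noteq> 0" using x y by (simp add: z_def)
    have "w z = w x - (w x div int g) * int g"
      using x y by (simp add: z_def w_mult w_power w_inverse)
    also have "\<dots> = w x mod int g" by (simp add: minus_div_mult_eq_mod)
    finally have "w z = w x mod int g" .
    moreover have "0 < w x mod int g" "w x mod int g < int g"
      using nd g pos_mod_sign[of "int g" "w x"] pos_mod_bound[of "int g" "w x"]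
      unfolding dvd_eq_mod_eq_0 by linarith+
    ultimately have "w z = int (nat (w z))" "0 < nat (w z)" "nat (w z) < g" by auto
    then show False using least[of "nat (w z)"] z0 by (metis not_le)
  qed
  define v where "v x = w x div int g" for x
  have wv: "w x = v x * int g" if "x \<noteq> 0" for x using dvd[OF that] by (simp add: v_def)
  have v: "discrete_valuation v"
  proof
    fix x y :: 'a
    assume xy: "x \<noteq> 0" "y \<noteq> 0"
    have "v (x * y) * int g = (v x + v y) * int g" using wv w_mult xy by (simp add: distrib_right)
    then show "v (x * y) = v x + v y" using g by simp
    have add: "v y \<le> v (x + y)" if xy: "x \<noteq> 0" "y \<noteq> 0" "x + y \<noteq> 0" "v y \<le> v x" for x y
    proof -
      have e: "w (x / y) = w x - w y" using xy by (simp add: divide_inverse w_mult w_inverse)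
      have "w y \<le> w x" using wv xy by (simp add: mult_right_mono)
      then have "x / y \<in> W" using w_W[of "x / y"] e xy by simp
      then have "x / y + 1 \<in> W" using W_add W_1 by blast
      moreover have eq: "x + y = (x / y + 1) * y" using xy by (simp add: distrib_right)
      moreover have "x / y + 1 \<noteq> 0" using eq xy by auto
      ultimately have "w y \<le> w (x + y)" using w_W w_mult xy by simp
      then show ?thesis using g by (simp add: v_def zdiv_mono1)
    qed
    show "min (v x) (v y) \<le> v (x + y)" if "x + y \<noteq> 0"
      using add[of x y] add[of y x] xy that by (cases "v y \<le> v x") (auto simp: add.commute)
  next
    show "\<exists>x. x \<noteq> 0 \<and> v x = 1" using y g by (auto simp: v_def intro!: exI[of _ y])
  qed
  moreover have "W = discrete_valuation.val_ring v"
  proof (rule Set.set_eqI)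
    fix x
    show "x \<in> W \<longleftrightarrow> x \<in> discrete_valuation.val_ring v"
    proof (cases "x = 0")
      case False
      then show ?thesis
        unfolding discrete_valuation.val_ring_def[OF v] discrete_valuation.vge_def[OF v]
        using w_W[OF False] wv[OF False] g by (simp add: zero_le_mult_iff)
    qed (use W_0 in \<open>simp add: discrete_valuation.val_ring_def[OF v] discrete_valuation.vge_def[OF v]\<close>)
  qed
  ultimately show thesis using that by blast
qed

text \<open>The common core for the integers and for \<open>F[T]\<close>. Every element of
  \<open>K\<close> is a power of \<open>p\<close> times a quotient of elements of
  \<open>A - M\<close>, which gives discreteness; finitely many residues of \<open>A\<close> give a
  finite residue field.\<close>

theorem prescribed_lengths_if_global:
  assumes K: "K = quotients A" and A: "is_subring A" "A \<subseteq> W" and p: "p \<in> M" "p \<noteq> 0"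
    and strip: "\<And>a. a \<in> A \<Longrightarrow> a \<noteq> 0 \<Longrightarrow> \<exists>k b. b \<in> A - M \<and> a = p ^ k * b"
    and S: "finite S" "\<And>a. a \<in> A \<Longrightarrow> \<exists>s\<in>S. a - s \<in> M"
    and t: "prime_localization A t" "prime_localization A t'" "t \<notin> (*) t' ` A"
  shows "prescribed_lengths W"
proof -
  have quot: "\<exists>k l a b. a \<in> A - M \<and> b \<in> A - M \<and> x = (p ^ k * a) / (p ^ l * b)"
    if x: "x \<in> K" "x \<noteq> 0" for x
  proof -
    obtain a b where ab: "x = a / b" "a \<in> A" "b \<in> A" "b \<noteq> 0" using x unfolding K quotients_def by blast
    then obtain k a' where "a' \<in> A - M" "a = p ^ k * a'" using strip[of a] x by auto
    moreover obtain l b' where "b' \<in> A - M" "b = p ^ l * b'" using strip[of b] ab by blast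
    ultimately show ?thesis using ab(1) by blast
  qed
  have AW: "a \<in> W - M" if "a \<in> A - M" for a using that A by auto
  have unit_div: "a / b \<in> W - M" if "a \<in> A - M" "b \<in> A - M" for a b
    using unit_mult[OF AW unit_inverse[OF AW]] that by (simp add: divide_inverse)
  obtain v where v: "discrete_valuation v" "W = discrete_valuation.val_ring v"
  proof (rule discrete_if_powers[OF p])
    fix x assume "x \<in> K" "x \<noteq> 0"
    then obtain k l a b where x: "a \<in> A - M" "b \<in> A - M" "x = (p ^ k * a) / (p ^ l * b)" using quot by blast
    have "p powi (int k - int l) = p ^ k / p ^ l" using p(2) by (simp add: power_int_diff)
    then have "x = p powi (int k - int l) * (a / b)" by (simp add: x)
    then show "\<exists>k u. u \<in> W - M \<and> x = p powi k * u" using unit_div x by blast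
  qed blast
  have "\<exists>s\<in>S. x - s \<in> M" if x: "x \<in> W \<inter> K" for x
  proof (cases "x \<in> M")
    case True
    obtain s where s: "s \<in> S" "0 - s \<in> M" using S(2) subring_0[OF A(1)] by blast
    then have "x + (0 - s) \<in> M" using True M_add by blast
    then show ?thesis using s by auto
  next
    case False
    then have x0: "x \<noteq> 0" using M_0 by auto
    obtain k l a b where ab: "a \<in> A - M" "b \<in> A - M" "x = (p ^ k * a) / (p ^ l * b)" using quot x x0 by blast
    have nz: "a \<noteq> 0" "b \<noteq> 0" using ab M_0 by auto
    have "int k = int l"
    proof (rule powi_unit_cancel[OF p AW[OF ab(1)] unit_mult[OF _ AW[OF ab(2)]]])
      show "x \<in> W - M" using x False by blast
      show "p powi int k * a = p powi int l * (x * b)" using p(2) nz by (simp add: ab(3))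
    qed
    then have xab: "x = a / b" using ab(3) p(2) by simp
    \<comment> \<open>Since \<open>b ^ m\<close> is 1 modulo \<open>M\<close>, the inverse of
      \<open>b\<close> is congruent to \<open>b ^ (m - 1)\<close>: every unit of
      \<open>W \<inter> K\<close> is congruent to an element of \<open>A\<close>.\<close>
    define m where "m = (fact (card S) :: nat)"
    have m: "m = Suc (m - 1)" by (simp add: m_def)
    have "b ^ m - 1 \<in> M" unfolding m_def
      using ab A by (intro unit_power_cong_1 AW S subring_power) auto
    then have "x * (b ^ m - 1) \<in> M" using x M_mult by blast
    moreover have "x * b ^ m = a * b ^ (m - 1)" by (subst m) (simp add: xab nz)
    ultimately have 1: "a * b ^ (m - 1) - x \<in> M" by (simp add: right_diff_distrib)
    have "a * b ^ (m - 1) \<in> A" using ab A by (auto simp: subring_mult subring_power)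
    then obtain s where s: "s \<in> S" "a * b ^ (m - 1) - s \<in> M" using S(2) by blast
    then have "(a * b ^ (m - 1) - s) - (a * b ^ (m - 1) - x) \<in> M" using 1 M_diff by blast
    then show ?thesis using s by auto
  qed
  then have "\<exists>S'. finite S' \<and> (\<forall>x\<in>W. \<exists>s\<in>S'. x - s \<in> M)"
    by (rule finite_residues_from_subfield[OF S(1)])
  then obtain S' where S': "finite S'" "\<And>x. x \<in> W \<Longrightarrow> \<exists>s\<in>S'. x - s \<in> M" by blast
  show ?thesis
    using prescribed_lengths_from_two_primes[OF v S'(1) _ _ t] S'(2) fin_ext K by blast
qed

end

section \<open>Rational function fields\<close>

definition adjoin :: "'a::field set \<Rightarrow> 'a \<Rightarrow> 'a set" where
  "adjoin R T = {poly p T | p. p \<in> polys_over R}"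

definition transcendental_over :: "'a::field set \<Rightarrow> 'a \<Rightarrow> bool" where
  "transcendental_over R T \<longleftrightarrow> is_subring R \<and> (\<forall>p\<in>polys_over R. poly p T = 0 \<longrightarrow> p = 0)"

lemma adjoin_subset: "is_subring X \<Longrightarrow> R \<subseteq> X \<Longrightarrow> T \<in> X \<Longrightarrow> adjoin R T \<subseteq> X"
  unfolding adjoin_def polys_over_def
  by (auto simp: poly_altdef intro!: subring_sum subring_mult subring_power)

lemma subring_adjoin: "is_subring R \<Longrightarrow> is_subring (adjoin R T)"
  unfolding adjoin_def by (rule subring_adjoin_element)

lemma mem_adjoin:
  assumes R: "is_subring R"
  shows "T \<in> adjoin R T" "a \<in> R \<Longrightarrow> a \<in> adjoin R T"
proof -
  have "poly (monom 1 1) T \<in> adjoin R T"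
    unfolding adjoin_def using polys_over_monom[OF R subring_1[OF R]] by blast
  then show "T \<in> adjoin R T" by (simp add: poly_monom)
  show "a \<in> adjoin R T" if "a \<in> R"
  proof -
    have "poly [:a:] T \<in> adjoin R T" unfolding adjoin_def using polys_over_const[OF R that] by blast
    then show ?thesis by simp
  qed
qed

lemma transcendental_poly_eq:
  assumes "transcendental_over R T" "p \<in> polys_over R" "q \<in> polys_over R" "poly p T = poly q T"
  shows "p = q"
  using assms polys_over_diff[of R p q] unfolding transcendental_over_def by (metis eq_iff_diff_eq_0 poly_diff)

lemma pCons_polys_over_iff: "pCons a p \<in> polys_over R \<longleftrightarrow> a \<in> R \<and> p \<in> polys_over R"
proof
  assume H: "pCons a p \<in> polys_over R"
  then have "coeff (pCons a p) 0 \<in> R" "coeff (pCons a p) (Suc i) \<in> R" for i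
    unfolding polys_over_def by blast+
  then show "a \<in> R \<and> p \<in> polys_over R" by (simp add: polys_over_def)
qed (auto simp: polys_over_def coeff_pCons split: nat.split)

lemma multiple_of_transcendental_iff:
  assumes T: "transcendental_over R T" and p: "p \<in> polys_over R"
  shows "poly p T \<in> (*) T ` adjoin R T \<longleftrightarrow> coeff p 0 = 0"
proof
  have R: "is_subring R" using T by (simp add: transcendental_over_def)
  assume "poly p T \<in> (*) T ` adjoin R T"
  then obtain q where q: "q \<in> polys_over R" "poly p T = T * poly q T" unfolding adjoin_def by blast
  then have "pCons 0 q \<in> polys_over R" "poly p T = poly (pCons 0 q) T"
    using subring_0[OF R] by (auto simp: pCons_polys_over_iff)
  then have "p = pCons 0 q" using transcendental_poly_eq[OF T p] by blast
  then show "coeff p 0 = 0" by simp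
next
  assume 0: "coeff p 0 = 0"
  obtain a q where "p = pCons a q" by (cases p)
  then have "poly p T = T * poly q T" "q \<in> polys_over R" using 0 p by (auto simp: pCons_polys_over_iff)
  then show "poly p T \<in> (*) T ` adjoin R T" unfolding adjoin_def by blast
qed

text \<open>By transcendence \<open>adjoin R T\<close> is a polynomial ring over the domain
  \<open>R\<close>, where divisibility by the variable is read off from the constant term.\<close>

lemma prime_localization_adjoin:
  assumes T: "transcendental_over R T"
  shows "prime_localization (adjoin R T) T"
proof
  have R: "is_subring R" using T by (simp add: transcendental_over_def)
  note mult = multiple_of_transcendental_iff[OF T]
  show "is_subring (adjoin R T)" "T \<in> adjoin R T" by (rule subring_adjoin[OF R], rule mem_adjoin[OF R])
  have "monom 1 1 \<in> polys_over R" by (intro polys_over_monom R subring_1)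
  then show "T \<noteq> 0" using T by (auto simp: transcendental_over_def poly_monom)
  show "1 \<notin> (*) T ` adjoin R T" using mult[OF polys_over_1[OF R]] by simp
  show "a \<in> (*) T ` adjoin R T \<or> b \<in> (*) T ` adjoin R T"
    if ab: "a \<in> adjoin R T" "b \<in> adjoin R T" "a * b \<in> (*) T ` adjoin R T" for a b
  proof -
    obtain p q where pq: "p \<in> polys_over R" "q \<in> polys_over R" "a = poly p T" "b = poly q T"
      using ab unfolding adjoin_def by blast
    then have "coeff (p * q) 0 = 0" using mult[OF polys_over_mult[OF R pq(1,2)]] ab(3) by simp
    then have "coeff p 0 = 0 \<or> coeff q 0 = 0" by (simp add: coeff_mult)
    then show ?thesis using mult pq by blast
  qed
  show "\<exists>k b. b \<in> adjoin R T \<and> b \<notin> (*) T ` adjoin R T \<and> a = T ^ k * b"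
    if a: "a \<in> adjoin R T" "a \<noteq> 0" for a
  proof -
    have "\<exists>k b. b \<in> adjoin R T \<and> b \<notin> (*) T ` adjoin R T \<and> poly p T = T ^ k * b"
      if "p \<in> polys_over R" "p \<noteq> 0" for p
      using that
    proof (induction p)
      case (pCons a p)
      show ?case
      proof (cases "a = 0")
        case True
        then have "p \<in> polys_over R" "p \<noteq> 0" using pCons.prems by (auto simp: pCons_polys_over_iff)
        then obtain k b where "b \<in> adjoin R T" "b \<notin> (*) T ` adjoin R T" "poly p T = T ^ k * b"
          using pCons.IH by blast
        then show ?thesis using True by (intro exI[of _ "Suc k"] exI[of _ b]) simp
      next
        case False
        then have "poly (pCons a p) T \<notin> (*) T ` adjoin R T" using mult[OF pCons.prems(1)] by simp
        moreover have "poly (pCons a p) T \<in> adjoin R T" unfolding adjoin_def using pCons.prems by blast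
        ultimately show ?thesis by (intro exI[of _ 0] exI[of _ "poly (pCons a p) T"]) simp
      qed
    qed simp
    moreover obtain p where "p \<in> polys_over R" "a = poly p T" using a(1) unfolding adjoin_def by blast
    moreover from this have "p \<noteq> 0" using a(2) by auto
    ultimately show ?thesis by blast
  qed
qed

lemma pcompose_polys_over:
  assumes R: "is_subring R" and q: "q \<in> polys_over R"
  shows "p \<in> polys_over R \<Longrightarrow> pcompose p q \<in> polys_over R"
proof (induction p)
  case (pCons a p)
  then show ?case
    by (auto simp: pcompose_pCons pCons_polys_over_iff intro!: polys_over_add polys_over_mult polys_over_const R q)
qed (simp add: polys_over_0[OF R])

text \<open>\<open>T - 1\<close> is the second prime. The substitution of \<open>T - 1\<close> for
  the variable is invertible, and \<open>T = 1 + (T - 1)\<close> has constant term 1 with respect to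
  it.\<close>

lemma transcendental_minus_one:
  assumes T: "transcendental_over R T"
  shows "transcendental_over R (T - 1)" "adjoin R (T - 1) = adjoin R T" "T \<notin> (*) (T - 1) ` adjoin R T"
proof -
  have R: "is_subring R" using T by (simp add: transcendental_over_def)
  have lin: "[:-1, 1:] \<in> polys_over R" "[:1, 1:] \<in> polys_over R"
    using subring_0[OF R] subring_1[OF R] subring_minus[OF R] by (auto simp: pCons_polys_over_iff polys_over_0[OF R])
  show T1: "transcendental_over R (T - 1)"
    unfolding transcendental_over_def
  proof (intro conjI ballI impI R)
    fix p assume p: "p \<in> polys_over R" "poly p (T - 1) = 0"
    then have "poly (pcompose p [:-1, 1:]) T = 0" by (simp add: poly_pcompose)
    then have "pcompose p [:-1, 1:] = 0"
      using T pcompose_polys_over[OF R lin(1) p(1)] by (simp add: transcendental_over_def)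
    then show "p = 0" using pcompose_eq_0[of p "[:-1, 1:]"] by simp
  qed
  have T_in: "T - 1 \<in> adjoin R T" "T \<in> adjoin R (T - 1)"
  proof -
    have "poly [:-1, 1:] T \<in> adjoin R T" "poly [:1, 1:] (T - 1) \<in> adjoin R (T - 1)"
      unfolding adjoin_def using lin by blast+
    then show "T - 1 \<in> adjoin R T" "T \<in> adjoin R (T - 1)" by simp_all
  qed
  show eq: "adjoin R (T - 1) = adjoin R T"
    using T_in mem_adjoin(2)[OF R] subring_adjoin[OF R] by (intro equalityI adjoin_subset subsetI) auto
  have "poly [:1, 1:] (T - 1) \<notin> (*) (T - 1) ` adjoin R (T - 1)"
    using multiple_of_transcendental_iff[OF T1 lin(2)] by simp
  then show "T \<notin> (*) (T - 1) ` adjoin R T" by (simp add: eq)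
qed

lemma subfield_field_adjoin: "is_subfield (field_adjoin k B)"
  unfolding field_adjoin_def is_subfield_def is_subring_def by blast

lemma field_adjoin_least: "is_subfield X \<Longrightarrow> k \<subseteq> X \<Longrightarrow> B \<subseteq> X \<Longrightarrow> field_adjoin k B \<subseteq> X"
  unfolding field_adjoin_def by blast

lemma field_adjoin_contains:
  fixes k :: "'a::field set"
  shows "k \<subseteq> field_adjoin k B" "B \<subseteq> field_adjoin k B"
  unfolding field_adjoin_def by blast+

lemma quotients_least: "is_subfield X \<Longrightarrow> A \<subseteq> X \<Longrightarrow> quotients A \<subseteq> X"
  unfolding quotients_def using subfield_divide by blast

section \<open>Polynomials in several variables\<close>

definition monomial_value :: "('a::field \<Rightarrow>\<^sub>0 nat) \<Rightarrow> 'a" where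
  "monomial_value m = (\<Prod>b \<in> Poly_Mapping.keys m. b ^ Poly_Mapping.lookup m b)"

lemma monomial_value_superset:
  assumes "finite S" "Poly_Mapping.keys m \<subseteq> S"
  shows "monomial_value m = (\<Prod>b\<in>S. b ^ Poly_Mapping.lookup m b)"
  unfolding monomial_value_def
  by (rule prod.mono_neutral_left) (use assms in \<open>auto simp: in_keys_iff\<close>)

lemma monomial_value_add: "monomial_value (m + n) = monomial_value m * monomial_value n"
proof -
  define S where "S = Poly_Mapping.keys m \<union> Poly_Mapping.keys n"
  have S: "finite S" "Poly_Mapping.keys m \<subseteq> S" "Poly_Mapping.keys n \<subseteq> S" "Poly_Mapping.keys (m + n) \<subseteq> S"
    using Poly_Mapping.keys_add[of m n] by (auto simp: S_def)
  show ?thesis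
    unfolding monomial_value_superset[OF S(1,2)] monomial_value_superset[OF S(1,3)] monomial_value_superset[OF S(1,4)]
    by (simp add: lookup_add power_add prod.distrib)
qed

lemma monomial_value_single: "monomial_value (Poly_Mapping.single b i) = b ^ i"
  by (simp add: monomial_value_def)

lemma mpoly_value_superset:
  assumes "finite S" "Poly_Mapping.keys p \<subseteq> S"
  shows "mpoly_value p = (\<Sum>m\<in>S. Poly_Mapping.lookup p m * monomial_value m)"
  unfolding mpoly_value_def monomial_value_def[symmetric]
  by (rule sum.mono_neutral_left) (use assms in \<open>auto simp: in_keys_iff\<close>)

lemma mpoly_value_add: "mpoly_value (p + q) = mpoly_value p + mpoly_value q"
proof -
  define S where "S = Poly_Mapping.keys p \<union> Poly_Mapping.keys q"
  have S: "finite S" "Poly_Mapping.keys p \<subseteq> S" "Poly_Mapping.keys q \<subseteq> S" "Poly_Mapping.keys (p + q) \<subseteq> S"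
    using Poly_Mapping.keys_add[of p q] by (auto simp: S_def)
  show ?thesis
    unfolding mpoly_value_superset[OF S(1,2)] mpoly_value_superset[OF S(1,3)] mpoly_value_superset[OF S(1,4)]
    by (simp add: lookup_add distrib_right sum.distrib)
qed

lemma mpoly_value_0: "mpoly_value 0 = 0"
  by (simp add: mpoly_value_def)

lemma mpoly_value_sum: "mpoly_value (\<Sum>i\<in>I. f i) = (\<Sum>i\<in>I. mpoly_value (f i))"
  by (induction I rule: infinite_finite_induct) (auto simp: mpoly_value_0 mpoly_value_add)

lemma mpoly_value_single: "mpoly_value (Poly_Mapping.single m c) = c * monomial_value m"
  by (cases "c = 0") (simp_all add: mpoly_value_def monomial_value_def)

context
  fixes F :: "'a::field set" and B :: "'a set"
  assumes F: "is_subfield F"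
begin

lemma mpoly_over_lookup: "p \<in> mpoly_over F B \<Longrightarrow> Poly_Mapping.lookup p m \<in> F"
  using subring_0[OF subfield_subring[OF F]] unfolding mpoly_over_def
  by (cases "m \<in> Poly_Mapping.keys p") (auto simp: in_keys_iff)

lemma mpoly_over_0: "0 \<in> mpoly_over F B"
  by (simp add: mpoly_over_def)

lemma mpoly_over_add:
  assumes "p \<in> mpoly_over F B" "q \<in> mpoly_over F B"
  shows "p + q \<in> mpoly_over F B"
proof -
  have "Poly_Mapping.lookup (p + q) m \<in> F" for m
    using mpoly_over_lookup assms subring_add[OF subfield_subring[OF F]] by (simp add: lookup_add)
  then show ?thesis using assms Poly_Mapping.keys_add[of p q] unfolding mpoly_over_def by blast
qed

lemma mpoly_over_sum: "(\<And>i. i \<in> I \<Longrightarrow> f i \<in> mpoly_over F B) \<Longrightarrow> (\<Sum>i\<in>I. f i) \<in> mpoly_over F B"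
  by (induction I rule: infinite_finite_induct) (auto intro: mpoly_over_0 mpoly_over_add)

lemma mpoly_over_single:
  "c \<in> F \<Longrightarrow> Poly_Mapping.keys m \<subseteq> B \<Longrightarrow> Poly_Mapping.single m c \<in> mpoly_over F B"
  by (cases "c = 0") (auto simp: mpoly_over_def)

lemma subring_mpoly_values: "is_subring (mpoly_value ` mpoly_over F B)"
proof -
  let ?V = "mpoly_value ` mpoly_over F B"
  note Fr = subfield_subring[OF F]
  have term_in: "c * monomial_value m \<in> ?V" if "c \<in> F" "Poly_Mapping.keys m \<subseteq> B" for c m
    using mpoly_over_single[OF that] by (metis image_eqI mpoly_value_single)
  have add: "x + y \<in> ?V" if "x \<in> ?V" "y \<in> ?V" for x y
    using that mpoly_over_add by (auto simp: mpoly_value_add[symmetric])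
  have sum_in: "(\<Sum>i\<in>I. f i) \<in> ?V" if "\<And>i. i \<in> I \<Longrightarrow> f i \<in> ?V" for I :: "'i set" and f
    using that mpoly_over_0 add
    by (induction I rule: infinite_finite_induct) (auto simp: mpoly_value_0 intro: image_eqI[of _ _ 0])
  have mult: "x * y \<in> ?V" if xy: "x \<in> ?V" "y \<in> ?V" for x y
  proof -
    obtain p q where pq: "p \<in> mpoly_over F B" "q \<in> mpoly_over F B" "x = mpoly_value p" "y = mpoly_value q"
      using xy by blast
    have "x * y = (\<Sum>m\<in>Poly_Mapping.keys p. \<Sum>n\<in>Poly_Mapping.keys q.
        (Poly_Mapping.lookup p m * Poly_Mapping.lookup q n) * monomial_value (m + n))"
      unfolding pq mpoly_value_def monomial_value_def[symmetric] sum_product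
      by (simp add: monomial_value_add ac_simps)
    also have "\<dots> \<in> ?V"
    proof (intro sum_in term_in subring_mult[OF Fr] mpoly_over_lookup pq)
      fix m n assume "m \<in> Poly_Mapping.keys p" "n \<in> Poly_Mapping.keys q"
      then show "Poly_Mapping.keys (m + n) \<subseteq> B"
        using pq Poly_Mapping.keys_add[of m n] unfolding mpoly_over_def by blast
    qed
    finally show ?thesis .
  qed
  have const: "c \<in> ?V" if "c \<in> F" for c using term_in[OF that, of 0] by (simp add: monomial_value_def)
  have "x - y \<in> ?V" if "x \<in> ?V" "y \<in> ?V" for x y
  proof -
    have "-1 * y \<in> ?V" using subring_minus[OF Fr subring_1[OF Fr]] that(2) by (rule mult[OF const])
    then have "x + -1 * y \<in> ?V" by (rule add[OF that(1)])
    then show ?thesis by simp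
  qed
  then show ?thesis unfolding is_subring_def using mult const[OF subring_1[OF Fr]] by blast
qed

lemma subset_mpoly_values: "F \<subseteq> mpoly_value ` mpoly_over F B" "B \<subseteq> mpoly_value ` mpoly_over F B"
proof -
  have "c = mpoly_value (Poly_Mapping.single 0 c)" for c :: 'a
    by (simp add: mpoly_value_single monomial_value_def)
  then show "F \<subseteq> mpoly_value ` mpoly_over F B" using mpoly_over_single[of _ 0] by fastforce
  have b: "b = mpoly_value (Poly_Mapping.single (Poly_Mapping.single b 1) 1)" for b :: 'a
    by (simp add: mpoly_value_single monomial_value_single)
  have "Poly_Mapping.single (Poly_Mapping.single b 1) 1 \<in> mpoly_over F B" if "b \<in> B" for b
    using that subring_1[OF subfield_subring[OF F]] by (intro mpoly_over_single) auto
  then show "B \<subseteq> mpoly_value ` mpoly_over F B" using b by fast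
qed

lemma mpoly_values_least:
  assumes X: "is_subring X" "F \<subseteq> X" "B \<subseteq> X"
  shows "mpoly_value ` mpoly_over F B \<subseteq> X"
proof
  fix x assume "x \<in> mpoly_value ` mpoly_over F B"
  then obtain p where p: "p \<in> mpoly_over F B" "x = mpoly_value p" by blast
  have prod: "(\<Prod>b\<in>I. g b) \<in> X" if "\<And>b. b \<in> I \<Longrightarrow> g b \<in> X" for I :: "'a set" and g
    using that by (induction I rule: infinite_finite_induct) (auto intro: subring_1 subring_mult X)
  show "x \<in> X" unfolding p mpoly_value_def
  proof (intro subring_sum subring_mult prod subring_power X)
    fix m assume m: "m \<in> Poly_Mapping.keys p"
    then show "Poly_Mapping.lookup p m \<in> X" using p X unfolding mpoly_over_def by blast
    show "b \<in> X" if "b \<in> Poly_Mapping.keys m" for b using m that p X unfolding mpoly_over_def by blast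
  qed
qed

end

text \<open>Polynomials in the variable \<open>T\<close> over the polynomials in the remaining variables are
  polynomials in all variables.\<close>

lemma transcendental_over_mpoly_values:
  assumes F: "is_subfield F" and indep: "alg_independent F B" and T: "T \<in> B"
  shows "transcendental_over (mpoly_value ` mpoly_over F (B - {T})) T"
  unfolding transcendental_over_def
proof (intro conjI ballI impI)
  let ?R = "mpoly_value ` mpoly_over F (B - {T})"
  show "is_subring ?R" by (rule subring_mpoly_values[OF F])
  fix p assume p: "p \<in> polys_over ?R" "poly p T = 0"
  have "\<forall>i. \<exists>P. P \<in> mpoly_over F (B - {T}) \<and> coeff p i = mpoly_value P"
    using p(1) unfolding polys_over_def by blast
  then obtain P where P: "\<And>i. P i \<in> mpoly_over F (B - {T}) \<and> coeff p i = mpoly_value (P i)" by metis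
  define sh where "sh m i = m + Poly_Mapping.single T i" for m and i :: nat
  \<comment> \<open>The single polynomial in all variables that corresponds to \<open>p\<close>. No
    monomial of any \<open>P i\<close> involves \<open>T\<close>, so shifting by powers of
    \<open>T\<close> merges no two monomials.\<close>
  define Q where "Q = (\<Sum>i\<le>degree p. \<Sum>m\<in>Poly_Mapping.keys (P i).
      Poly_Mapping.single (sh m i) (Poly_Mapping.lookup (P i) m))"
  have keysP: "Poly_Mapping.keys m \<subseteq> B - {T}" if "m \<in> Poly_Mapping.keys (P i)" for m i
    using that P unfolding mpoly_over_def by blast
  have "Poly_Mapping.keys (sh m i) \<subseteq> B" if "m \<in> Poly_Mapping.keys (P i)" for m i
    using keysP[OF that] T Poly_Mapping.keys_add[of m "Poly_Mapping.single T i"] unfolding sh_def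
    by (auto split: if_splits)
  then have "Q \<in> mpoly_over F B"
    unfolding Q_def using P mpoly_over_lookup[OF F]
    by (intro mpoly_over_sum mpoly_over_single F) blast+
  moreover have "mpoly_value Q = 0"
  proof -
    have "mpoly_value Q = (\<Sum>i\<le>degree p. \<Sum>m\<in>Poly_Mapping.keys (P i).
        Poly_Mapping.lookup (P i) m * monomial_value m * T ^ i)"
      unfolding Q_def mpoly_value_sum mpoly_value_single sh_def monomial_value_add monomial_value_single
      by (simp add: mult.assoc)
    also have "\<dots> = (\<Sum>i\<le>degree p. mpoly_value (P i) * T ^ i)"
      by (simp add: mpoly_value_def monomial_value_def sum_distrib_right)
    also have "\<dots> = poly p T" using P by (simp add: poly_altdef)
    finally show ?thesis using p(2) by simp
  qed
  ultimately have Q0: "Q = 0" using indep unfolding alg_independent_def by blast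
  have sh_inj: "i = j \<and> m = m'" if m: "m \<in> Poly_Mapping.keys (P i)" "m' \<in> Poly_Mapping.keys (P j)"
    and eq: "sh m i = sh m' j" for m m' i j
  proof -
    have "Poly_Mapping.lookup m T = 0" "Poly_Mapping.lookup m' T = 0"
      using keysP[OF m(1)] keysP[OF m(2)] by (auto simp: in_keys_iff)
    moreover have "Poly_Mapping.lookup (sh m i) T = Poly_Mapping.lookup (sh m' j) T" using eq by simp
    ultimately have "i = j" by (simp add: sh_def lookup_add)
    then show ?thesis using eq by (simp add: sh_def)
  qed
  have "coeff p i = 0" if i: "i \<le> degree p" for i
  proof -
    have "Poly_Mapping.lookup (P i) m = 0" for m
    proof (rule ccontr)
      assume "Poly_Mapping.lookup (P i) m \<noteq> 0"
      then have m: "m \<in> Poly_Mapping.keys (P i)" by (simp add: in_keys_iff)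
      have "Poly_Mapping.lookup Q (sh m i) = (\<Sum>j\<le>degree p. \<Sum>m'\<in>Poly_Mapping.keys (P j).
          if j = i \<and> m' = m then Poly_Mapping.lookup (P i) m else 0)"
        unfolding Q_def lookup_sum lookup_single
        by (intro sum.cong refl) (use sh_inj m in \<open>auto simp: when_def\<close>)
      also have "\<dots> = (\<Sum>j\<le>degree p. if j = i then Poly_Mapping.lookup (P i) m else 0)"
        by (intro sum.cong refl) (use m in \<open>auto simp: sum.delta\<close>)
      also have "\<dots> = Poly_Mapping.lookup (P i) m" using i by simp
      finally show False using Q0 \<open>Poly_Mapping.lookup (P i) m \<noteq> 0\<close> by simp
    qed
    then have "P i = 0" by (intro poly_mapping_eqI) simp
    then show ?thesis using P[of i] by (simp add: mpoly_value_0)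
  qed
  then show "p = 0" by (metis leading_coeff_0_iff order_refl)
qed

text \<open>One variable is singled out and the others are absorbed into the coefficient ring, which
  turns any number of variables into a polynomial ring in one.\<close>

lemma purely_transcendental_eq_quotients:
  assumes "purely_transcendental F B L" "T \<in> B"
  defines "R \<equiv> mpoly_value ` mpoly_over F (B - {T})"
  shows "transcendental_over R T" "L = quotients (adjoin R T)"
proof -
  have F: "is_subfield F" and B: "alg_independent F B" and L: "L = field_adjoin F B"
    using assms(1) by (auto simp: purely_transcendental_def)
  show "transcendental_over R T" unfolding R_def by (rule transcendental_over_mpoly_values[OF F B assms(2)])
  have R: "is_subring R" unfolding R_def by (rule subring_mpoly_values[OF F])
  note RA = mem_adjoin[OF R]
  have sub: "F \<subseteq> R" "B - {T} \<subseteq> R" unfolding R_def by (rule subset_mpoly_values[OF F])+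
  show "L = quotients (adjoin R T)"
  proof
    have "F \<union> B \<subseteq> adjoin R T" using RA sub by blast
    then show "L \<subseteq> quotients (adjoin R T)"
      unfolding L using subset_quotients[OF subring_adjoin[OF R, of T]]
      by (intro field_adjoin_least subfield_quotients subring_adjoin R) auto
    have "R \<subseteq> L" unfolding R_def L
      using field_adjoin_contains[where k = F and B = B] by (intro mpoly_values_least F subfield_subring subfield_field_adjoin) auto
    then show "quotients (adjoin R T) \<subseteq> L"
      using field_adjoin_contains(2)[where k = F and B = B] assms(2) unfolding L
      by (intro quotients_least adjoin_subset subfield_subring subfield_field_adjoin) auto
  qed
qed

section \<open>Global fields\<close>

text \<open>Long division in which quotient and remainder keep their coefficients in the subfield
  \<open>F\<close>.\<close>

lemma polys_over_division:
  assumes F: "is_subfield F" and r: "r \<in> polys_over F" "r \<noteq> 0"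
  shows "a \<in> polys_over F \<Longrightarrow> \<exists>q c. q \<in> polys_over F \<and> c \<in> polys_over F \<and> a = r * q + c \<and>
           (c = 0 \<or> degree c < degree r)"
proof (induction "degree a" arbitrary: a rule: less_induct)
  case less
  note Fr = subfield_subring[OF F]
  show ?case
  proof (cases "a = 0 \<or> degree a < degree r")
    case True
    then show ?thesis using less.prems polys_over_0[OF Fr] by (intro exI[of _ 0] exI[of _ a]) auto
  next
    case False
    define s where "s = monom (lead_coeff a / lead_coeff r) (degree a - degree r)"
    have s: "s \<in> polys_over F" unfolding s_def
      using less.prems r by (intro polys_over_monom Fr subfield_divide F) (auto simp: polys_over_def)
    have a0: "a \<noteq> 0" "degree r \<le> degree a" using False by auto
    have s0: "s \<noteq> 0" "degree s = degree a - degree r" using a0 r by (auto simp: s_def degree_monom_eq)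
    have deg: "degree (r * s) = degree a" using a0 s0 r by (simp add: degree_mult_eq)
    have lc: "lead_coeff (r * s) = lead_coeff a"
      unfolding lead_coeff_mult using r s0 by (simp add: s_def lead_coeff_monom)
    define b where "b = a - r * s"
    have b: "b \<in> polys_over F" unfolding b_def by (intro polys_over_diff polys_over_mult Fr s r less.prems)
    have "b = 0 \<or> degree b < degree a"
    proof (cases "degree a = 0")
      case True
      then have "degree b = 0" unfolding b_def using deg by (metis degree_diff_le le_zero_eq)
      moreover have "coeff b 0 = 0" using lc deg True by (simp add: b_def)
      ultimately show ?thesis by (metis leading_coeff_0_iff)
    next
      case False
      have "degree b < degree a"
      proof (rule degree_lessI)
        show "\<forall>k\<ge>degree a. coeff b k = 0"
        proof (intro allI impI)
          fix k assume "degree a \<le> k"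
          then show "coeff b k = 0"
            using lc deg by (cases "k = degree a") (simp_all add: b_def coeff_eq_0)
        qed
      qed (use False in simp)
      then show ?thesis ..
    qed
    then obtain q c where "q \<in> polys_over F" "c \<in> polys_over F" "b = r * q + c" "c = 0 \<or> degree c < degree r"
    proof
      assume "b = 0"
      then show thesis using that[of 0 0] polys_over_0[OF Fr] by simp
    next
      assume "degree b < degree a"
      then show thesis using less.hyps[OF _ b] that by blast
    qed
    then show ?thesis using s polys_over_add[OF Fr]
      by (intro exI[of _ "q + s"] exI[of _ c]) (auto simp: b_def algebra_simps)
  qed
qed

text \<open>Reversing coefficients turns a relation for the inverse of \<open>T\<close> into one for
  \<open>T\<close>. This allows the generator to be chosen inside the given valuation ring.\<close>

lemma adjoin_inverse:
  assumes F: "is_subfield F" and T: "transcendental_over F T"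
  shows "transcendental_over F (inverse T)" "quotients (adjoin F (inverse T)) = quotients (adjoin F T)"
proof -
  note Fr = subfield_subring[OF F]
  have T0: "T \<noteq> 0" using prime_localization.t[OF prime_localization_adjoin[OF T]] by blast
  show "transcendental_over F (inverse T)"
    unfolding transcendental_over_def
  proof (intro conjI ballI impI Fr)
    fix p assume p: "p \<in> polys_over F" "poly p (inverse T) = 0"
    have "poly (reflect_poly p) T = 0" using T0 p(2) by (simp add: poly_reflect_poly_nz)
    moreover have "reflect_poly p \<in> polys_over F"
      using p(1) subring_0[OF Fr] by (simp add: polys_over_def coeff_reflect_poly)
    ultimately have "reflect_poly p = 0" using T unfolding transcendental_over_def by blast
    then show "p = 0" by simp
  qed
  have sub: "quotients (adjoin F (inverse y)) \<subseteq> quotients (adjoin F y)" for y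
  proof -
    have "y \<in> quotients (adjoin F y)" "F \<subseteq> quotients (adjoin F y)"
      using mem_adjoin[OF Fr] subset_quotients[OF subring_adjoin[OF Fr, of y]] by blast+
    then show ?thesis
      by (intro quotients_least adjoin_subset subfield_subring subfield_quotients subring_adjoin Fr subfield_inverse)
  qed
  show "quotients (adjoin F (inverse T)) = quotients (adjoin F T)"
    using sub[of T] sub[of "inverse T"] by simp
qed

section \<open>Function fields over a finite field\<close>

context valuation_ring_UNIV
begin

text \<open>Non-zero elements of a finite field are roots of unity.\<close>

lemma finite_subfield_subset:
  assumes F: "is_subfield F" "finite F"
  shows "F \<subseteq> W"
proof
  fix x assume x: "x \<in> F"
  show "x \<in> W"
  proof (cases "x = 0")
    case False
    have "range (\<lambda>n::nat. x ^ n) \<subseteq> F" using subring_power[OF subfield_subring[OF F(1)] x] by auto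
    then have "\<not> inj (\<lambda>n::nat. x ^ n)"
      using F(2) finite_subset finite_imageD infinite_UNIV_nat by blast
    then obtain i j where ij: "i < j" "x ^ i = x ^ j"
      unfolding inj_def by (metis linorder_neqE_nat)
    then have "x ^ (j - i) = 1" using False by (simp add: power_diff)
    then show ?thesis using power_in_W[of x "j - i"] ij(1) W_1 by simp
  qed (simp add: W_0)
qed

text \<open>\<open>r\<close> generates the contraction of \<open>M\<close> to \<open>F[T]\<close>,
  being of least degree. The contraction is non-zero, since otherwise \<open>W\<close> would contain
  the rational function field. Remainders modulo \<open>r\<close> represent the residues.\<close>

lemma prescribed_lengths_function_field:
  assumes F: "is_subfield F" "finite F" and T: "transcendental_over F T" "T \<in> W"
    and ext: "finite_extension (quotients (adjoin F T)) (UNIV :: 'a set)" and WU: "W \<noteq> UNIV"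
  shows "prescribed_lengths W"
proof -
  interpret finite_over_subfield W "quotients (adjoin F T)" using ext by unfold_locales
  note Fr = subfield_subring[OF F(1)]
  have FW: "F \<subseteq> W" by (rule finite_subfield_subset[OF F])
  have AW: "adjoin F T \<subseteq> W" by (rule adjoin_subset[OF W FW T(2)])
  have polyW: "poly a T \<in> W" if "a \<in> polys_over F" for a using that AW unfolding adjoin_def by blast
  have "\<exists>a. a \<in> polys_over F \<and> a \<noteq> 0 \<and> poly a T \<in> M"
  proof (rule ccontr)
    assume none: "\<not> ?thesis"
    have "inverse b \<in> W" if "b \<in> adjoin F T" "b \<noteq> 0" for b
    proof -
      obtain a where "a \<in> polys_over F" "b = poly a T" using \<open>b \<in> adjoin F T\<close> unfolding adjoin_def by blast
      then show ?thesis using none that unit_iff polyW by force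
    qed
    then have "quotients (adjoin F T) \<subseteq> W"
      using AW W_mult by (auto simp: quotients_def divide_inverse)
    then show False using subfield_not_subset[OF WU] by blast
  qed
  then obtain r where r: "r \<in> polys_over F" "r \<noteq> 0" "poly r T \<in> M"
    and min: "\<And>a. a \<in> polys_over F \<Longrightarrow> a \<noteq> 0 \<Longrightarrow> poly a T \<in> M \<Longrightarrow> degree r \<le> degree a"
    using ex_has_least_nat[of "\<lambda>a. a \<in> polys_over F \<and> a \<noteq> 0 \<and> poly a T \<in> M" _ degree] by blast
  define p where "p = poly r T"
  have p: "p \<in> M" "p \<noteq> 0" using r T(1) by (auto simp: p_def transcendental_over_def)
  have deg_r: "0 < degree r"
  proof (rule ccontr)
    assume "\<not> 0 < degree r"
    then obtain c where c: "r = [:c:]" by (metis degree_eq_zeroE not_gr_zero)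
    then have "c \<in> F" using r(1) by (simp add: pCons_polys_over_iff)
    then have "inverse c \<in> W" using subfield_inverse[OF F(1)] FW by blast
    then show False using p c by (simp add: p_def nonunits_def)
  qed
  have M_dvd: "\<exists>q. q \<in> polys_over F \<and> a = r * q" if a: "a \<in> polys_over F" "poly a T \<in> M" for a
  proof -
    obtain q c where qc: "q \<in> polys_over F" "c \<in> polys_over F" "a = r * q + c" "c = 0 \<or> degree c < degree r"
      using polys_over_division[OF F(1) r(1,2) a(1)] by blast
    have "poly a T - p * poly q T \<in> M" using a(2) p(1) polyW[OF qc(1)] by (intro M_diff M_mult2)
    then have "poly c T \<in> M" by (simp add: qc(3) p_def)
    then have "c = 0" using min[OF qc(2)] qc(4) by (meson leD)
    then show ?thesis using qc by auto
  qed
  have strip: "\<exists>k b. b \<in> adjoin F T - M \<and> poly a T = p ^ k * b" if "a \<in> polys_over F" "a \<noteq> 0" for a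
    using that
  proof (induction "degree a" arbitrary: a rule: less_induct)
    case less
    show ?case
    proof (cases "poly a T \<in> M")
      case False
      then show ?thesis using less.prems unfolding adjoin_def
        by (intro exI[of _ 0] exI[of _ "poly a T"]) auto
    next
      case True
      obtain q where q: "q \<in> polys_over F" "a = r * q" using M_dvd less.prems True by blast
      then have "q \<noteq> 0" "degree q < degree a" using less.prems deg_r by (auto simp: degree_mult_eq)
      then obtain k b where "b \<in> adjoin F T - M" "poly q T = p ^ k * b" using less.hyps[OF _ q(1)] by blast
      then show ?thesis by (intro exI[of _ "Suc k"] exI[of _ b]) (auto simp: q(2) p_def)
    qed
  qed
  define S where "S = (\<lambda>c. poly c T) ` {c. degree c < degree r \<and> (\<forall>i. coeff c i \<in> F)}"
  show ?thesis
  proof (rule prescribed_lengths_if_global[OF refl subring_adjoin[OF Fr] AW p])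
    fix a assume "a \<in> adjoin F T" "a \<noteq> 0"
    then obtain c where "c \<in> polys_over F" "a = poly c T" unfolding adjoin_def by blast
    moreover from this have "c \<noteq> 0" using \<open>a \<noteq> 0\<close> by auto
    ultimately show "\<exists>k b. b \<in> adjoin F T - M \<and> a = p ^ k * b" using strip by blast
  next
    show "finite S" unfolding S_def by (intro finite_imageI finite_polys_over F)
    fix a assume "a \<in> adjoin F T"
    then obtain a' where a': "a' \<in> polys_over F" "a = poly a' T" unfolding adjoin_def by blast
    obtain q c where qc: "q \<in> polys_over F" "c \<in> polys_over F" "a' = r * q + c" "c = 0 \<or> degree c < degree r"
      using polys_over_division[OF F(1) r(1,2) a'(1)] by blast
    have "a - poly c T = p * poly q T" by (simp add: a' qc p_def)
    also have "\<dots> \<in> M" using p(1) polyW[OF qc(1)] by (rule M_mult2)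
    finally have "a - poly c T \<in> M" .
    moreover have "poly c T \<in> S" unfolding S_def using qc deg_r by (auto simp: polys_over_def)
    ultimately show "\<exists>s\<in>S. a - s \<in> M" by blast
  next
    show "prime_localization (adjoin F T) T" by (rule prime_localization_adjoin[OF T(1)])
    show "prime_localization (adjoin F T) (T - 1)"
      using prime_localization_adjoin[OF transcendental_minus_one(1)[OF T(1)]]
        transcendental_minus_one(2)[OF T(1)] by simp
    show "T \<notin> (*) (T - 1) ` adjoin F T" by (rule transcendental_minus_one(3)[OF T(1)])
  qed
qed

end

section \<open>Number fields\<close>

lemma prime_localization_int:
  assumes inj: "inj (of_int :: int \<Rightarrow> 'a::field)" and q: "prime (q :: int)"
  shows "prime_localization (range (of_int :: int \<Rightarrow> 'a)) (of_int q)"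
proof
  have inj': "of_int a = (of_int b :: 'a) \<longleftrightarrow> a = b" for a b using inj by (auto dest: injD)
  have mult: "of_int a \<in> (*) (of_int q :: 'a) ` range of_int \<longleftrightarrow> q dvd a" for a
    by (auto simp: dvd_def image_iff inj' of_int_mult[symmetric] simp del: of_int_mult)
  have q0: "q \<noteq> 0" using q by auto
  show "is_subring (range (of_int :: int \<Rightarrow> 'a))"
    unfolding is_subring_def
  proof (intro conjI ballI)
    show "(1::'a) \<in> range of_int" by (metis of_int_1 rangeI)
    fix x y :: 'a assume "x \<in> range of_int" "y \<in> range of_int"
    then show "x - y \<in> range of_int" "x * y \<in> range of_int"
      by (metis (mono_tags) of_int_diff rangeE rangeI, metis (mono_tags) of_int_mult rangeE rangeI)
  qed
  show "of_int q \<in> range (of_int :: int \<Rightarrow> 'a)" by simp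
  show "of_int q \<noteq> (0::'a)" using inj'[of q 0] q0 by simp
  show "1 \<notin> (*) (of_int q :: 'a) ` range of_int" using mult[of 1] q not_prime_unit by auto
  show "a \<in> (*) (of_int q) ` range of_int \<or> b \<in> (*) (of_int q) ` range of_int"
    if "a \<in> range of_int" "b \<in> range of_int" "a * b \<in> (*) (of_int q) ` range of_int" for a b :: 'a
  proof -
    obtain m n where mn: "a = of_int m" "b = of_int n" using \<open>a \<in> range of_int\<close> \<open>b \<in> range of_int\<close> by blast
    then have "q dvd m * n" using mult[of "m * n"] that(3) by simp
    then show ?thesis using q mn mult by (auto simp: prime_dvd_mult_iff)
  qed
  show "\<exists>k b. b \<in> range of_int \<and> b \<notin> (*) (of_int q) ` range of_int \<and> a = of_int q ^ k * b"
    if a: "a \<in> range of_int" "a \<noteq> 0" for a :: 'a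
  proof -
    obtain m where m: "a = of_int m" using a by blast
    then have "m \<noteq> 0" using a by auto
    moreover have "\<not> is_unit q" using q not_prime_unit by blast
    ultimately obtain n where "m = q ^ multiplicity q m * n" "\<not> q dvd n"
      using multiplicity_decompose'[of m q] by metis
    then show ?thesis using m mult by (metis of_int_mult of_int_power rangeI)
  qed
qed

text \<open>The least positive integer in \<open>M\<close> generates the contraction of
  \<open>M\<close> to the integers by division with remainder; it exists because \<open>W\<close>
  cannot contain the rationals. The two coprime primes are 2 and 3.\<close>

lemma (in valuation_ring_UNIV) prescribed_lengths_number_field:
  assumes char: "CHAR('a) = 0" and WU: "W \<noteq> UNIV"
    and ext: "finite_extension (quotients (range of_int)) (UNIV :: 'a set)"
  shows "prescribed_lengths W"
proof -
  interpret finite_over_subfield W "quotients (range of_int)" using ext by unfold_locales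
  have of_int_0: "of_int a = (0::'a) \<longleftrightarrow> a = 0" for a
    using of_int_eq_0_iff_char_dvd[where 'a = 'a, of a] char by simp
  then have inj: "inj (of_int :: int \<Rightarrow> 'a)"
    by (intro injI) (metis eq_iff_diff_eq_0 of_int_diff)
  have AW: "range of_int \<subseteq> W" using subring_of_int[OF W] by blast
  have "\<exists>a::int. 0 < a \<and> of_int a \<in> M"
  proof (rule ccontr)
    assume none: "\<not> ?thesis"
    have "inverse b \<in> W" if "b \<in> range of_int" "b \<noteq> 0" for b
    proof -
      obtain a where a: "b = of_int a" using \<open>b \<in> range of_int\<close> by blast
      have "b \<notin> M"
      proof
        assume "b \<in> M"
        then have "of_int \<bar>a\<bar> \<in> M" using a M_minus[of b] by (cases "0 \<le> a") auto
        then show False using none a that by (metis abs_of_nonneg of_int_0 zero_less_abs_iff)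
      qed
      then show ?thesis using unit_iff AW that by blast
    qed
    then have "quotients (range of_int) \<subseteq> W"
      using AW W_mult by (auto simp: quotients_def divide_inverse)
    then show False using subfield_not_subset[OF WU] by blast
  qed
  then have ex: "\<exists>n::nat. 0 < n \<and> of_int (int n) \<in> M" by (metis zero_less_imp_eq_int of_nat_0_less_iff)
  define n where "n = (LEAST n::nat. 0 < n \<and> of_int (int n) \<in> M)"
  have n: "0 < n" "of_int (int n) \<in> M" using LeastI_ex[OF ex] unfolding n_def by blast+
  have least: "\<not> (0 < l \<and> of_int (int l) \<in> M)" if "l < n" for l
    using not_less_Least[OF that[unfolded n_def]] .
  define p :: 'a where "p = of_int (int n)"
  have p: "p \<in> M" "p \<noteq> 0" using n of_int_0[of "int n"] by (simp_all add: p_def)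
  have M_dvd: "int n dvd a" if a: "of_int a \<in> M" for a
  proof -
    have "of_int a - p * of_int (a div int n) \<in> M" using a p AW by (intro M_diff M_mult2) auto
    moreover have "of_int a - p * of_int (a div int n) = (of_int (a mod int n) :: 'a)"
      by (metis of_int_diff of_int_mult minus_mult_div_eq_mod p_def)
    ultimately have "of_int (int (nat (a mod int n))) \<in> M" using n(1) by simp
    moreover have "nat (a mod int n) < n" using n(1) by (simp add: nat_less_iff)
    ultimately have "nat (a mod int n) = 0" using least[of "nat (a mod int n)"] by auto
    then show ?thesis using n(1) pos_mod_sign[of "int n" a] unfolding dvd_eq_mod_eq_0 by linarith
  qed
  have n1: "n \<noteq> 1" using n(2) M_1 by auto
  have strip: "\<exists>k b. b \<in> range of_int - M \<and> of_int a = p ^ k * b" if "a \<noteq> 0" for a :: int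
    using that
  proof (induction "nat \<bar>a\<bar>" arbitrary: a rule: less_induct)
    case less
    show ?case
    proof (cases "(of_int a :: 'a) \<in> M")
      case False
      then show ?thesis by (intro exI[of _ 0] exI[of _ "of_int a"]) auto
    next
      case True
      then obtain c where c: "a = int n * c" using M_dvd unfolding dvd_def by blast
      then have "c \<noteq> 0" using less.prems by auto
      moreover have "nat \<bar>c\<bar> < nat \<bar>a\<bar>" using c \<open>c \<noteq> 0\<close> n(1) n1 by (simp add: abs_mult)
      ultimately obtain k b where "b \<in> range of_int - M" "of_int c = p ^ k * b" using less.hyps by blast
      then show ?thesis by (intro exI[of _ "Suc k"] exI[of _ b]) (auto simp: c p_def)
    qed
  qed
  have pl: "prime_localization (range of_int :: 'a set) (of_int 2)"
    "prime_localization (range of_int :: 'a set) (of_int 3)"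
    by (rule prime_localization_int[OF inj], simp)+
  show ?thesis
  proof (rule prescribed_lengths_if_global[OF refl prime_localization.A[OF pl(1)] AW p _ _ _ pl])
    fix a :: 'a assume a: "a \<in> range of_int" "a \<noteq> 0"
    then obtain m where "a = of_int m" by blast
    moreover from this have "m \<noteq> 0" using a(2) by auto
    ultimately show "\<exists>k b. b \<in> range of_int - M \<and> a = p ^ k * b" using strip by blast
  next
    show "finite (of_int ` {0..<int n} :: 'a set)" by simp
    fix a :: 'a assume "a \<in> range of_int"
    then obtain m where m: "a = of_int m" by blast
    have "a - of_int (m mod int n) = p * of_int (m div int n)"
      unfolding m p_def of_int_mult[symmetric] of_int_diff[symmetric] by (simp add: minus_mod_eq_mult_div)
    moreover have "p * of_int (m div int n) \<in> M" using AW by (intro M_mult2 p(1)) auto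
    ultimately have "a - of_int (m mod int n) \<in> M" by simp
    moreover have "m mod int n \<in> {0..<int n}" using n(1) by simp
    ultimately show "\<exists>s\<in>of_int ` {0..<int n}. a - s \<in> M" by blast
  next
    show "of_int 2 \<notin> (*) (of_int 3 :: 'a) ` range of_int"
    proof
      assume "of_int 2 \<in> (*) (of_int 3 :: 'a) ` range of_int"
      then obtain c :: int where "of_int 2 = (of_int 3 * of_int c :: 'a)" by blast
      then have "of_int 2 = (of_int (3 * c) :: 'a)" by (simp only: of_int_mult)
      then have "2 = 3 * c" using inj by (metis injD)
      then show False by presburger
    qed
  qed
qed

lemma prescribed_lengths_global_field:
  assumes K: "global_field (UNIV :: 'a::field set)" and V: "valuation_ring_of (UNIV :: 'a set) V" "V \<noteq> UNIV"
  shows "prescribed_lengths V"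
proof -
  interpret V: valuation_ring_UNIV V
    using valuation_subring_of_valuation[OF V(1)] by (simp add: valuation_ring_UNIV_def)
  show ?thesis
    using K unfolding global_field_def
  proof (elim disjE exE conjE)
    assume char: "CHAR('a) = 0" and ext: "finite_extension {of_int a / of_int b |a b. b \<noteq> 0} (UNIV :: 'a set)"
    have "of_int b = (0::'a) \<longleftrightarrow> b = 0" for b
      using of_int_eq_0_iff_char_dvd[where 'a = 'a, of b] char by simp
    then have "{of_int a / of_int b |a b. b \<noteq> 0} = quotients (range (of_int :: int \<Rightarrow> 'a))"
      unfolding quotients_def by fastforce
    then show ?thesis using V.prescribed_lengths_number_field[OF char V(2)] ext by simp
  next
    fix F T L assume F: "finite F" and L: "purely_transcendental F {T} L" "finite_extension L (UNIV :: 'a set)"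
    have Fs: "is_subfield F" using L(1) by (simp add: purely_transcendental_def)
    \<comment> \<open>With a single variable, removing it leaves only the constants as coefficient
      ring.\<close>
    have R: "mpoly_value ` mpoly_over F {} = F"
      using subset_mpoly_values(1)[OF Fs, of "{}"] mpoly_values_least[OF Fs subfield_subring[OF Fs], of "{}"] by auto
    have T: "transcendental_over F T" "L = quotients (adjoin F T)"
      using purely_transcendental_eq_quotients[OF L(1), of T] R by simp_all
    show ?thesis
    proof (cases "T \<in> V")
      case True
      then show ?thesis using V.prescribed_lengths_function_field[OF Fs F T(1)] L(2) T(2) V(2) by simp
    next
      case False
      then have "inverse T \<in> V" using V.not_in_imp_inverse_M V.M_W by blast
      then show ?thesis
        using V.prescribed_lengths_function_field[OF Fs F adjoin_inverse(1)[OF Fs T(1)]]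
          adjoin_inverse(2)[OF Fs T(1)] L(2) T(2) V(2) by simp
    qed
  qed
qed

section \<open>The two cases with a given discrete valuation domain\<close>

lemma finite_extension_refl: "finite_extension (UNIV :: 'a::field set) UNIV"
  unfolding finite_extension_def
proof (intro conjI exI[of _ "{1}"] ballI)
  show "\<exists>c. (\<forall>b\<in>{1}. c b \<in> UNIV) \<and> x = (\<Sum>b\<in>{1}. c b * b)" for x :: 'a
    by (intro exI[of _ "\<lambda>_. x"]) simp
qed (auto simp: subfield_UNIV)

text \<open>Any one of the variables supplies the coprime primes \<open>T\<close> and
  \<open>T - 1\<close>; the field is regarded as a finite extension of itself.\<close>

lemma prescribed_lengths_purely_transcendental:
  assumes V: "discrete_valuation_ring_of (UNIV :: 'a::field set) V" "finite_residue_field V"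
    and K: "purely_transcendental F B (UNIV :: 'a set)" "B \<noteq> {}"
  shows "prescribed_lengths V"
proof -
  obtain v where v: "discrete_valuation v" "V = discrete_valuation.val_ring v"
    using discrete_valuation_of_ring[OF V(1)] by blast
  interpret V: valuation_ring_UNIV V unfolding v(2) by (rule discrete_valuation.valuation_ring_UNIV[OF v(1)])
  obtain S where S: "finite S" "\<And>x. x \<in> V \<Longrightarrow> \<exists>s\<in>S. x - s \<in> nonunits V" using V.finite_residues[OF V(2)] by blast
  obtain T where "T \<in> B" using K(2) by blast
  then obtain R where T: "transcendental_over R T" "UNIV = quotients (adjoin R T)"
    using purely_transcendental_eq_quotients[OF K(1)] by blast
  have ext: "finite_extension (quotients (adjoin R T)) (UNIV :: 'a set)"
    using finite_extension_refl T(2) by simp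
  have "prime_localization (adjoin R T) (T - 1)"
    using prime_localization_adjoin[OF transcendental_minus_one(1)[OF T(1)]]
      transcendental_minus_one(2)[OF T(1)] by simp
  then show ?thesis
    using prescribed_lengths_from_two_primes[OF v S(1) _ ext prime_localization_adjoin[OF T(1)] _
        transcendental_minus_one(3)[OF T(1)]] S(2) by blast
qed

lemma prescribed_lengths_finite_extension:
  assumes V: "discrete_valuation_ring_of (UNIV :: 'a::field set) V" "finite_residue_field V"
    and L: "finite_extension L (UNIV :: 'a set)" and W: "valuation_ring_of L W"
    and indep: "independent_in L W (V \<inter> L)"
    and pf: "nonzero_principal_maximal_ideal W \<or> finite_residue_field W"
  shows "prescribed_lengths V"
proof -
  obtain v where v: "discrete_valuation v" "V = discrete_valuation.val_ring v"
    using discrete_valuation_of_ring[OF V(1)] by blast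
  interpret V: valuation_ring_UNIV V unfolding v(2) by (rule discrete_valuation.valuation_ring_UNIV[OF v(1)])
  interpret V: finite_over_subfield V L using L by unfold_locales
  interpret W: valuation_subring L W by (rule valuation_subring_of_valuation[OF W])
  obtain S where S: "finite S" "\<And>x. x \<in> V \<Longrightarrow> \<exists>s\<in>S. x - s \<in> nonunits V" using V.finite_residues[OF V(2)] by blast
  \<comment> \<open>An inclusion would confine the ring generated by both, which is
    \<open>L\<close>, to \<open>V\<close>; but a proper valuation ring cannot contain a subfield of
    finite degree.\<close>
  have "\<not> W \<subseteq> V"
  proof
    assume "W \<subseteq> V"
    moreover have "is_subring (V \<inter> L)"
      using V.W subfield_subring[OF V.K] by (auto simp: is_subring_def)
    ultimately have "subring_generated (W \<union> (V \<inter> L)) \<subseteq> V \<inter> L"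
      unfolding subring_generated_def using W.WL by blast
    then have "L \<subseteq> V" using indep unfolding independent_in_def by blast
    then show False
      using V.subfield_not_subset discrete_valuation.val_ring_not_UNIV[OF v(1)] v(2) by blast
  qed
  moreover have "principal_or_finite W"
    unfolding principal_or_finite_def using pf W.principal_generator W.finite_residues by blast
  ultimately show ?thesis
    using prescribed_lengths_if_independent[OF v S(1) _ L W.valuation_subring_axioms] S(2) by blast
qed

theorem corollary5p4:
  fixes V :: "'a::field set" and k :: nat and n :: "nat \<Rightarrow> nat"
  assumes "is_subring V" and "is_quotient_field V UNIV"
    and "(global_field (UNIV :: 'a set) \<and> valuation_ring_of UNIV V \<and> V \<noteq> UNIV)
       \<or> (discrete_valuation_ring_of UNIV V \<and> finite_residue_field V \<and>
           (\<exists>F B. B \<noteq> {} \<and> purely_transcendental F B (UNIV :: 'a set)))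
       \<or> (discrete_valuation_ring_of UNIV V \<and> finite_residue_field V \<and>
           (\<exists>L W. finite_extension L (UNIV :: 'a set) \<and> valuation_ring_of L W \<and>
                  independent_in L W (V \<inter> L) \<and>
                  (nonzero_principal_maximal_ideal W \<or> finite_residue_field W)))"
    and "k > 0" and "\<forall>i\<in>{1..k}. 1 < n i" and "mono_on {1..k} n"
  shows "\<exists>H \<in> Int_poly V. \<exists>A :: nat \<Rightarrow> 'a poly list.
           (\<forall>i\<in>{1..k}. factorization_in (Int_poly V) H (A i) \<and> length (A i) = n i) \<and>
           (\<forall>i\<in>{1..k}. \<forall>j\<in>{1..k}. i \<noteq> j \<longrightarrow> \<not> essentially_same_in (Int_poly V) (A i) (A j)) \<and>
           (\<forall>us. factorization_in (Int_poly V) H us \<longrightarrow>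
                  (\<exists>i\<in>{1..k}. essentially_same_in (Int_poly V) (A i) us))"
proof -
  have "prescribed_lengths V"
    using assms(3) prescribed_lengths_global_field prescribed_lengths_purely_transcendental
      prescribed_lengths_finite_extension by blast
  then show ?thesis using assms(4,5) unfolding prescribed_lengths_def by blast
qed

end
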